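(* Let $D$ be a virtual spatial graph diagram and let $D^p$ be the virtual link diagram associated with $D$ with projector $P_2$. Then $$R(D;A^4,-d^{-1})=d\,\langle D^p\rangle(A,A^{-1},d),$$ where $d=-A^{2}-A^{-2}$, $R(D;\alpha,x)$ is the generalized Yamada polynomial (evaluated at $\alpha=A^4$, $x=-d^{-1}$), and $\langle\cdot\rangle$ is the bracket polynomial.
   Context: **Diagrams.** A virtual spatial graph diagram is a finite graph (loops, multiple edges and circle components without vertices allowed) generically immersed in $\mathbb{R}^2$ whose transverse double points are each labeled as a classical crossing (with over/under information) or a virtual crossing (no over/under information). A virtual link diagram is one with no vertices. **Generalized Yamada polynomial.** A cyclic graph is an abstract graph with a cyclic ordering of the half-edges at each vertex; it determines an orientable ribbon graph (a disk for each vertex, with untwisted bands attached in the given cyclic orders). A diagram without classical crossings is regarded as a cyclic graph, with cyclic orders given by the orientation of the plane and virtual crossings ignored. Let $k$ be the number of connected components and $bc$ the number of boundary components of the associated ribbon graph. At a classical crossing, $s_+$ is the A-smoothing (joining the two regions swept out by rotating the over-strand counterclockwise until it meets the under-strand), $s_-$ is the other smoothing (B-smoothing), and $s_0$ is the replacement of the crossing by a 4-valent vertex. The polynomial $R(D)=R(D;\alpha,x)\in\mathbb{Z}[\alpha^{\pm1},x^{\pm1}]$ is determined by: (1) absorbing or inserting degree-2 vertices on edges or circle components does not change $R$; (2) $R(D)=\alpha R(D_{s_+})+\alpha^{-1}R(D_{s_-})+x^{-1}R(D_{s_0})$ for the three replacements at any classical crossing; (3) for an unmarked edge $e$ carrying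 no classical crossings, $R(D)=x\,R(D-e)+R(D(\overline e))$, where $D-e$ is deletion of $e$ and $D(\overline e)$ is $D$ with $e$ kept and marked; (4) if $D$ is a cyclic graph all of whose edges are marked, then $R(D)=(-x)^{bc(D)-2k(D)}(\alpha+\alpha^{-1}+2)^{bc(D)-k(D)}$; in particular $n$ isolated vertices have value $(-x)^{-n}$, and $R(\emptyset)=1$. **Bracket.** For a virtual link diagram $E$, $\langle E\rangle(A,B,d)=\sum_\sigma A^{\alpha(\sigma)}B^{\beta(\sigma)}d^{|\sigma|-1}$, where $\sigma$ runs over all choices of an A- or B-smoothing at each classical crossing, $\alpha(\sigma)$ and $\beta(\sigma)$ are the numbers of A- and B-smoothings, and $|\sigma|$ is the number of closed curves of $\sigma$ (virtual crossings are ignored when counting curves). It is extended linearly to formal linear combinations of diagrams. **Projector and $D^p$.** In the 2-strand Temperley–Lieb algebra (loop value $d$), $P_2=1_2-\frac1d e_1$, where $1_2$ is two parallel strands and $e_1$ is a cup–cap pair; thus $P_2^2=P_2$ and $P_2e_1=0$. The arcs of $D$ are the pieces of its edges that start and end at classical crossings and vertices (virtual crossings do not cut arcs). $D^p$ is obtained from $D$ by replacing every arc by two parallel strands with two copies of $P_2$ inserted; every classical crossing by its 2-cable (four classical crossings with the same over/under information); every virtual crossing by four virtual crossings; and, at every vertex, by joining for each pair of cyclically consecutive half-edges the two neighbouring strands by an arc (so a degree-$n$ vertex gives $n$ such arcs following the boundary of the vertex disk, and an isolated vertex gives a circle). A circle component with no vertices or classical crossings is doubled with $P_2$ inserted. $D^p$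 denotes the linear combination of virtual link diagrams obtained by expanding all copies of $P_2$. *)

theory Defs
  imports Complex_Main "HOL-Library.Poly_Mapping" "HOL-Library.Product_Plus"
begin

section \<open>Virtual spatial graph diagrams\<close>

text \<open>
  A diagram is given by its special points (nodes) and by the segments joining them. The half-edges
  at a node are listed in counterclockwise order; a segment is a pair of half-edges matched
  by \<open>mate\<close>.

  \<^item> \<open>Vertex hs\<close>: a vertex of the graph, isolated if \<open>hs\<close> is empty.
  \<^item> \<open>Crossing a b c d\<close>: a classical crossing; the over-strand is \<open>a\<close>--\<open>c\<close>, the under-strand
    \<open>b\<close>--\<open>d\<close>.
  \<^item> \<open>Virtual a b c d\<close>: a virtual crossing of the strands \<open>a\<close>--\<open>c\<close> and \<open>b\<close>--\<open>d\<close>.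
  \<^item> \<open>Point p q\<close>: a regular point of an edge or circle, not a vertex of the graph. It does not cut
    arcs or edges; it is needed to write down circle components without vertices
    (the free circle is \<open>Point p q\<close> with \<open>mate p = q\<close>) and smoothed crossings.

  Planarity of the rotation system is not required, so the plane diagrams are contained in, but do
  not exhaust, the class considered here. (Drawing a non-planar one in the plane only creates further
  virtual crossings.) The encoding of a diagram is not unique: the order of the list of nodes, the
  names of the half-edges and the number of \<open>Point\<close>s are immaterial.
\<close>

datatype 'h node =
    Vertex "'h list"
  | Crossing 'h 'h 'h 'h
  | Virtual 'h 'h 'h 'h
  | Point 'h 'h

datatype 'h diagram = Diagram (nodes: "'h node list") (mate: "'h \<Rightarrow> 'h")

fun node_half_edges :: "'h node \<Rightarrow> 'h list" where
  "node_half_edges (Vertex hs) = hs"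
| "node_half_edges (Crossing a b c d) = [a, b, c, d]"
| "node_half_edges (Virtual a b c d) = [a, b, c, d]"
| "node_half_edges (Point p q) = [p, q]"

definition half_edges :: "'h diagram \<Rightarrow> 'h set" where
  "half_edges D = (\<Union>n\<in>set (nodes D). set (node_half_edges n))"

fun is_vertex :: "'h node \<Rightarrow> bool" where
  "is_vertex (Vertex hs) = True"
| "is_vertex _ = False"

fun is_crossing :: "'h node \<Rightarrow> bool" where
  "is_crossing (Crossing a b c d) = True"
| "is_crossing _ = False"

definition vertex_half_edges :: "'h diagram \<Rightarrow> 'h set" where
  "vertex_half_edges D = (\<Union>n\<in>{n \<in> set (nodes D). is_vertex n}. set (node_half_edges n))"

definition crossing_half_edges :: "'h diagram \<Rightarrow> 'h set" where
  "crossing_half_edges D = (\<Union>n\<in>{n \<in> set (nodes D). is_crossing n}. set (node_half_edges n))"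

text \<open>The classes of the equivalence relation on \<open>X\<close> generated by \<open>r\<close> (for \<open>r \<subseteq> X \<times> X\<close>).\<close>

definition classes :: "'b set \<Rightarrow> ('b \<times> 'b) set \<Rightarrow> 'b set set" where
  "classes X r = X // (r \<union> r\<inverse>)\<^sup>*"

text \<open>The pairs of half-edges that are opposite to each other, on a common strand.\<close>

fun opposite :: "'h node \<Rightarrow> ('h \<times> 'h) set" where
  "opposite (Vertex hs) = {}"
| "opposite (Crossing a b c d) = {(a, c), (b, d)}"
| "opposite (Virtual a b c d) = {(a, c), (b, d)}"
| "opposite (Point p q) = {(p, q)}"

definition strand_rel :: "'h diagram \<Rightarrow> ('h \<times> 'h) set" where
  "strand_rel D = {(h, mate D h) | h. h \<in> half_edges D} \<union> (\<Union>n\<in>set (nodes D). opposite n)"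

text \<open>
  The edges and the circle components of the immersed graph, each given by the set of the half-edges
  on it: strands run straight through crossings and end at vertices only.
\<close>

definition strands :: "'h diagram \<Rightarrow> 'h set set" where
  "strands D = classes (half_edges D) (strand_rel D)"

definition edges :: "'h diagram \<Rightarrow> 'h set set" where
  "edges D = {e \<in> strands D. e \<inter> vertex_half_edges D \<noteq> {}}"

definition free_circles :: "'h diagram \<Rightarrow> 'h set set" where
  "free_circles D =
     {C \<in> strands D. C \<inter> (vertex_half_edges D \<union> crossing_half_edges D) = {}}"

text \<open>
  The last condition is a convention of the encoding: a circle component without vertices and
  classical crossings carries at least one \<open>Point\<close>, at which a degree-2 vertex may be inserted.
\<close>

definition is_diagram :: "'h diagram \<Rightarrow> bool" where
  "is_diagram D \<longleftrightarrow>
     distinct (concat (map node_half_edges (nodes D))) \<and>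
     (\<forall>h\<in>half_edges D. mate D h \<in> half_edges D \<and> mate D h \<noteq> h \<and> mate D (mate D h) = h) \<and>
     (\<forall>C\<in>free_circles D. \<exists>p q. Point p q \<in> set (nodes D) \<and> p \<in> C)"

text \<open>
  The set of marked edges is represented by the set \<open>M\<close> of all half-edges on them. Only strands
  without classical crossings are ever marked.
\<close>

definition is_marking :: "'h diagram \<Rightarrow> 'h set \<Rightarrow> bool" where
  "is_marking D M \<longleftrightarrow>
     M \<subseteq> half_edges D \<and> M \<inter> crossing_half_edges D = {} \<and>
     (\<forall>e\<in>strands D. e \<subseteq> M \<or> e \<inter> M = {})"

section \<open>Smoothings, deletion of edges, and ribbon graphs\<close>

text \<open>
  Rotating the over-strand \<open>a\<close>--\<open>c\<close> of \<open>Crossing a b c d\<close> counterclockwise onto the under-strand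
  sweeps out the region between \<open>a\<close> and \<open>b\<close> and the region between \<open>c\<close> and \<open>d\<close>; the A-smoothing
  joins these two regions, so its arcs connect \<open>b\<close> with \<open>c\<close> and \<open>d\<close> with \<open>a\<close>.
\<close>

fun smoothA :: "'h node \<Rightarrow> 'h node list" where
  "smoothA (Crossing a b c d) = [Point b c, Point d a]"
| "smoothA n = [n]"

fun smoothB :: "'h node \<Rightarrow> 'h node list" where
  "smoothB (Crossing a b c d) = [Point a b, Point c d]"
| "smoothB n = [n]"

text \<open>
  Deletion of the edge \<open>e\<close>, which carries no classical crossings. The end vertices stay, and a
  virtual crossing that loses one of its strands becomes a regular point of the other one.
\<close>

fun delete_node :: "'h set \<Rightarrow> 'h node \<Rightarrow> 'h node list" where
  "delete_node e (Vertex hs) = [Vertex (filter (\<lambda>h. h \<notin> e) hs)]"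
| "delete_node e (Crossing a b c d) = [Crossing a b c d]"
| "delete_node e (Virtual a b c d) =
     (if a \<in> e \<and> b \<in> e then []
      else if a \<in> e then [Point b d]
      else if b \<in> e then [Point a c]
      else [Virtual a b c d])"
| "delete_node e (Point p q) = (if p \<in> e then [] else [Point p q])"

definition delete_edge :: "'h diagram \<Rightarrow> 'h set \<Rightarrow> 'h diagram" where
  "delete_edge D e = Diagram (concat (map (delete_node e) (nodes D))) (mate D)"

text \<open>The pairs of cyclically consecutive elements; \<open>(h, h)\<close> for a singleton list.\<close>

definition consecutive :: "'h list \<Rightarrow> ('h \<times> 'h) list" where
  "consecutive hs = zip hs (rotate1 hs)"

definition isolated_vertices :: "'h diagram \<Rightarrow> nat" where
  "isolated_vertices D = count_list (nodes D) (Vertex [])"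

fun vertex_rel :: "'h node \<Rightarrow> ('h \<times> 'h) set" where
  "vertex_rel (Vertex hs) = set (consecutive hs)"
| "vertex_rel _ = {}"

text \<open>
  \<open>num_components D\<close> and \<open>num_boundaries D\<close> are the numbers of connected components and of boundary components of the ribbon
  graph of a diagram without classical crossings.
\<close>

definition num_components :: "'h diagram \<Rightarrow> nat" where
  "num_components D = card (classes (half_edges D)
                 (strand_rel D \<union> (\<Union>n\<in>set (nodes D). vertex_rel n)))
         + isolated_vertices D"

text \<open>
  A half-edge of a band has two boundary sides, the clockwise and the counterclockwise one as seen
  from the node it belongs to. As bands are untwisted, the counterclockwise side of one end of a
  band continues as the clockwise side of its other end, and also as the
  clockwise side of the opposite half-edge when the band passes a virtual crossing or a regular
  point. Along the boundary of a vertex disk, the counterclockwise side of a half-edge is joined to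
  the clockwise side of the next one. The disk of an isolated vertex has one boundary component.
\<close>

datatype side = Cw | Ccw

fun flip :: "side \<Rightarrow> side" where
  "flip Cw = Ccw"
| "flip Ccw = Cw"

definition boundary_rel :: "'h diagram \<Rightarrow> (('h \<times> side) \<times> ('h \<times> side)) set" where
  "boundary_rel D =
     {((h, s), (h', flip s)) | h h' s. (h, h') \<in> strand_rel D} \<union>
     {((h, Ccw), (h', Cw)) | h h'. (h, h') \<in> (\<Union>n\<in>set (nodes D). vertex_rel n)}"

definition num_boundaries :: "'h diagram \<Rightarrow> nat" where
  "num_boundaries D = card (classes (half_edges D \<times> UNIV) (boundary_rel D)) + isolated_vertices D"

section \<open>The generalized Yamada polynomial\<close>

text \<open>
  The ring of integral Laurent polynomials in two variables, as the group ring of the lattice of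
  exponent vectors; the element \<open>Poly_Mapping.single (i, j) 1\<close> is the monomial with
  exponent \<open>i\<close> of \<open>\<alpha>\<close> and exponent \<open>j\<close> of \<open>x\<close>.
\<close>

type_synonym laurent = "(int \<times> int) \<Rightarrow>\<^sub>0 int"

definition alpha_pow :: "int \<Rightarrow> laurent" where
  "alpha_pow i = Poly_Mapping.single (i, 0) 1"

definition x_pow :: "int \<Rightarrow> laurent" where
  "x_pow j = Poly_Mapping.single (0, j) 1"

definition minus_x_pow :: "int \<Rightarrow> laurent" where
  "minus_x_pow j = (if even j then x_pow j else - x_pow j)"

definition laurent_eval :: "'a::field \<Rightarrow> 'a \<Rightarrow> laurent \<Rightarrow> 'a" where
  "laurent_eval \<alpha> x p =
     (\<Sum>(i, j)\<in>Poly_Mapping.keys p.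
        of_int (Poly_Mapping.lookup p (i, j)) * \<alpha> powi i * x powi j)"

text \<open>
  The rules determining the polynomial. A degree-2 vertex \<open>Vertex [p, q]\<close> on an edge or circle is
  absorbed by turning it into the regular point \<open>Point p q\<close>, and inserted the other way round. \<open>R D M\<close> is its value on the diagram \<open>D\<close> with the edges
  in \<open>M\<close> marked, \<open>R D {}\<close> the value on \<open>D\<close> itself. Deletion is for edges only: on a circle
  component one first has to insert a vertex. In the last rule, \<open>num_boundaries D - num_components D\<close> is a natural number as
  every component has a boundary component.
\<close>

locale generalized_yamada =
  fixes R :: "'h diagram \<Rightarrow> 'h set \<Rightarrow> laurent"
  assumes degree_2_vertex:
    "\<lbrakk>is_diagram (Diagram (ns1 @ Vertex [p, q] # ns2) m);
      is_marking (Diagram (ns1 @ Vertex [p, q] # ns2) m) M; p \<in> M \<longleftrightarrow> q \<in> M\<rbrakk> \<Longrightarrow>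
     R (Diagram (ns1 @ Vertex [p, q] # ns2) m) M = R (Diagram (ns1 @ Point p q # ns2) m) M"
  and classical_crossing:
    "\<lbrakk>is_diagram (Diagram (ns1 @ Crossing a b c d # ns2) m);
      is_marking (Diagram (ns1 @ Crossing a b c d # ns2) m) M\<rbrakk> \<Longrightarrow>
     R (Diagram (ns1 @ Crossing a b c d # ns2) m) M =
       alpha_pow 1 * R (Diagram (ns1 @ smoothA (Crossing a b c d) @ ns2) m) M
       + alpha_pow (-1) * R (Diagram (ns1 @ smoothB (Crossing a b c d) @ ns2) m) M
       + x_pow (-1) * R (Diagram (ns1 @ Vertex [a, b, c, d] # ns2) m) M"
  and unmarked_edge:
    "\<lbrakk>is_diagram D; is_marking D M; e \<in> edges D; e \<inter> M = {}; e \<inter> crossing_half_edges D = {}\<rbrakk> \<Longrightarrow>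
     R D M = x_pow 1 * R (delete_edge D e) M + R D (M \<union> e)"
  and cyclic_graph:
    "\<lbrakk>is_diagram D; \<forall>n\<in>set (nodes D). \<not> is_crossing n\<rbrakk> \<Longrightarrow>
     R D (half_edges D) =
       minus_x_pow (int (num_boundaries D) - 2 * int (num_components D))
       * (alpha_pow 1 + alpha_pow (-1) + 2) ^ (num_boundaries D - num_components D)"

section \<open>The bracket polynomial of virtual link diagrams\<close>

definition crossings :: "'h diagram \<Rightarrow> nat set" where
  "crossings E = {i. i < length (nodes E) \<and> is_crossing (nodes E ! i)}"

text \<open>The state with A-smoothings at the crossings in \<open>S\<close> and B-smoothings at all other crossings.\<close>

definition resolve :: "nat set \<Rightarrow> 'h diagram \<Rightarrow> 'h diagram" where
  "resolve S E =
     Diagram (concat (map (\<lambda>i. if i \<in> S then smoothA (nodes E ! i) else smoothB (nodes E ! i))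
                        [0..<length (nodes E)]))
       (mate E)"

text \<open>
  In a diagram without vertices and classical crossings, the strands are the closed curves. The
  exponent is an integer as the empty diagram has a state without curves.
\<close>

definition bracket :: "'a::field \<Rightarrow> 'a \<Rightarrow> 'a \<Rightarrow> 'h diagram \<Rightarrow> 'a" where
  "bracket A B d E =
     (\<Sum>S\<in>Pow (crossings E).
        A ^ card S * B ^ card (crossings E - S) * d powi (int (card (strands (resolve S E))) - 1))"

definition linear_bracket :: "'a::field \<Rightarrow> 'a \<Rightarrow> 'a \<Rightarrow> ('h diagram \<Rightarrow>\<^sub>0 'a) \<Rightarrow> 'a" where
  "linear_bracket A B d L =
     (\<Sum>E\<in>Poly_Mapping.keys L. Poly_Mapping.lookup L E * bracket A B d E)"

section \<open>The virtual link diagram with projectors\<close>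

text \<open>
  Every half-edge \<open>h\<close> of \<open>D\<close> becomes two parallel strands, the clockwise and the counterclockwise
  one as seen from the node of \<open>h\<close>. Going from the middle of the segment towards the node, each of
  them passes the half-edges \<open>Far\<close> and \<open>Near\<close> of a box and then \<open>Tip\<close>, at the node. The box holds
  the identity or, if \<open>h\<close> is the site of a projector, one of the two terms of the projector.
  If the node is a crossing, then the segment that runs across below \<open>h\<close>, between two of the four
  crossings of the 2-cable, consists of the half-edges \<open>Core\<close>, those on the clockwise and on the
  counterclockwise side of \<open>h\<close>. The labels \<open>Iso i\<close> are for the circle around an isolated vertex at
  position \<open>i\<close> in the list of nodes.
\<close>

datatype level = Far | Near | Tip | Core

datatype 'h cable = Strand 'h side level | Iso nat side

fun cable_mate :: "('h \<Rightarrow> 'h) \<Rightarrow> 'h cable \<Rightarrow> 'h cable" where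
  "cable_mate m (Strand h s Far) = Strand (m h) (flip s) Far"
| "cable_mate m (Strand h s Near) = Strand h s Tip"
| "cable_mate m (Strand h s Tip) = Strand h s Near"
| "cable_mate m (Strand h s Core) = Strand h (flip s) Core"
| "cable_mate m (Iso i s) = Iso i (flip s)"

text \<open>
  The four crossings of a 2-cabled crossing, \<open>X\<close> being \<open>Crossing\<close> or \<open>Virtual\<close>. With \<open>a\<close>, \<open>b\<close>,
  \<open>c\<close>, \<open>d\<close> in the east, north, west and south, they are the crossings in the north-east,
  north-west, south-west and south-east, each with its half-edges listed from the east on.
\<close>

definition cable_crossing ::
    "('h cable \<Rightarrow> 'h cable \<Rightarrow> 'h cable \<Rightarrow> 'h cable \<Rightarrow> 'h cable node) \<Rightarrow>
     'h \<Rightarrow> 'h \<Rightarrow> 'h \<Rightarrow> 'h \<Rightarrow> 'h cable node list" where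
  "cable_crossing X a b c d =
     [X (Strand a Ccw Tip) (Strand b Cw Tip) (Strand b Cw Core) (Strand a Ccw Core),
      X (Strand b Ccw Core) (Strand b Ccw Tip) (Strand c Cw Tip) (Strand c Cw Core),
      X (Strand d Cw Core) (Strand c Ccw Core) (Strand c Ccw Tip) (Strand d Cw Tip),
      X (Strand a Cw Tip) (Strand a Cw Core) (Strand d Ccw Core) (Strand d Ccw Tip)]"

fun cable_node :: "nat \<Rightarrow> 'h node \<Rightarrow> 'h cable node list" where
  "cable_node i (Vertex hs) =
     (if hs = [] then [Point (Iso i Cw) (Iso i Ccw)]
      else map (\<lambda>(h, h'). Point (Strand h Ccw Tip) (Strand h' Cw Tip)) (consecutive hs))"
| "cable_node i (Crossing a b c d) = cable_crossing Crossing a b c d"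
| "cable_node i (Virtual a b c d) = cable_crossing Virtual a b c d"
| "cable_node i (Point p q) =
     [Point (Strand p Cw Tip) (Strand q Ccw Tip), Point (Strand p Ccw Tip) (Strand q Cw Tip)]"

definition identity_box :: "'h \<Rightarrow> 'h cable node list" where
  "identity_box h =
     [Point (Strand h Cw Near) (Strand h Cw Far), Point (Strand h Ccw Near) (Strand h Ccw Far)]"

definition cup_cap_box :: "'h \<Rightarrow> 'h cable node list" where
  "cup_cap_box h =
     [Point (Strand h Cw Near) (Strand h Ccw Near), Point (Strand h Cw Far) (Strand h Ccw Far)]"

text \<open>The doubled diagram, with a cup--cap pair on the half-edges in \<open>S\<close>.\<close>

definition cable_diagram :: "'h set \<Rightarrow> 'h diagram \<Rightarrow> 'h cable diagram" where
  "cable_diagram S D =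
     Diagram
       (concat (map (\<lambda>i. cable_node i (nodes D ! i)) [0..<length (nodes D)])
        @ concat (map (\<lambda>h. if h \<in> S then cup_cap_box h else identity_box h)
                    (concat (map node_half_edges (nodes D)))))
       (cable_mate (mate D))"

text \<open>
  The half-edges where a projector is inserted: one at each of the two ends of every arc, which are
  the half-edges at vertices and classical crossings, and one anywhere on every circle component
  without vertices and classical crossings.
\<close>

definition projector_sites :: "'h diagram \<Rightarrow> 'h set" where
  "projector_sites D =
     vertex_half_edges D \<union> crossing_half_edges D \<union> (\<lambda>C. SOME h. h \<in> C) ` free_circles D"

text \<open>
  The linear combination of virtual link diagrams obtained by expanding the projectors
  \<open>P\<^sub>2 = 1\<^sub>2 - (1/d) e\<^sub>1\<close> at all sites.
\<close>

definition projected_diagram :: "'a::field \<Rightarrow> 'h diagram \<Rightarrow> ('h cable diagram \<Rightarrow>\<^sub>0 'a)" where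
  "projected_diagram d D =
     (\<Sum>S\<in>Pow (projector_sites D). Poly_Mapping.single (cable_diagram S D) ((- (1 / d)) ^ card S))"

end

theory Submission
  imports Defs
begin

text \<open>
  Both sides of the theorem count closed curves. At \<open>\<alpha> = A\<^sup>4\<close> and \<open>x = -1/d\<close> one has \<open>-x = 1/d\<close> and
  \<open>\<alpha> + \<alpha>\<inverse> + 2 = (A\<^sup>2 + A\<^sup>-\<^sup>2)\<^sup>2 = d\<^sup>2\<close>, so the value of a fully marked cyclic graph becomes
  \<open>d\<^sup>b\<^sup>c\<close>, and \<open>bc\<close> is the number of curves of the doubled diagram, which runs along the boundary of
  the ribbon graph. It remains to see that the doubled diagram with projectors obeys the
  crossing rule and the edge rule.

  \<^emph>\<open>Crossings.\<close> The 2-cable of a crossing has sixteen smoothings. One that turns a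
  half-edge back on itself is annihilated by the projector on that half-edge, because the cup-cap
  term of the projector then has one curve more than the identity term (\<open>project_turnback\<close>). Seven
  smoothings remain: the two doubled smoothings with coefficients \<open>A\<^sup>4\<close> and \<open>A\<^sup>-\<^sup>4\<close>, and
  five with the pattern of a doubled 4-valent vertex, whose coefficients add up to
  \<open>d + 2 A\<^sup>2 + 2 A\<^sup>-\<^sup>2 = -d = x\<inverse>\<close> (\<open>project_crossing\<close>).

  \<^emph>\<open>Edges.\<close> Let an edge without classical crossings carry \<open>k \<ge> 1\<close> projectors. If all of them
  contribute the identity, the band of the edge is intact: this is the marked edge. If \<open>j \<ge> 1\<close> of
  them contribute a cup-cap pair, the band falls into \<open>j + 1\<close> pieces, the two outer ones can be
  retracted into the end vertices, and the \<open>j - 1\<close> inner ones are circles: this is the deleted edge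
  with the factor \<open>(-1/d)\<^sup>j d\<^sup>j\<^sup>-\<^sup>1\<close>. Summed over the nonempty sets of projectors these factors give
  \<open>-1/d = x\<close> for every \<open>k\<close> (\<open>cable_sum_edge\<close>).

  Since only \<open>k \<ge> 1\<close> matters, a smoothing may merge arcs without any adjustment of the projectors on
  them; this replaces the idempotence of the projector. The induction \<open>evaluate_eq_cable_sum\<close>
  therefore keeps the original sites of the projectors and asks only that the crossings and
  all unmarked strands carry sites and the marked ones carry none.

  Closed curves are counted as the components of a graph: the arcs inside the nodes and boxes are
  its unordered pairs \<open>{x, y}\<close>, the segments between nodes are given by a fixed involution. Every
  planar move of curves is then a sequence of two operations: shortening a curve (\<open>join\<close>)
  and removing a circle (\<open>circle\<close>).
\<close>

section \<open>Classes of generated equivalence relations\<close>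

abbreviation conn :: "('b \<times> 'b) set \<Rightarrow> ('b \<times> 'b) set" where
  "conn r \<equiv> (r \<union> r\<inverse>)\<^sup>*"

lemma conn_sym: "(x, y) \<in> conn r \<Longrightarrow> (y, x) \<in> conn r"
  by (rule symD[OF sym_rtrancl]) (auto simp: sym_def)

lemma conn_trans: "(x, y) \<in> conn r \<Longrightarrow> (y, z) \<in> conn r \<Longrightarrow> (x, z) \<in> conn r"
  by (rule rtrancl_trans)

lemma conn_step: "(x, y) \<in> r \<Longrightarrow> (x, y) \<in> conn r"
  by blast

lemma conn_class_eq_iff: "conn r `` {x} = conn r `` {y} \<longleftrightarrow> (x, y) \<in> conn r"
  by (auto intro: conn_trans conn_sym)

lemma classes_eq_image: "classes X r = (\<lambda>x. conn r `` {x}) ` X"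
  by (auto simp: classes_def quotient_def)

lemma finite_classes: "finite X \<Longrightarrow> finite (classes X r)"
  by (simp add: classes_eq_image)

lemma conn_map:
  assumes "(x, y) \<in> conn r" and step: "\<And>u v. (u, v) \<in> r \<Longrightarrow> (f u, f v) \<in> conn s"
  shows "(f x, f y) \<in> conn s"
  using assms(1)
proof (induction rule: rtrancl_induct)
  case (step y z)
  then show ?case using assms(2) by (meson UnE conn_sym conn_trans converseD)
qed simp

text \<open>
  The common source of the two comparisons of cardinalities below: \<open>g\<close> factors through \<open>f\<close>.
\<close>

lemma image_factors:
  assumes "\<And>x y. x \<in> X \<Longrightarrow> y \<in> X \<Longrightarrow> f x = f y \<Longrightarrow> g x = g y"
  shows "\<exists>\<phi>. \<forall>x\<in>X. \<phi> (f x) = g x"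
proof (intro exI ballI)
  fix x assume x: "x \<in> X"
  let ?y = "SOME y. y \<in> X \<and> f y = f x"
  have "?y \<in> X \<and> f ?y = f x"
    by (rule someI[of "\<lambda>y. y \<in> X \<and> f y = f x" x]) (use x in simp)
  then show "(\<lambda>u. g (SOME y. y \<in> X \<and> f y = u)) (f x) = g x"
    using assms[of ?y x] x by simp
qed

lemma card_image_eq_if_same_kernel:
  assumes "\<And>x y. x \<in> X \<Longrightarrow> y \<in> X \<Longrightarrow> f x = f y \<longleftrightarrow> g x = g y"
  shows "card (f ` X) = card (g ` X)"
proof -
  obtain \<phi> where "\<forall>x\<in>X. \<phi> (f x) = g x"
    using image_factors[of X f g, OF iffD1[OF assms]] by blast
  then have "bij_betw \<phi> (f ` X) (g ` X)"
    unfolding bij_betw_def inj_on_def using assms by (auto simp: image_iff)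
  then show ?thesis by (rule bij_betw_same_card)
qed

lemma card_image_le_if_finer:
  assumes "finite X" "\<And>x y. x \<in> X \<Longrightarrow> y \<in> X \<Longrightarrow> f x = f y \<Longrightarrow> g x = g y"
  shows "card (g ` X) \<le> card (f ` X)"
proof -
  obtain \<phi> where "\<forall>x\<in>X. \<phi> (f x) = g x"
    using image_factors[of X f g, OF assms(2)] by blast
  then have "g ` X = \<phi> ` f ` X" by (auto simp: image_iff)
  then show ?thesis using card_image_le[of "f ` X" \<phi>] assms(1) by simp
qed

text \<open>
  How two graphs are compared throughout: \<open>f\<close> contracts connected subsets of \<open>X\<close> and \<open>g\<close> picks a
  point in each of them, so paths can be carried over in both directions.
\<close>

lemma card_classes_contract:
  assumes "f ` X = Y"
    and "\<And>u v. (u, v) \<in> r \<Longrightarrow> (f u, f v) \<in> conn s"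
    and "\<And>u v. (u, v) \<in> s \<Longrightarrow> (g u, g v) \<in> conn r"
    and "\<And>x. x \<in> X \<Longrightarrow> (x, g (f x)) \<in> conn r"
  shows "card (classes X r) = card (classes Y s)"
proof -
  have "(x, y) \<in> conn r \<longleftrightarrow> (f x, f y) \<in> conn s" if "x \<in> X" "y \<in> X" for x y
  proof
    assume "(f x, f y) \<in> conn s"
    then have "(g (f x), g (f y)) \<in> conn r" using assms(3) by (rule conn_map)
    then show "(x, y) \<in> conn r" using assms(4) that by (meson conn_sym conn_trans)
  qed (rule conn_map[OF _ assms(2)])
  then have "card ((\<lambda>x. conn r `` {x}) ` X) = card ((\<lambda>x. conn s `` {f x}) ` X)"
    by (intro card_image_eq_if_same_kernel) (simp only: conn_class_eq_iff)
  then show ?thesis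
    unfolding classes_eq_image assms(1)[symmetric] by (simp add: image_image)
qed

section \<open>Counting closed curves\<close>

text \<open>
  The graph formed by the arcs in \<open>P\<close> and the segments \<open>x\<close>--\<open>M x\<close>. A segment counts only if both of
  its ends are on arcs, so that nothing has to be assumed about \<open>M\<close> outside of \<open>\<Union>P\<close>.
\<close>

definition link :: "('c \<Rightarrow> 'c) \<Rightarrow> 'c set set \<Rightarrow> ('c \<times> 'c) set" where
  "link M P = {(x, y). {x, y} \<in> P} \<union> {(x, M x) |x. x \<in> \<Union>P \<and> M x \<in> \<Union>P}"

definition loops :: "('c \<Rightarrow> 'c) \<Rightarrow> 'c set set \<Rightarrow> nat" where
  "loops M P = card (classes (\<Union>P) (link M P))"

text \<open>
  Two arcs meeting at a segment form one arc. The contraction sends the two inner points \<open>z\<close> and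
  \<open>z'\<close> to the outer ends of their arcs.
\<close>

lemma loops_join:
  assumes inv: "\<And>w. M (M w) = w" and "z' = M z" "z \<noteq> z'"
    and "z \<notin> \<Union>P" "z' \<notin> \<Union>P" "x \<notin> {z, z'}" "y \<notin> {z, z'}"
  shows "loops M (insert {x, z} (insert {z', y} P)) = loops M (insert {x, y} P)"
  unfolding loops_def
proof (rule card_classes_contract)
  let ?Q = "insert {x, z} (insert {z', y} P)" and ?P' = "insert {x, y} P"
  let ?f = "\<lambda>w. if w = z then x else if w = z' then y else w"
  have mate: "M z = z'" "M z' = z" "M w = z \<longleftrightarrow> w = z'" "M w = z' \<longleftrightarrow> w = z" for w
    using assms(1,2) by metis+
  show "?f ` \<Union>?Q = \<Union>?P'"
    using assms by (auto simp: image_iff)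
  have xy: "(x, y) \<in> conn (link M ?P')" "(y, x) \<in> conn (link M ?P')"
    by (rule conn_step, simp add: link_def insert_commute)+
  show "(?f u, ?f v) \<in> conn (link M ?P')" if "(u, v) \<in> link M ?Q" for u v
    using that unfolding link_def[of M ?Q]
  proof (elim UnE)
    assume "(u, v) \<in> {(x, y). {x, y} \<in> ?Q}"
    then consider "{u, v} = {x, z}" | "{u, v} = {z', y}" | "{u, v} \<in> P" by auto
    then show ?thesis
    proof cases
      case 3
      then have "{u, v} \<subseteq> \<Union>P" by blast
      then have "?f u = u" "?f v = v" using assms(4,5) by auto
      with 3 show ?thesis by (intro conn_step) (auto simp: link_def)
    qed (use assms xy in \<open>auto simp: doubleton_eq_iff\<close>)
  next
    assume "(u, v) \<in> {(x, M x) |x. x \<in> \<Union>?Q \<and> M x \<in> \<Union>?Q}"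
    then have v: "v = M u" "u \<in> \<Union>?Q" "v \<in> \<Union>?Q" by auto
    show ?thesis
    proof (cases "u \<in> {z, z'}")
      case True
      then show ?thesis using v mate xy assms(3) by auto
    next
      case False
      then have "v \<notin> {z, z'}" using v mate by auto
      with False v have "(u, v) \<in> link M ?P'" by (auto simp: link_def)
      with False \<open>v \<notin> {z, z'}\<close> show ?thesis using conn_step[of u v "link M ?P'"] by simp
    qed
  qed
  have 1: "(x, z) \<in> link M ?Q" "(z', y) \<in> link M ?Q" "(z, z') \<in> link M ?Q"
    using mate(1) by (simp_all add: link_def)
  then have 2: "(x, y) \<in> conn (link M ?Q)"
    by (meson conn_step conn_trans)
  show "(u, v) \<in> conn (link M ?Q)" if "(u, v) \<in> link M ?P'" for u v
  proof -
    have "u = x \<and> v = y \<or> u = y \<and> v = x \<or> (u, v) \<in> link M ?Q"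
      using that by (auto simp: link_def doubleton_eq_iff)
    then show ?thesis using 2 conn_sym[OF 2] conn_step[of u v "link M ?Q"] by blast
  qed
  show "(w, ?f w) \<in> conn (link M ?Q)" if "w \<in> \<Union>?Q" for w
    using conn_sym[OF conn_step[OF 1(1)]] conn_step[OF 1(2)] by simp
qed

text \<open>
  An arc closed up by the segment between its own ends is a component of its own.
\<close>

lemma loops_circle:
  assumes inv: "\<And>w. M (M w) = w" and "z' = M z"
    and fresh: "z \<notin> \<Union>P" "z' \<notin> \<Union>P" and "finite (\<Union>P)"
  shows "loops M (insert {z, z'} P) = Suc (loops M P)"
proof -
  let ?r = "link M (insert {z, z'} P)" and ?s = "link M P"
  have mate: "M z = z'" "M z' = z" "M w = z \<longleftrightarrow> w = z'" "M w = z' \<longleftrightarrow> w = z" for w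
    using assms(1,2) by metis+
  have step: "(u, v) \<in> ?r \<longleftrightarrow> (u, v) \<in> ?s \<or> {u, v} = {z, z'}" for u v
    using mate fresh by (auto simp: link_def doubleton_eq_iff)
  have dom: "u \<in> \<Union>P \<and> v \<in> \<Union>P" if "(u, v) \<in> ?s" for u v
    using that by (auto simp: link_def)
  have 1: "(u, v) \<in> conn ?s \<and> v \<in> \<Union>P" if "(u, v) \<in> conn ?r" "u \<in> \<Union>P" for u v
    using that
  proof (induction rule: rtrancl_induct)
    case (step v w)
    then have v: "(u, v) \<in> conn ?s" "v \<in> \<Union>P" by auto
    then have "(v, w) \<in> ?s \<union> ?s\<inverse>"
      using step(2) fresh unfolding Un_iff converse_iff \<open>\<And>u v. (u, v) \<in> ?r \<longleftrightarrow> _\<close>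
      by (auto simp: doubleton_eq_iff)
    then show ?case using v dom by (auto intro: rtrancl_into_rtrancl)
  qed auto
  have 2: "conn ?s \<subseteq> conn ?r"
    by (rule rtrancl_mono) (use step in auto)
  have "conn ?r `` {u} = conn ?s `` {u}" if "u \<in> \<Union>P" for u
    using 1 2 that by blast
  then have rest: "classes (\<Union>P) ?r = classes (\<Union>P) ?s"
    by (auto simp: classes_eq_image)
  have "(z, z') \<in> ?r" using step by blast
  then have same: "conn ?r `` {z} = conn ?r `` {z'}"
    unfolding conn_class_eq_iff by blast
  have new: "conn ?r `` {z} \<notin> classes (\<Union>P) ?r"
  proof
    assume "conn ?r `` {z} \<in> classes (\<Union>P) ?r"
    then obtain u where "u \<in> \<Union>P" "(u, z) \<in> conn ?r"
      by (auto simp: classes_eq_image conn_class_eq_iff intro: conn_sym)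
    with 1 fresh show False by blast
  qed
  have "classes (\<Union>(insert {z, z'} P)) ?r = insert (conn ?r `` {z}) (classes (\<Union>P) ?r)"
    by (simp add: classes_eq_image same)
  then show ?thesis
    unfolding loops_def using new rest finite_classes[OF assms(5)] by simp
qed

section \<open>The bracket as an iterated expansion\<close>

text \<open>
  Smoothing the crossings one after the other turns the sum over subsets of positions into a
  recursion, which can be unfolded locally at a single crossing of the original diagram.
\<close>

fun expand :: "'a::field \<Rightarrow> 'a \<Rightarrow> 'h node list \<Rightarrow> ('h node list \<Rightarrow> 'a) \<Rightarrow> 'a" where
  "expand A B [] F = F []"
| "expand A B (n # ns) F =
     (if is_crossing n
      then A * expand A B ns (\<lambda>r. F (smoothA n @ r)) + B * expand A B ns (\<lambda>r. F (smoothB n @ r))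
      else expand A B ns (\<lambda>r. F (n # r)))"

lemma expand_append:
  "expand A B (xs @ ys) F = expand A B xs (\<lambda>r. expand A B ys (\<lambda>r'. F (r @ r')))"
  by (induction xs arbitrary: F) auto

lemma expand_no_crossing: "\<forall>n\<in>set ns. \<not> is_crossing n \<Longrightarrow> expand A B ns F = F ns"
  by (induction ns arbitrary: F) auto

text \<open>
  Smoothings keep all half-edges and create neither crossings nor vertices; this is what
  one may assume of the lists at which \<open>F\<close> and \<open>G\<close> are compared.
\<close>

lemma expand_cong_strong:
  assumes "\<And>r. (\<Union>n\<in>set r. set (node_half_edges n)) = (\<Union>n\<in>set ns. set (node_half_edges n)) \<Longrightarrow>
      \<forall>n\<in>set r. \<not> is_crossing n \<Longrightarrow> (\<forall>n\<in>set r. is_vertex n \<longrightarrow> n \<in> set ns) \<Longrightarrow> F r = G r"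
  shows "expand A B ns F = expand A B ns G"
  using assms
proof (induction ns arbitrary: F G)
  case (Cons n ns)
  show ?case
  proof (cases "is_crossing n")
    case True
    then obtain a b c d where n: "n = Crossing a b c d" by (cases n) auto
    have "expand A B ns (\<lambda>r. F (smoothA n @ r)) = expand A B ns (\<lambda>r. G (smoothA n @ r))"
         "expand A B ns (\<lambda>r. F (smoothB n @ r)) = expand A B ns (\<lambda>r. G (smoothB n @ r))"
      by (intro Cons.IH Cons.prems; auto simp: n)+
    then show ?thesis using True by simp
  next
    case False
    have "expand A B ns (\<lambda>r. F (n # r)) = expand A B ns (\<lambda>r. G (n # r))"
      by (intro Cons.IH Cons.prems) (use False in auto)
    then show ?thesis using False by simp
  qed
qed auto

lemma expand_mult: "expand A B ns (\<lambda>r. c * F r) = c * expand A B ns F"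
  by (induction ns arbitrary: F) (auto simp: algebra_simps)

definition crossing_indices :: "'h node list \<Rightarrow> nat set" where
  "crossing_indices ns = {i. i < length ns \<and> is_crossing (ns ! i)}"

definition smooth_at :: "nat set \<Rightarrow> 'h node list \<Rightarrow> 'h node list" where
  "smooth_at S ns =
     concat (map (\<lambda>i. if i \<in> S then smoothA (ns ! i) else smoothB (ns ! i)) [0..<length ns])"

lemma finite_crossing_indices [simp]: "finite (crossing_indices ns)"
  by (simp add: crossing_indices_def)

lemma crossing_indices_Cons:
  "crossing_indices (n # ns) = (if is_crossing n then {0} else {}) \<union> Suc ` crossing_indices ns"
proof -
  have "i \<in> crossing_indices (n # ns) \<longleftrightarrow>
      i \<in> (if is_crossing n then {0} else {}) \<union> Suc ` crossing_indices ns" for i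
    by (cases i) (auto simp: crossing_indices_def)
  then show ?thesis by blast
qed

lemma smooth_at_Cons:
  "smooth_at S (n # ns) = (if 0 \<in> S then smoothA n else smoothB n) @ smooth_at {i. Suc i \<in> S} ns"
proof -
  have "[0..<length (n # ns)] = 0 # map Suc [0..<length ns]"
    by (simp add: upt_conv_Cons map_Suc_upt del: upt_Suc)
  then show ?thesis
    unfolding smooth_at_def by (simp add: comp_def del: upt_Suc cong: if_cong)
qed

lemma sum_Pow_image_Suc:
  "(\<Sum>S\<in>Pow (Suc ` C). f S) = (\<Sum>S\<in>Pow C. f (Suc ` S))"
proof -
  have "inj_on ((`) Suc) (Pow C)" by (auto simp: inj_on_def inj_image_eq_iff)
  then show ?thesis
    by (simp add: image_Pow_surj[OF refl, symmetric] sum.reindex comp_def)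
qed

lemma sum_Pow_insert:
  assumes "finite C" "x \<notin> C"
  shows "(\<Sum>S\<in>Pow (insert x C). f S) = (\<Sum>S\<in>Pow C. f S) + (\<Sum>S\<in>Pow C. f (insert x S))"
proof -
  have "inj_on (insert x) (Pow C)" "Pow C \<inter> insert x ` Pow C = {}"
    using assms(2) by (auto simp: inj_on_def)
  then show ?thesis
    using assms(1) by (simp add: Pow_insert sum.union_disjoint sum.reindex)
qed

text \<open>
  A set of positions in \<open>n # ns\<close> is a shifted set of positions in \<open>ns\<close>, with \<open>0\<close> added or not.
\<close>

lemma expand_eq_sum:
  "expand A B ns F = (\<Sum>S\<in>Pow (crossing_indices ns).
      A ^ card S * B ^ card (crossing_indices ns - S) * F (smooth_at S ns))"
proof (induction ns arbitrary: F)
  case Nil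
  then show ?case by (simp add: crossing_indices_def smooth_at_def)
next
  case (Cons n ns)
  let ?C = "crossing_indices ns"
  have shift: "card (Suc ` S) = card S" "{i. Suc i \<in> Suc ` S} = S"
    "{i. i = 0 \<or> Suc i \<in> Suc ` S} = insert 0 S" "0 \<notin> Suc ` S" "Suc ` ?C - Suc ` S = Suc ` (?C - S)" for S
    by (auto simp: card_image)
  have fin: "card (insert 0 (Suc ` S)) = Suc (card S)" if "S \<subseteq> ?C" for S
    using that finite_subset[OF that] by (simp add: card_image)
  have s0: "smooth_at (Suc ` S) (n # ns) = smoothB n @ smooth_at S ns" for S
    by (simp add: smooth_at_Cons shift)
  have s1: "smooth_at (insert 0 (Suc ` S)) (n # ns) = smoothA n @ smooth_at S ns" for S
    by (simp add: smooth_at_Cons shift)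
  show ?case
  proof (cases "is_crossing n")
    case True
    have c: "insert 0 (Suc ` ?C) - Suc ` S = insert 0 (Suc ` (?C - S))"
      "insert 0 (Suc ` ?C) - insert 0 (Suc ` S) = Suc ` (?C - S)" for S
      by auto
    show ?thesis
      using True fin
      by (simp add: crossing_indices_Cons sum_Pow_insert sum_Pow_image_Suc Cons.IH s0 s1 c shift
          card_image sum_distrib_left mult.assoc mult.left_commute cong: sum.cong_simp)
  next
    case False
    then have "smoothB n = [n]" by (cases n) auto
    then show ?thesis
      using False
      by (simp add: crossing_indices_Cons sum_Pow_image_Suc Cons.IH s0 shift card_image)
  qed
qed

text \<open>
  The factor \<open>d\<close> of the theorem turns the exponent \<open>|\<sigma>| - 1\<close> into a natural number.
\<close>

lemma bracket_eq_expand: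
  assumes "d \<noteq> 0"
  shows "d * bracket A B d E = expand A B (nodes E) (\<lambda>r. d ^ card (strands (Diagram r (mate E))))"
proof -
  have "d * (x * d powi (int k - 1)) = x * d ^ k" for x and k
    using assms by (simp add: power_int_diff field_simps)
  note eq = this[of "_ * _"]
  show ?thesis
    by (simp add: bracket_def expand_eq_sum sum_distrib_left eq crossings_def crossing_indices_def
        resolve_def smooth_at_def)
qed

lemma linear_bracket_superset:
  assumes "finite K" "Poly_Mapping.keys L \<subseteq> K"
  shows "linear_bracket A B d L = (\<Sum>E\<in>K. Poly_Mapping.lookup L E * bracket A B d E)"
  unfolding linear_bracket_def
  by (rule sum.mono_neutral_left) (use assms in \<open>auto simp: in_keys_iff\<close>)

lemma linear_bracket_add:
  "linear_bracket A B d (L + L') = linear_bracket A B d L + linear_bracket A B d L'"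
proof -
  let ?K = "Poly_Mapping.keys L \<union> Poly_Mapping.keys L'"
  have "Poly_Mapping.keys (L + L') \<subseteq> ?K" by (rule Poly_Mapping.keys_add)
  then show ?thesis
    by (simp add: linear_bracket_superset[of ?K] lookup_add algebra_simps sum.distrib)
qed

lemma linear_bracket_zero: "linear_bracket A B d 0 = 0"
  by (simp add: linear_bracket_def)

lemma linear_bracket_single:
  "linear_bracket A B d (Poly_Mapping.single E c) = c * bracket A B d E"
  by (simp add: linear_bracket_superset[of "{E}"])

lemma linear_bracket_sum:
  "linear_bracket A B d (\<Sum>i\<in>I. L i) = (\<Sum>i\<in>I. linear_bracket A B d (L i))"
  by (induction I rule: infinite_finite_induct)
    (simp_all add: linear_bracket_zero linear_bracket_add)

lemma linear_bracket_projected: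
  "linear_bracket A B d (projected_diagram \<delta> D) =
     (\<Sum>S\<in>Pow (projector_sites D). (- (1 / \<delta>)) ^ card S * bracket A B d (cable_diagram S D))"
  by (simp add: projected_diagram_def linear_bracket_sum linear_bracket_single)

section \<open>Evaluation of Laurent polynomials\<close>

lemma laurent_eval_superset:
  assumes "finite K" "Poly_Mapping.keys p \<subseteq> K"
  shows "laurent_eval \<alpha> x p =
    (\<Sum>(i, j)\<in>K. of_int (Poly_Mapping.lookup p (i, j)) * \<alpha> powi i * x powi j)"
  unfolding laurent_eval_def
  by (rule sum.mono_neutral_left) (use assms in \<open>auto simp: in_keys_iff\<close>)

lemma laurent_eval_add:
  "laurent_eval \<alpha> x (p + q) = laurent_eval \<alpha> x p + laurent_eval \<alpha> x q"
proof -
  let ?K = "Poly_Mapping.keys p \<union> Poly_Mapping.keys q"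
  have "Poly_Mapping.keys (p + q) \<subseteq> ?K" by (rule Poly_Mapping.keys_add)
  then show ?thesis
    by (simp add: laurent_eval_superset[of ?K] lookup_add algebra_simps sum.distrib case_prod_beta)
qed

lemma laurent_eval_zero: "laurent_eval \<alpha> x 0 = 0"
  by (simp add: laurent_eval_def)

lemma laurent_eval_single:
  "laurent_eval \<alpha> x (Poly_Mapping.single (i, j) c) = of_int c * \<alpha> powi i * x powi j"
  by (simp add: laurent_eval_superset[of "{(i, j)}"])

lemma laurent_eval_sum:
  "laurent_eval \<alpha> x (\<Sum>i\<in>I. p i) = (\<Sum>i\<in>I. laurent_eval \<alpha> x (p i))"
  by (induction I rule: infinite_finite_induct) (simp_all add: laurent_eval_zero laurent_eval_add)

lemma laurent_eval_uminus: "laurent_eval \<alpha> x (- p) = - laurent_eval \<alpha> x p"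
  by (metis add.right_inverse laurent_eval_add laurent_eval_zero neg_eq_iff_add_eq_0)

lemma laurent_eval_mult:
  assumes "\<alpha> \<noteq> 0" "x \<noteq> 0"
  shows "laurent_eval \<alpha> x (p * q) = laurent_eval \<alpha> x p * laurent_eval \<alpha> x q"
proof -
  have decomp: "p = (\<Sum>k\<in>Poly_Mapping.keys p. Poly_Mapping.single k (Poly_Mapping.lookup p k))"
    for p :: laurent
    by (rule poly_mapping_eqI) (auto simp: lookup_sum lookup_single when_def in_keys_iff)
  have "laurent_eval \<alpha> x (Poly_Mapping.single k a * Poly_Mapping.single l b) =
      laurent_eval \<alpha> x (Poly_Mapping.single k a) * laurent_eval \<alpha> x (Poly_Mapping.single l b)" for k l a b
    using assms
    by (cases k; cases l) (simp add: mult_single laurent_eval_single power_int_add)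
  then have "laurent_eval \<alpha> x ((\<Sum>k\<in>Poly_Mapping.keys p. Poly_Mapping.single k (Poly_Mapping.lookup p k)) *
        (\<Sum>k\<in>Poly_Mapping.keys q. Poly_Mapping.single k (Poly_Mapping.lookup q k))) =
      laurent_eval \<alpha> x (\<Sum>k\<in>Poly_Mapping.keys p. Poly_Mapping.single k (Poly_Mapping.lookup p k)) *
      laurent_eval \<alpha> x (\<Sum>k\<in>Poly_Mapping.keys q. Poly_Mapping.single k (Poly_Mapping.lookup q k))"
    by (simp add: sum_product laurent_eval_sum)
  then show ?thesis
    by (simp only: decomp[symmetric])
qed

lemma laurent_eval_power:
  assumes "\<alpha> \<noteq> 0" "x \<noteq> 0"
  shows "laurent_eval \<alpha> x (p ^ n) = laurent_eval \<alpha> x p ^ n"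
proof (induction n)
  case 0
  have "laurent_eval \<alpha> x (Poly_Mapping.single (0, 0) 1) = 1" by (simp add: laurent_eval_single)
  then show ?case by (simp add: zero_prod_def[symmetric])
qed (simp add: laurent_eval_mult[OF assms])

section \<open>Moves on doubled strands\<close>

text \<open>
  The arc joining the two strands of \<open>h\<close>, one half of a cup-cap pair.
\<close>

definition cap :: "level \<Rightarrow> 'h \<Rightarrow> 'h cable set" where
  "cap l h = {Strand h Cw l, Strand h Ccw l}"

definition cut :: "'h \<Rightarrow> 'h cable set set" where
  "cut h = {cap Near h, cap Far h}"

definition through :: "'h \<Rightarrow> 'h cable set set" where
  "through h = {{Strand h Cw Near, Strand h Cw Far}, {Strand h Ccw Near, Strand h Ccw Far}}"

definition boxes :: "'h set \<Rightarrow> 'h set \<Rightarrow> 'h cable set set" where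
  "boxes S H = (\<Union>h\<in>H. if h \<in> S then cut h else through h)"

definition parallel :: "'h \<Rightarrow> 'h \<Rightarrow> 'h cable set set" where
  "parallel h h' =
     {{Strand h Cw Tip, Strand h' Ccw Tip}, {Strand h Ccw Tip, Strand h' Cw Tip}}"

text \<open>
  The arc from \<open>h\<close> to the next half-edge, along the boundary of a vertex disk.
\<close>

definition disk_arc :: "'h \<Rightarrow> 'h \<Rightarrow> 'h cable set" where
  "disk_arc h h' = {Strand h Ccw Tip, Strand h' Cw Tip}"

text \<open>
  The two smoothings of the crossing in the corner between consecutive half-edges \<open>h\<close> and \<open>h'\<close> of a
  cabled crossing. Described by whether the outer ends are joined around the corner, rather than as
  A or B, the four corners look alike, and the cases below need to be treated up to
  rotation only.
\<close>

definition corner :: "bool \<Rightarrow> 'h \<Rightarrow> 'h \<Rightarrow> 'h cable set set" where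
  "corner joined h h' =
     (if joined
      then {{Strand h Ccw Tip, Strand h' Cw Tip}, {Strand h Ccw Core, Strand h' Cw Core}}
      else {{Strand h Ccw Tip, Strand h Ccw Core}, {Strand h' Cw Tip, Strand h' Cw Core}})"

text \<open>
  Side condition of all local moves: the surrounding arcs \<open>P\<close> do not touch the points being moved.
\<close>

definition avoids :: "'h cable set set \<Rightarrow> 'h set \<Rightarrow> level set \<Rightarrow> bool" where
  "avoids P H K \<longleftrightarrow> (\<forall>h\<in>H. \<forall>s. \<forall>l\<in>K. Strand h s l \<notin> \<Union>P)"

lemma avoids_Un [simp]: "avoids (P \<union> Q) H K \<longleftrightarrow> avoids P H K \<and> avoids Q H K"
  by (auto simp: avoids_def)

lemma avoids_mono: "avoids P H K \<Longrightarrow> H' \<subseteq> H \<Longrightarrow> K' \<subseteq> K \<Longrightarrow> avoids P H' K'"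
  unfolding avoids_def by blast

text \<open>
  The involution is required on all half-edges and not just on those of one diagram, so that the same
  \<open>m\<close> serves for a diagram and for everything obtained from it by smoothing and deletion.
\<close>

locale involution =
  fixes m :: "'h \<Rightarrow> 'h"
  assumes m_m [simp]: "m (m h) = h"
begin

abbreviation curves :: "'h cable set set \<Rightarrow> nat" where
  "curves P \<equiv> loops (cable_mate m) P"

lemma flip_flip [simp]: "flip (flip s) = s"
  by (cases s) auto

lemma cable_mate_cable_mate: "cable_mate m (cable_mate m w) = w"
  by (cases "(m, w)" rule: cable_mate.cases) auto

lemma join:
  assumes "cable_mate m z = z'" "z \<noteq> z'" "z \<notin> \<Union>P" "z' \<notin> \<Union>P" "x \<notin> {z, z'}" "y \<notin> {z, z'}"
  shows "curves (insert {x, z} (insert {z', y} P)) = curves (insert {x, y} P)"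
  by (rule loops_join) (use assms cable_mate_cable_mate in auto)

lemma circle:
  assumes "cable_mate m z = z'" "z \<notin> \<Union>P" "z' \<notin> \<Union>P" "finite (\<Union>P)"
  shows "curves (insert {z, z'} P) = Suc (curves P)"
  by (rule loops_circle) (use assms cable_mate_cable_mate in auto)

text \<open>
  If two adjacent corners are not joined, the strands of the half-edge \<open>h\<close> between them are connected
  below \<open>h\<close>. Through an identity box the turnback retracts to a cap at \<open>Far\<close>.
\<close>

lemma turnback_through:
  assumes "avoids P {h} {Near, Tip, Core}"
  shows "curves (P \<union> {{Strand h Ccw Tip, Strand h Ccw Core}, {Strand h Cw Tip, Strand h Cw Core}} \<union> through h)
       = curves (insert (cap Far h) P)"
proof -
  let ?h = "Strand h"
  note A = assms[unfolded avoids_def]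
  have "curves (P \<union> {{?h Ccw Tip, ?h Ccw Core}, {?h Cw Tip, ?h Cw Core}} \<union> through h)
      = curves (insert {?h Cw Tip, ?h Cw Core} (insert {?h Ccw Core, ?h Ccw Tip}
            (insert {?h Cw Near, ?h Cw Far} (insert {?h Ccw Near, ?h Ccw Far} P))))"
    by (simp add: through_def insert_commute)
  also have "\<dots> = curves (insert {?h Cw Tip, ?h Ccw Tip}
            (insert {?h Cw Near, ?h Cw Far} (insert {?h Ccw Near, ?h Ccw Far} P)))"
    by (rule join) (use A in auto)
  also have "\<dots> = curves (insert {?h Cw Tip, ?h Ccw Tip} (insert {?h Ccw Near, ?h Ccw Far}
            (insert {?h Cw Near, ?h Cw Far}  P)))"
    by (simp add: insert_commute)
  also have "\<dots> = curves (insert {?h Cw Tip, ?h Ccw Far} (insert {?h Cw Near, ?h Cw Far} P))"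
    by (rule join) (use A in auto)
  also have "\<dots> = curves (insert {?h Ccw Far, ?h Cw Tip} (insert {?h Cw Near, ?h Cw Far} P))"
    by (simp add: insert_commute)
  also have "\<dots> = curves (insert {?h Ccw Far, ?h Cw Far} P)"
    by (rule join) (use A in auto)
  finally show ?thesis by (simp add: cap_def insert_commute)
qed

text \<open>
  Through a cup-cap box the outcome is the same cap at \<open>Far\<close>, and the turnback closes up to a circle.
\<close>

lemma turnback_cut:
  assumes "avoids P {h} {Near, Tip, Core}" "finite (\<Union>P)"
  shows "curves (P \<union> {{Strand h Ccw Tip, Strand h Ccw Core}, {Strand h Cw Tip, Strand h Cw Core}} \<union> cut h)
       = Suc (curves (insert (cap Far h) P))"
proof -
  let ?h = "Strand h" and ?Q = "insert (cap Far h) P"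
  have A: "?h s l \<notin> \<Union>?Q" if "l \<in> {Near, Tip, Core}" for s l
    using assms(1) that by (auto simp: avoids_def cap_def)
  have F: "finite (\<Union>?Q)" using assms(2) by (simp add: cap_def)
  have "curves (P \<union> {{?h Ccw Tip, ?h Ccw Core}, {?h Cw Tip, ?h Cw Core}} \<union> cut h)
      = curves (insert {?h Cw Tip, ?h Cw Core} (insert {?h Ccw Core, ?h Ccw Tip}
            (insert {?h Cw Near, ?h Ccw Near} ?Q)))"
    by (simp add: cut_def cap_def insert_commute)
  also have "\<dots> = curves (insert {?h Cw Tip, ?h Ccw Tip} (insert {?h Cw Near, ?h Ccw Near} ?Q))"
    by (rule join) (use A in auto)
  also have "\<dots> = curves (insert {?h Cw Tip, ?h Ccw Tip} (insert {?h Ccw Near, ?h Cw Near} ?Q))"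
    by (simp add: insert_commute)
  also have "\<dots> = curves (insert {?h Cw Tip, ?h Cw Near} ?Q)"
    by (rule join) (use A in auto)
  also have "\<dots> = Suc (curves ?Q)"
    by (rule circle) (use A F in auto)
  finally show ?thesis .
qed

text \<open>
  All corners joined: the four inner segments close up to a circle in the middle.
\<close>

lemma corners_vertex_circle:
  assumes "distinct [a, b, c, d]" "avoids P {a, b, c, d} {Core}" "finite (\<Union>P)"
  shows "curves (P \<union> corner True a b \<union> corner True b c \<union> corner True c d \<union> corner True d a)
       = Suc (curves (P \<union> {disk_arc a b, disk_arc b c, disk_arc c d, disk_arc d a}))"
proof -
  let ?Q = "P \<union> {disk_arc a b, disk_arc b c, disk_arc c d, disk_arc d a}"
  have A: "Strand h s Core \<notin> \<Union>?Q" if "h \<in> {a, b, c, d}" for s h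
    using assms(2) that by (auto simp: avoids_def disk_arc_def)
  have F: "finite (\<Union>?Q)" using assms(3) by (simp add: disk_arc_def)
  have "curves (P \<union> corner True a b \<union> corner True b c \<union> corner True c d \<union> corner True d a)
      = curves (insert {Strand a Ccw Core, Strand b Cw Core} (insert {Strand b Ccw Core, Strand c Cw Core}
         (insert {Strand c Ccw Core, Strand d Cw Core} (insert {Strand d Ccw Core, Strand a Cw Core} ?Q))))"
    by (simp add: corner_def disk_arc_def insert_commute)
  also have "\<dots> = curves (insert {Strand a Ccw Core, Strand c Cw Core}
         (insert {Strand c Ccw Core, Strand d Cw Core} (insert {Strand d Ccw Core, Strand a Cw Core} ?Q)))"
    by (rule join) (use A assms(1) in auto)
  also have "\<dots> = curves (insert {Strand a Ccw Core, Strand d Cw Core} (insert {Strand d Ccw Core, Strand a Cw Core} ?Q))"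
    by (rule join) (use A assms(1) in auto)
  also have "\<dots> = curves (insert {Strand a Ccw Core, Strand a Cw Core} ?Q)"
    by (rule join) (use A assms(1) in auto)
  also have "\<dots> = Suc (curves ?Q)"
    by (rule circle) (use A F in auto)
  finally show ?thesis .
qed

text \<open>
  One corner not joined: the inner segments provide the missing arc around it.
\<close>

lemma corners_vertex:
  assumes "distinct [a, b, c, d]" "avoids P {a, b, c, d} {Core}"
  shows "curves (P \<union> corner False a b \<union> corner True b c \<union> corner True c d \<union> corner True d a)
       = curves (P \<union> {disk_arc a b, disk_arc b c, disk_arc c d, disk_arc d a})"
proof -
  let ?Q = "P \<union> {disk_arc b c, disk_arc c d, disk_arc d a}"
  have A: "Strand h s Core \<notin> \<Union>?Q" if "h \<in> {a, b, c, d}" for s h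
    using assms(2) that by (auto simp: avoids_def disk_arc_def)
  have "curves (P \<union> corner False a b \<union> corner True b c \<union> corner True c d \<union> corner True d a)
      = curves (insert {Strand b Cw Tip, Strand b Cw Core} (insert {Strand b Ccw Core, Strand c Cw Core}
         (insert {Strand c Ccw Core, Strand d Cw Core} (insert {Strand d Ccw Core, Strand a Cw Core}
         (insert {Strand a Ccw Core, Strand a Ccw Tip} ?Q)))))"
    by (simp add: corner_def disk_arc_def insert_commute)
  also have "\<dots> = curves (insert {Strand b Cw Tip, Strand c Cw Core}
         (insert {Strand c Ccw Core, Strand d Cw Core} (insert {Strand d Ccw Core, Strand a Cw Core}
         (insert {Strand a Ccw Core, Strand a Ccw Tip} ?Q))))"
    by (rule join) (use A assms(1) in auto)
  also have "\<dots> = curves (insert {Strand b Cw Tip, Strand d Cw Core} (insert {Strand d Ccw Core, Strand a Cw Core}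
         (insert {Strand a Ccw Core, Strand a Ccw Tip} ?Q)))"
    by (rule join) (use A assms(1) in auto)
  also have "\<dots> = curves (insert {Strand b Cw Tip, Strand a Cw Core} (insert {Strand a Ccw Core, Strand a Ccw Tip} ?Q))"
    by (rule join) (use A assms(1) in auto)
  also have "\<dots> = curves (insert {Strand b Cw Tip, Strand a Ccw Tip} ?Q)"
    by (rule join) (use A assms(1) in auto)
  finally show ?thesis by (simp add: disk_arc_def insert_commute)
qed

text \<open>
  Two opposite corners not joined: the inner segments lead straight across, parallel to the
  outer arcs.
\<close>

lemma corners_parallel:
  assumes "distinct [a, b, c, d]" "avoids P {a, b, c, d} {Core}"
  shows "curves (P \<union> corner False a b \<union> corner True b c \<union> corner False c d \<union> corner True d a)
       = curves (P \<union> parallel b c \<union> parallel d a)"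
proof -
  let ?Q = "P \<union> {disk_arc b c, disk_arc d a}"
  have A: "Strand h s Core \<notin> \<Union>?Q" if "h \<in> {a, b, c, d}" for s h
    using assms(2) that by (auto simp: avoids_def disk_arc_def)
  have "curves (P \<union> corner False a b \<union> corner True b c \<union> corner False c d \<union> corner True d a)
      = curves (insert {Strand b Cw Tip, Strand b Cw Core} (insert {Strand b Ccw Core, Strand c Cw Core}
         (insert {Strand c Ccw Core, Strand c Ccw Tip} (insert {Strand d Cw Tip, Strand d Cw Core}
         (insert {Strand d Ccw Core, Strand a Cw Core}
         (insert {Strand a Ccw Core, Strand a Ccw Tip} ?Q))))))"
    by (simp add: corner_def disk_arc_def insert_commute)
  also have "\<dots> = curves (insert {Strand b Cw Tip, Strand c Cw Core}
         (insert {Strand c Ccw Core, Strand c Ccw Tip} (insert {Strand d Cw Tip, Strand d Cw Core}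
         (insert {Strand d Ccw Core, Strand a Cw Core}
         (insert {Strand a Ccw Core, Strand a Ccw Tip} ?Q)))))"
    by (rule join) (use A assms(1) in auto)
  also have "\<dots> = curves (insert {Strand b Cw Tip, Strand c Ccw Tip} (insert {Strand d Cw Tip, Strand d Cw Core}
         (insert {Strand d Ccw Core, Strand a Cw Core}
         (insert {Strand a Ccw Core, Strand a Ccw Tip} ?Q))))"
    by (rule join) (use A assms(1) in auto)
  also have "\<dots> = curves (insert {Strand d Cw Tip, Strand d Cw Core}
         (insert {Strand d Ccw Core, Strand a Cw Core}
         (insert {Strand a Ccw Core, Strand a Ccw Tip} (insert {Strand b Cw Tip, Strand c Ccw Tip} ?Q))))"
    by (simp add: insert_commute)
  also have "\<dots> = curves (insert {Strand d Cw Tip, Strand a Cw Core}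
         (insert {Strand a Ccw Core, Strand a Ccw Tip} (insert {Strand b Cw Tip, Strand c Ccw Tip} ?Q)))"
    by (rule join) (use A assms(1) in auto)
  also have "\<dots> = curves (insert {Strand d Cw Tip, Strand a Ccw Tip} (insert {Strand b Cw Tip, Strand c Ccw Tip} ?Q))"
    by (rule join) (use A assms(1) in auto)
  finally show ?thesis by (simp add: disk_arc_def parallel_def insert_commute)
qed

text \<open>
  The arcs of the four virtual crossings in the 2-cable of a virtual crossing.
\<close>

definition virtual_arcs :: "'h \<Rightarrow> 'h \<Rightarrow> 'h \<Rightarrow> 'h \<Rightarrow> 'h cable set set" where
  "virtual_arcs a b c d =
     {{Strand a Ccw Tip, Strand b Cw Core}, {Strand b Cw Tip, Strand a Ccw Core},
      {Strand b Ccw Core, Strand c Cw Tip}, {Strand b Ccw Tip, Strand c Cw Core},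
      {Strand d Cw Core, Strand c Ccw Tip}, {Strand c Ccw Core, Strand d Cw Tip},
      {Strand a Cw Tip, Strand d Ccw Core}, {Strand a Cw Core, Strand d Ccw Tip}}"

lemma virtual_arcs:
  assumes "distinct [a, b, c, d]" "avoids P {a, b, c, d} {Core}"
  shows "curves (P \<union> virtual_arcs a b c d) = curves (P \<union> parallel a c \<union> parallel b d)"
proof -
  have A: "Strand h s Core \<notin> \<Union>P" if "h \<in> {a, b, c, d}" for s h
    using assms(2) that by (auto simp: avoids_def)
  have "curves (P \<union> virtual_arcs a b c d) =
     curves (insert {Strand a Ccw Tip, Strand b Cw Core} (insert {Strand b Ccw Core, Strand c Cw Tip}
       (insert {Strand b Cw Tip, Strand a Ccw Core} (insert {Strand a Cw Core, Strand d Ccw Tip}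
       (insert {Strand b Ccw Tip, Strand c Cw Core} (insert {Strand c Ccw Core, Strand d Cw Tip}
       (insert {Strand c Ccw Tip, Strand d Cw Core} (insert {Strand d Ccw Core, Strand a Cw Tip} P))))))))"
    by (simp add: virtual_arcs_def insert_commute)
  also have "\<dots> = curves (insert {Strand a Ccw Tip, Strand c Cw Tip}
       (insert {Strand b Cw Tip, Strand a Ccw Core} (insert {Strand a Cw Core, Strand d Ccw Tip}
       (insert {Strand b Ccw Tip, Strand c Cw Core} (insert {Strand c Ccw Core, Strand d Cw Tip}
       (insert {Strand c Ccw Tip, Strand d Cw Core} (insert {Strand d Ccw Core, Strand a Cw Tip} P)))))))"
    by (rule join) (use A assms(1) in auto)
  also have "\<dots> = curves (insert {Strand b Cw Tip, Strand a Ccw Core} (insert {Strand a Cw Core, Strand d Ccw Tip}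
       (insert {Strand b Ccw Tip, Strand c Cw Core} (insert {Strand c Ccw Core, Strand d Cw Tip}
       (insert {Strand c Ccw Tip, Strand d Cw Core} (insert {Strand d Ccw Core, Strand a Cw Tip}
       (insert {Strand a Ccw Tip, Strand c Cw Tip} P)))))))"
    by (simp add: insert_commute)
  also have "\<dots> = curves (insert {Strand b Cw Tip, Strand d Ccw Tip}
       (insert {Strand b Ccw Tip, Strand c Cw Core} (insert {Strand c Ccw Core, Strand d Cw Tip}
       (insert {Strand c Ccw Tip, Strand d Cw Core} (insert {Strand d Ccw Core, Strand a Cw Tip}
       (insert {Strand a Ccw Tip, Strand c Cw Tip} P))))))"
    by (rule join) (use A assms(1) in auto)
  also have "\<dots> = curves (insert {Strand b Ccw Tip, Strand c Cw Core} (insert {Strand c Ccw Core, Strand d Cw Tip}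
       (insert {Strand c Ccw Tip, Strand d Cw Core} (insert {Strand d Ccw Core, Strand a Cw Tip}
       (insert {Strand b Cw Tip, Strand d Ccw Tip} (insert {Strand a Ccw Tip, Strand c Cw Tip} P))))))"
    by (simp add: insert_commute)
  also have "\<dots> = curves (insert {Strand b Ccw Tip, Strand d Cw Tip}
       (insert {Strand c Ccw Tip, Strand d Cw Core} (insert {Strand d Ccw Core, Strand a Cw Tip}
       (insert {Strand b Cw Tip, Strand d Ccw Tip} (insert {Strand a Ccw Tip, Strand c Cw Tip} P)))))"
    by (rule join) (use A assms(1) in auto)
  also have "\<dots> = curves (insert {Strand c Ccw Tip, Strand d Cw Core} (insert {Strand d Ccw Core, Strand a Cw Tip}
       (insert {Strand b Ccw Tip, Strand d Cw Tip}
       (insert {Strand b Cw Tip, Strand d Ccw Tip} (insert {Strand a Ccw Tip, Strand c Cw Tip} P)))))"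
    by (simp add: insert_commute)
  also have "\<dots> = curves (insert {Strand c Ccw Tip, Strand a Cw Tip} (insert {Strand b Ccw Tip, Strand d Cw Tip}
       (insert {Strand b Cw Tip, Strand d Ccw Tip} (insert {Strand a Ccw Tip, Strand c Cw Tip} P))))"
    by (rule join) (use A assms(1) in auto)
  finally show ?thesis by (simp add: parallel_def insert_commute)
qed

text \<open>
  On a segment with a cup-cap pair at one end, an identity box at the other end lets the cap slide
  along, so it makes no difference at which of the two ends the cut is. Together with
  \<open>mate_caps\<close>, where both ends are cut, this shows that a second cut next to a first one produces
  exactly one circle.
\<close>

lemma mate_cut_through:
  assumes "avoids P {h, m h} {Far}" "m h \<noteq> h"
  shows "curves (P \<union> cut h \<union> through (m h)) = curves (P \<union> {cap Near h, cap Near (m h)})"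
proof -
  let ?k = "m h" and ?P = "insert (cap Near h) P"
  have A: "Strand k s Far \<notin> \<Union>?P" if "k \<in> {h, ?k}" for s k
    using assms(1) that by (auto simp: avoids_def cap_def)
  have "curves (P \<union> cut h \<union> through ?k) =
      curves (insert {Strand h Ccw Far, Strand h Cw Far} (insert {Strand ?k Ccw Far, Strand ?k Ccw Near}
       (insert {Strand ?k Cw Far, Strand ?k Cw Near} ?P)))"
    by (simp add: cut_def through_def cap_def insert_commute)
  also have "\<dots> = curves (insert {Strand h Ccw Far, Strand ?k Ccw Near} (insert {Strand ?k Cw Far, Strand ?k Cw Near} ?P))"
    by (rule join) (use A assms(2) in auto)
  also have "\<dots> = curves (insert {Strand ?k Ccw Near, Strand h Ccw Far} (insert {Strand ?k Cw Far, Strand ?k Cw Near} ?P))"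
    by (simp add: insert_commute)
  also have "\<dots> = curves (insert {Strand ?k Ccw Near, Strand ?k Cw Near} ?P)"
    by (rule join) (use A assms(2) in auto)
  finally show ?thesis by (simp add: cap_def insert_commute)
qed

lemma mate_caps:
  assumes "avoids P {h, m h} {Far}" "m h \<noteq> h" "finite (\<Union>P)"
  shows "curves (P \<union> {cap Far h, cap Far (m h)}) = Suc (curves P)"
proof -
  let ?k = "m h"
  have A: "Strand k s Far \<notin> \<Union>P" if "k \<in> {h, ?k}" for s k
    using assms(1) that by (auto simp: avoids_def cap_def)
  have "curves (P \<union> {cap Far h, cap Far ?k}) =
      curves (insert {Strand h Ccw Far, Strand h Cw Far} (insert {Strand ?k Ccw Far, Strand ?k Cw Far} P))"
    by (simp add: cap_def insert_commute)
  also have "\<dots> = curves (insert {Strand h Ccw Far, Strand ?k Cw Far} P)"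
    by (rule join) (use A assms(2) in auto)
  also have "\<dots> = Suc (curves P)"
    by (rule circle) (use A assms(3) in auto)
  finally show ?thesis .
qed

text \<open>
  The same for two half-edges that are opposite to each other at a node.
\<close>

lemma parallel_cut_through:
  assumes "avoids P {h, k} {Near, Tip}" "k \<noteq> h"
  shows "curves (P \<union> parallel h k \<union> cut h \<union> through k) = curves (P \<union> {cap Far h, cap Far k})"
proof -
  let ?P = "insert (cap Far h) P"
  have A: "Strand g s l \<notin> \<Union>?P" if "g \<in> {h, k}" "l \<in> {Near, Tip}" for s g l
    using assms(1) that by (auto simp: avoids_def cap_def)
  have "curves (P \<union> parallel h k \<union> cut h \<union> through k) =
      curves (insert {Strand h Ccw Near, Strand h Cw Near} (insert {Strand h Cw Tip, Strand k Ccw Tip}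
       (insert {Strand k Ccw Near, Strand k Ccw Far} (insert {Strand k Cw Far, Strand k Cw Near}
       (insert {Strand k Cw Tip, Strand h Ccw Tip} ?P)))))"
    by (simp add: cut_def through_def cap_def parallel_def insert_commute)
  also have "\<dots> = curves (insert {Strand h Ccw Near, Strand k Ccw Tip}
       (insert {Strand k Ccw Near, Strand k Ccw Far} (insert {Strand k Cw Far, Strand k Cw Near}
       (insert {Strand k Cw Tip, Strand h Ccw Tip} ?P))))"
    by (rule join) (use A assms(2) in auto)
  also have "\<dots> = curves (insert {Strand h Ccw Near, Strand k Ccw Far} (insert {Strand k Cw Far, Strand k Cw Near}
       (insert {Strand k Cw Tip, Strand h Ccw Tip} ?P)))"
    by (rule join) (use A assms(2) in auto)
  also have "\<dots> = curves (insert {Strand k Cw Far, Strand k Cw Near} (insert {Strand k Cw Tip, Strand h Ccw Tip}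
       (insert {Strand h Ccw Near, Strand k Ccw Far} ?P)))"
    by (simp add: insert_commute)
  also have "\<dots> = curves (insert {Strand k Cw Far, Strand h Ccw Tip} (insert {Strand h Ccw Near, Strand k Ccw Far} ?P))"
    by (rule join) (use A assms(2) in auto)
  also have "\<dots> = curves (insert {Strand k Cw Far, Strand k Ccw Far} ?P)"
    by (rule join) (use A assms(2) in auto)
  finally show ?thesis by (simp add: cap_def insert_commute)
qed

lemma parallel_caps:
  assumes "avoids P {h, k} {Near, Tip}" "k \<noteq> h" "finite (\<Union>P)"
  shows "curves (P \<union> parallel h k \<union> {cap Near h, cap Near k}) = Suc (curves P)"
proof -
  have A: "Strand g s l \<notin> \<Union>P" if "g \<in> {h, k}" "l \<in> {Near, Tip}" for s g l
    using assms(1) that by (auto simp: avoids_def cap_def)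
  have "curves (P \<union> parallel h k \<union> {cap Near h, cap Near k}) =
      curves (insert {Strand h Ccw Near, Strand h Cw Near} (insert {Strand h Cw Tip, Strand k Ccw Tip}
       (insert {Strand k Ccw Near, Strand k Cw Near} (insert {Strand k Cw Tip, Strand h Ccw Tip} P))))"
    by (simp add: cap_def parallel_def insert_commute)
  also have "\<dots> = curves (insert {Strand h Ccw Near, Strand k Ccw Tip}
       (insert {Strand k Ccw Near, Strand k Cw Near} (insert {Strand k Cw Tip, Strand h Ccw Tip} P)))"
    by (rule join) (use A assms(2) in auto)
  also have "\<dots> = curves (insert {Strand h Ccw Near, Strand k Cw Near} (insert {Strand k Cw Tip, Strand h Ccw Tip} P))"
    by (rule join) (use A assms(2) in auto)
  also have "\<dots> = curves (insert {Strand h Ccw Near, Strand h Ccw Tip} P)"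
    by (rule join) (use A assms(2) in auto)
  also have "\<dots> = Suc (curves P)"
    by (rule circle) (use A assms(3) in auto)
  finally show ?thesis .
qed

text \<open>
  A cut at the only half-edge of a vertex leaves the boundary circle of an isolated vertex.
\<close>

lemma vertex_cap_single:
  assumes "avoids P {h} {Near, Tip}" "finite (\<Union>P)"
  shows "curves (P \<union> {disk_arc h h, cap Near h}) = Suc (curves P)"
proof -
  have A: "Strand h s l \<notin> \<Union>P" if "l \<in> {Near, Tip}" for s l
    using assms(1) that by (auto simp: avoids_def cap_def)
  have "curves (P \<union> {disk_arc h h, cap Near h}) =
      curves (insert {Strand h Ccw Near, Strand h Cw Near} (insert {Strand h Cw Tip, Strand h Ccw Tip} P))"
    by (simp add: cap_def disk_arc_def insert_commute)
  also have "\<dots> = curves (insert {Strand h Ccw Near, Strand h Ccw Tip} P)"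
    by (rule join) (use A in auto)
  also have "\<dots> = Suc (curves P)"
    by (rule circle) (use A assms(2) in auto)
  finally show ?thesis .
qed

text \<open>
  A cut at a half-edge of a vertex removes it from the cyclic order.
\<close>

lemma vertex_cap:
  assumes "avoids P {h} {Near, Tip}" "h \<notin> {g, k}"
  shows "curves (P \<union> {disk_arc g h, disk_arc h k, cap Near h}) = curves (insert (disk_arc g k) P)"
proof -
  have A: "Strand h s l \<notin> \<Union>P" if "l \<in> {Near, Tip}" for s l
    using assms(1) that by (auto simp: avoids_def cap_def)
  have "curves (P \<union> {disk_arc g h, disk_arc h k, cap Near h}) =
      curves (insert {Strand g Ccw Tip, Strand h Cw Tip} (insert {Strand h Cw Near, Strand h Ccw Near}
        (insert {Strand h Ccw Tip, Strand k Cw Tip} P)))"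
    by (simp add: cap_def disk_arc_def insert_commute)
  also have "\<dots> = curves (insert {Strand g Ccw Tip, Strand h Ccw Near} (insert {Strand h Ccw Tip, Strand k Cw Tip} P))"
    by (rule join) (use A assms in auto)
  also have "\<dots> = curves (insert {Strand g Ccw Tip, Strand k Cw Tip} P)"
    by (rule join) (use A assms in auto)
  finally show ?thesis by (simp add: disk_arc_def)
qed

end

section \<open>The doubled diagram as a state sum over the original nodes\<close>

definition corner_choices :: "(bool \<times> bool \<times> bool \<times> bool) list" where
  "corner_choices =
     [(i, j, k, l). i \<leftarrow> [False, True], j \<leftarrow> [False, True], k \<leftarrow> [False, True], l \<leftarrow> [False, True]]"

locale skein = involution m for m :: "'h \<Rightarrow> 'h" +
  fixes A d :: "'a::field"
  assumes A_nonzero: "A \<noteq> 0" and d_def: "d = - (A ^ 2) - A powi (-2)" and d_nonzero: "d \<noteq> 0"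
begin

text \<open>
  Whether joining a corner is an A- or a B-smoothing alternates around the crossing.
\<close>

definition crossing_weight :: "bool \<times> bool \<times> bool \<times> bool \<Rightarrow> 'a" where
  "crossing_weight = (\<lambda>(i, j, k, l).
     (if i then inverse A else A) * (if j then A else inverse A) *
     (if k then inverse A else A) * (if l then A else inverse A))"

text \<open>
  Each of the sixteen smoothings of the cabled crossing, with its coefficient in the bracket.
\<close>

definition crossing_states :: "'h \<Rightarrow> 'h \<Rightarrow> 'h \<Rightarrow> 'h \<Rightarrow> ('a \<times> 'h cable set set) list" where
  "crossing_states a b c e =
     map (\<lambda>(i, j, k, l). (crossing_weight (i, j, k, l),
            corner i a b \<union> corner j b c \<union> corner k c e \<union> corner l e a)) corner_choices"

text \<open>
  The local states of the cable of a node, with arcs between the \<open>Tip\<close>s (and, at crossings, through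
  the \<open>Core\<close>s). The circle around an isolated vertex is recorded by the weight \<open>d\<close> rather
  than by an arc, which makes the states independent of the position of the node.
\<close>

fun node_states :: "'h node \<Rightarrow> ('a \<times> 'h cable set set) list" where
  "node_states (Vertex hs) =
     [(if hs = [] then d else 1, (\<lambda>(h, h'). disk_arc h h') ` set (consecutive hs))]"
| "node_states (Crossing a b c e) = crossing_states a b c e"
| "node_states (Virtual a b c e) = [(1, parallel a c \<union> parallel b e)]"
| "node_states (Point p q) = [(1, parallel p q)]"

fun state_sum :: "'h node list \<Rightarrow> 'h cable set set \<Rightarrow> 'a" where
  "state_sum [] P = d ^ curves P"
| "state_sum (n # ns) P = (\<Sum>(w, X)\<leftarrow>node_states n. w * state_sum ns (P \<union> X))"

end

text \<open>
  The nodes of the cabled diagram by recursion on the list of nodes.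
\<close>

fun cable_nodes :: "nat \<Rightarrow> 'h node list \<Rightarrow> 'h cable node list" where
  "cable_nodes i [] = []"
| "cable_nodes i (n # ns) = cable_node i n @ cable_nodes (Suc i) ns"

lemma cable_nodes_eq:
  "concat (map (\<lambda>i. cable_node (k + i) (ns ! i)) [0..<length ns]) = cable_nodes k ns"
proof (induction ns arbitrary: k)
  case (Cons n ns)
  have "[0..<length (n # ns)] = 0 # map Suc [0..<length ns]"
    by (simp add: upt_conv_Cons map_Suc_upt del: upt_Suc)
  then show ?case using Cons[of "Suc k"] by (simp add: comp_def del: upt_Suc)
qed simp

abbreviation all_half_edges :: "'h node list \<Rightarrow> 'h set" where
  "all_half_edges ns \<equiv> (\<Union>n\<in>set ns. set (node_half_edges n))"

definition arcs :: "'c node list \<Rightarrow> 'c set set" where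
  "arcs ns = (\<Union>n\<in>set ns. (\<lambda>(x, y). {x, y}) ` opposite n)"

lemma arcs_simps [simp]:
  "arcs [] = {}" "arcs (n # ns) = (\<lambda>(x, y). {x, y}) ` opposite n \<union> arcs ns"
  "arcs (xs @ ys) = arcs xs \<union> arcs ys"
  by (auto simp: arcs_def)

lemma Union_arcs_subset: "\<Union>(arcs ns) \<subseteq> all_half_edges ns"
proof -
  have "x \<in> set (node_half_edges n)" if "p \<in> opposite n" "x \<in> {fst p, snd p}" for n p and x :: 'a
    using that by (cases n) auto
  then show ?thesis by (fastforce simp: arcs_def)
qed

lemma finite_Union_arcs [simp]: "finite (\<Union>(arcs ns))"
  by (rule finite_subset[OF Union_arcs_subset]) simp

lemma set_consecutive:
  "fst ` set (consecutive hs) = set hs" "snd ` set (consecutive hs) = set hs"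
proof -
  have "map fst (consecutive hs) = hs" "map snd (consecutive hs) = rotate1 hs"
    by (simp_all add: consecutive_def)
  then show "fst ` set (consecutive hs) = set hs" "snd ` set (consecutive hs) = set hs"
    by (metis set_map set_rotate1)+
qed

lemma consecutive_mem: "(h, h') \<in> set (consecutive hs) \<Longrightarrow> h \<in> set hs \<and> h' \<in> set hs"
  using set_consecutive[of hs] by (metis fst_conv image_eqI snd_conv)

lemma cable_node_half_edges:
  assumes "x \<in> all_half_edges (cable_node i n)"
  shows "(\<exists>h\<in>set (node_half_edges n). \<exists>s l. l \<in> {Tip, Core} \<and> x = Strand h s l) \<or>
    (\<exists>s. x = Iso i s)"
  using assms
  by (cases n) (auto simp: cable_crossing_def split: if_splits dest!: consecutive_mem)

lemma cable_nodes_half_edges: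
  assumes "x \<in> all_half_edges (cable_nodes i ns)"
  shows "(\<exists>h\<in>all_half_edges ns. \<exists>s l. l \<in> {Tip, Core} \<and> x = Strand h s l) \<or>
    (\<exists>j s. i \<le> j \<and> x = Iso j s)"
  using assms
proof (induction ns arbitrary: i)
  case (Cons n ns)
  then consider "x \<in> all_half_edges (cable_node i n)" | "x \<in> all_half_edges (cable_nodes (Suc i) ns)"
    by auto
  then show ?case
  proof cases
    case 1
    from cable_node_half_edges[OF this] show ?thesis by auto
  next
    case 2
    from Cons.IH[OF this] show ?thesis by (auto dest: Suc_leD)
  qed
qed simp

lemma cable_node_closed:
  assumes "x \<in> all_half_edges (cable_node i n)" "x = Strand h s Core \<or> x = Iso i s"
  shows "cable_mate m x \<in> all_half_edges (cable_node i n)"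
  using assms by (cases n) (auto simp: cable_crossing_def split: if_splits)

lemma cable_node_Tip:
  assumes "h \<in> set (node_half_edges n)"
  shows "Strand h s Tip \<in> all_half_edges (cable_node i n)"
proof (cases n)
  case (Vertex hs)
  with assms have h: "h \<in> set hs" by simp
  then obtain g k where "(h, k) \<in> set (consecutive hs)" "(g, h) \<in> set (consecutive hs)"
    using set_consecutive[of hs] by (metis (no_types, lifting) imageE prod.collapse)
  moreover have "hs \<noteq> []" using h by auto
  ultimately show ?thesis using Vertex by (cases s) force+
qed (use assms in \<open>cases s; auto simp: cable_crossing_def\<close>)+

context skein begin

lemma node_states_finite: "(w, X) \<in> set (node_states n) \<Longrightarrow> finite (\<Union>X)"
  by (cases n) (auto simp: crossing_states_def corner_def parallel_def disk_arc_def)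

lemma node_states_avoids:
  assumes "(w, X) \<in> set (node_states n)" "H \<inter> set (node_half_edges n) = {}"
  shows "avoids X H K"
proof -
  have "h \<in> set (node_half_edges n)" if "Strand h s l \<in> \<Union>X" for h s l
    using assms(1) that
    by (cases n) (auto simp: crossing_states_def corner_def parallel_def disk_arc_def dest: consecutive_mem split: if_splits)
  then show ?thesis using assms(2) by (auto simp: avoids_def)
qed

lemma arcs_avoids:
  assumes "all_half_edges r = all_half_edges (cable_nodes i ns)" "H \<inter> all_half_edges ns = {}"
  shows "avoids (arcs r) H K"
proof -
  have "h \<in> all_half_edges ns" if "Strand h s l \<in> \<Union>(arcs r)" for h s l
  proof -
    have "Strand h s l \<in> all_half_edges (cable_nodes i ns)"
      using that Union_arcs_subset[of r] unfolding assms(1) by (rule rev_subsetD)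
    from cable_nodes_half_edges[OF this] show ?thesis by auto
  qed
  then show ?thesis using assms(2) unfolding avoids_def by blast
qed

lemma expand_four_crossings:
  assumes "is_crossing n1" "is_crossing n2" "is_crossing n3" "is_crossing n4"
  shows "expand A (inverse A) ([n1, n2, n3, n4] @ ns) F =
    (\<Sum>(i, j, k, l)\<leftarrow>corner_choices. crossing_weight (i, j, k, l) * expand A (inverse A) ns
       (\<lambda>r. F (((if i then smoothB n1 else smoothA n1) @ (if j then smoothA n2 else smoothB n2) @
               (if k then smoothB n3 else smoothA n3) @ (if l then smoothA n4 else smoothB n4)) @ r)))"
  using assms by (simp add: corner_choices_def crossing_weight_def algebra_simps)

text \<open>
  The virtual crossings and the circles around isolated vertices are resolved here, once and for all;
  from now on only the arcs of \<open>node_states\<close> occur.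
\<close>

lemma expand_cable_nodes:
  assumes "distinct (concat (map node_half_edges ns))"
    and "finite (\<Union>P)" "avoids P (all_half_edges ns) {Core}"
    and "\<And>j s. i \<le> j \<Longrightarrow> Iso j s \<notin> \<Union>P"
  shows "expand A (inverse A) (cable_nodes i ns) (\<lambda>r. d ^ curves (P \<union> arcs r)) = state_sum ns P"
  using assms
proof (induction ns arbitrary: i P)
  case Nil
  then show ?case by simp
next
  case (Cons n ns)
  have dist: "distinct (node_half_edges n)" "distinct (concat (map node_half_edges ns))"
    and disj: "set (node_half_edges n) \<inter> all_half_edges ns = {}"
    using Cons.prems(1) by auto
  have IH: "expand A (inverse A) (cable_nodes (Suc i) ns) (\<lambda>r. d ^ curves (P \<union> X \<union> arcs r))
       = state_sum ns (P \<union> X)"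
    if "(w, X) \<in> set (node_states n)" for w X
  proof (rule Cons.IH[OF dist(2)])
    show "finite (\<Union>(P \<union> X))" using Cons.prems(2) node_states_finite[OF that] by simp
    show "avoids (P \<union> X) (all_half_edges ns) {Core}"
      using Cons.prems(3) node_states_avoids[OF that, of "all_half_edges ns"] disj
      by (auto elim: avoids_mono)
    show "Iso j s \<notin> \<Union>(P \<union> X)" if "Suc i \<le> j" for j s
    proof -
      have "Iso j s \<notin> \<Union>X"
        using \<open>(w, X) \<in> _\<close> by (cases n)
          (auto simp: crossing_states_def corner_def parallel_def disk_arc_def split: if_splits)
      then show ?thesis using Cons.prems(4)[of j s] that by auto
    qed
  qed
  show ?case
  proof (cases n)
    case (Vertex hs)
    show ?thesis
    proof (cases "hs = []")
      case True
      have "expand A (inverse A) (cable_nodes (Suc i) ns) (\<lambda>r. d ^ curves (insert {Iso i Cw, Iso i Ccw} (P \<union> arcs r)))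
         = expand A (inverse A) (cable_nodes (Suc i) ns) (\<lambda>r. d * d ^ curves (P \<union> arcs r))"
      proof (rule expand_cong_strong)
        fix r assume r: "all_half_edges r = all_half_edges (cable_nodes (Suc i) ns)"
        have "Iso i s \<notin> \<Union>(P \<union> arcs r)" for s
        proof -
          have "Iso i s \<notin> \<Union>(arcs r)"
          proof
            assume "Iso i s \<in> \<Union>(arcs r)"
            then have "Iso i s \<in> all_half_edges (cable_nodes (Suc i) ns)"
              using Union_arcs_subset[of r] unfolding r by (rule rev_subsetD)
            from cable_nodes_half_edges[OF this] show False by auto
          qed
          then show ?thesis using Cons.prems(4)[of i s] by auto
        qed
        then have "curves (insert {Iso i Cw, Iso i Ccw} (P \<union> arcs r)) = Suc (curves (P \<union> arcs r))"
          by (intro circle) (use Cons.prems(2) in auto)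
        then show "d ^ curves (insert {Iso i Cw, Iso i Ccw} (P \<union> arcs r)) = d * d ^ curves (P \<union> arcs r)"
          by simp
      qed
      then show ?thesis
        using IH Vertex True by (simp add: expand_mult consecutive_def)
    next
      case False
      let ?V = "map (\<lambda>(h, h'). Point (Strand h Ccw Tip) (Strand h' Cw Tip)) (consecutive hs)"
      have a: "arcs ?V = (\<lambda>(h, h'). disk_arc h h') ` set (consecutive hs)"
        by (force simp: arcs_def disk_arc_def)
      have "\<forall>n\<in>set ?V. \<not> is_crossing n" by auto
      then show ?thesis using False Vertex IH
        by (simp add: expand_append expand_no_crossing a Un_assoc)
    qed
  next
    case (Crossing a b c e)
    have "expand A (inverse A) (cable_nodes i (n # ns)) (\<lambda>r. d ^ curves (P \<union> arcs r)) =
      (\<Sum>(i, j, k, l)\<leftarrow>corner_choices. crossing_weight (i, j, k, l) *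
         state_sum ns (P \<union> (corner i a b \<union> corner j b c \<union> corner k c e \<union> corner l e a)))"
      unfolding cable_nodes.simps Crossing cable_node.simps cable_crossing_def
    proof (subst expand_four_crossings, goal_cases)
      case 5
      show ?case
      proof (intro arg_cong[of _ _ sum_list] map_cong refl, clarify, goal_cases)
        case (1 i j k l)
        let ?X = "corner i a b \<union> corner j b c \<union> corner k c e \<union> corner l e a"
        have "(crossing_weight (i, j, k, l), ?X) \<in> set (node_states n)"
          using 1 by (auto simp: Crossing crossing_states_def intro!: image_eqI[of _ _ "(i, j, k, l)"])
        from IH[OF this] show ?case
          by (cases i; cases j; cases k; cases l; simp add: corner_def insert_commute)
      qed
    qed simp_all
    then show ?thesis
      by (simp add: Crossing crossing_states_def comp_def split_def)
  next
    case (Virtual a b c e)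
    have "expand A (inverse A) (cable_nodes (Suc i) ns) (\<lambda>r. d ^ curves (P \<union> arcs r \<union> virtual_arcs a b c e))
        = expand A (inverse A) (cable_nodes (Suc i) ns)
            (\<lambda>r. d ^ curves (P \<union> arcs r \<union> parallel a c \<union> parallel b e))"
    proof (rule expand_cong_strong)
      fix r assume r: "all_half_edges r = all_half_edges (cable_nodes (Suc i) ns)"
      have "curves (P \<union> arcs r \<union> virtual_arcs a b c e) = curves (P \<union> arcs r \<union> parallel a c \<union> parallel b e)"
      proof (rule virtual_arcs)
        show "distinct [a, b, c, e]" using dist Virtual by simp
        show "avoids (P \<union> arcs r) {a, b, c, e} {Core}"
          using Cons.prems(3) arcs_avoids[OF r, of "{a, b, c, e}"] disj Virtual
          by (auto elim: avoids_mono)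
      qed
      then show "d ^ curves (P \<union> arcs r \<union> virtual_arcs a b c e) =
          d ^ curves (P \<union> arcs r \<union> parallel a c \<union> parallel b e)" by simp
    qed
    then show ?thesis
      using IH Virtual
      by (simp add: cable_crossing_def virtual_arcs_def Un_ac insert_commute)
  next
    case (Point p q)
    then show ?thesis
      using IH by (simp add: parallel_def)
  qed
qed

end

text \<open>
  In a diagram without vertices and crossings the half-edges are exactly the ends of arcs. The mate
  function of the cabled diagram may be replaced by any \<open>M\<close> that agrees with it there.
\<close>

lemma strands_eq_loops:
  assumes "\<forall>n\<in>set r. \<not> is_vertex n"
    and closed: "\<And>x. x \<in> all_half_edges r \<Longrightarrow> \<mu> x = M x \<and> M x \<in> all_half_edges r"
  shows "card (strands (Diagram r \<mu>)) = loops M (arcs r)"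
proof -
  have "x \<in> \<Union>((\<lambda>(x, y). {x, y}) ` opposite n)" if "x \<in> set (node_half_edges n)" "n \<in> set r" for x n
    using that assms(1) by (cases n) auto
  then have X: "all_half_edges r = \<Union>(arcs r)"
    using Union_arcs_subset[of r] by (fastforce simp: arcs_def)
  have "strand_rel (Diagram r \<mu>) \<union> (strand_rel (Diagram r \<mu>))\<inverse> = link M (arcs r) \<union> (link M (arcs r))\<inverse>"
  proof -
    have "{(h, \<mu> h) |h. h \<in> all_half_edges r} =
        {(x, M x) |x. x \<in> all_half_edges r \<and> M x \<in> all_half_edges r}"
      using closed by (metis (no_types, lifting))
    then have 1: "strand_rel (Diagram r \<mu>) =
        {(x, M x) |x. x \<in> \<Union>(arcs r) \<and> M x \<in> \<Union>(arcs r)} \<union> (\<Union>n\<in>set r. opposite n)"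
      unfolding strand_rel_def half_edges_def diagram.sel X by (rule arg_cong)
    have "{x, y} \<in> arcs r \<longleftrightarrow> (\<exists>n\<in>set r. (x, y) \<in> opposite n \<or> (y, x) \<in> opposite n)" for x y
      by (force simp: arcs_def doubleton_eq_iff)
    then have 2: "{(x, y). {x, y} \<in> arcs r} = (\<Union>n\<in>set r. opposite n) \<union> (\<Union>n\<in>set r. opposite n)\<inverse>"
      by auto
    show ?thesis
      unfolding 1 link_def 2 by (simp only: converse_Un converse_converse Un_ac Un_left_absorb Un_absorb)
  qed
  then show ?thesis
    by (simp add: strands_def loops_def classes_def half_edges_def X)
qed

definition box_nodes :: "'h set \<Rightarrow> 'h list \<Rightarrow> 'h cable node list" where
  "box_nodes S hs = concat (map (\<lambda>h. if h \<in> S then cup_cap_box h else identity_box h) hs)"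

lemma arcs_box_nodes: "arcs (box_nodes S hs) = boxes S (set hs)"
  by (induction hs)
    (auto simp: box_nodes_def boxes_def cut_def through_def cap_def cup_cap_box_def identity_box_def)

lemma box_nodes_half_edges:
  "all_half_edges (box_nodes S hs) = {Strand h s l |h s l. h \<in> set hs \<and> l \<in> {Near, Far}}"
proof -
  have "s = Cw \<or> s = Ccw" for s by (cases s) auto
  then have "all_half_edges (if h \<in> S then cup_cap_box h else identity_box h) =
      {Strand h s l |s l. l \<in> {Near, Far}}" for h
    by (auto simp: cup_cap_box_def identity_box_def)
  note box = this
  have "all_half_edges (box_nodes S hs) =
      (\<Union>h\<in>set hs. all_half_edges (if h \<in> S then cup_cap_box h else identity_box h))"
    by (induction hs) (simp_all only: box_nodes_def list.simps concat.simps set_append UN_Un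
        UN_insert UN_empty set_simps)
  then show ?thesis unfolding box by blast
qed

lemma nodes_cable_diagram:
  "nodes (cable_diagram S D) =
     cable_nodes 0 (nodes D) @ box_nodes S (concat (map node_half_edges (nodes D)))"
  using cable_nodes_eq[of 0 "nodes D"] by (simp add: cable_diagram_def box_nodes_def)

lemma cable_nodes_closed:
  assumes "x \<in> all_half_edges (cable_nodes i ns)" "x = Strand h s Core \<or> x = Iso j s"
  shows "cable_mate m x \<in> all_half_edges (cable_nodes i ns)"
  using assms
proof (induction ns arbitrary: i)
  case (Cons n ns)
  then consider "x \<in> all_half_edges (cable_node i n)" | "x \<in> all_half_edges (cable_nodes (Suc i) ns)"
    by auto
  then show ?case
  proof cases
    case 1
    then have "x = Strand h s Core \<or> x = Iso i s"
      using cable_node_half_edges[OF 1] Cons.prems(2) by auto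
    then have "cable_mate m x \<in> all_half_edges (cable_node i n)"
      using cable_node_closed[OF 1, of h s] by auto
    then show ?thesis by auto
  next
    case 2
    from Cons.IH[OF this Cons.prems(2)] show ?thesis by auto
  qed
qed simp

lemma cable_nodes_Tip:
  assumes "h \<in> all_half_edges ns"
  shows "Strand h s Tip \<in> all_half_edges (cable_nodes i ns)"
  using assms
proof (induction ns arbitrary: i)
  case (Cons n ns)
  then show ?case using cable_node_Tip[of h n s i] Cons.IH[of "Suc i"] by auto
qed simp

text \<open>
  Every segment of the cabled diagram has both ends in it, so \<open>link\<close> ignores none of them.
\<close>

lemma cable_diagram_closed:
  assumes "x \<in> half_edges (cable_diagram S D)"
    and m: "\<And>h. h \<in> half_edges D \<Longrightarrow> mate D h = m h \<and> m h \<in> half_edges D"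
  shows "cable_mate (mate D) x = cable_mate m x \<and> cable_mate m x \<in> half_edges (cable_diagram S D)"
proof -
  let ?H = "half_edges D"
  have H: "half_edges (cable_diagram S D) =
     all_half_edges (cable_nodes 0 (nodes D)) \<union> {Strand h s l |h s l. h \<in> ?H \<and> l \<in> {Near, Far}}"
    by (simp add: half_edges_def nodes_cable_diagram box_nodes_half_edges UN_Un)
  note Tip = cable_nodes_Tip[of _ "nodes D" _ 0, folded half_edges_def]
  show ?thesis
    using assms(1) unfolding H
  proof
    assume x: "x \<in> all_half_edges (cable_nodes 0 (nodes D))"
    from cable_nodes_half_edges[OF this] consider h s where "h \<in> ?H" "x = Strand h s Tip"
      | h s where "x = Strand h s Core" | j s where "x = Iso j s"
      by (auto simp: half_edges_def)
    then show "cable_mate (mate D) x = cable_mate m x \<and> cable_mate m x \<in>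
     all_half_edges (cable_nodes 0 (nodes D)) \<union> {Strand h s l |h s l. h \<in> ?H \<and> l \<in> {Near, Far}}"
    proof cases
      case (2 h s)
      then show ?thesis using cable_nodes_closed[OF x, of h s 0 m] by auto
    next
      case (3 j s)
      then show ?thesis using cable_nodes_closed[OF x, of undefined s j m] by auto
    qed auto
  next
    assume "x \<in> {Strand h s l |h s l. h \<in> ?H \<and> l \<in> {Near, Far}}"
    then show "cable_mate (mate D) x = cable_mate m x \<and> cable_mate m x \<in>
     all_half_edges (cable_nodes 0 (nodes D)) \<union> {Strand h s l |h s l. h \<in> ?H \<and> l \<in> {Near, Far}}"
      using m Tip by auto
  qed
qed

lemma cable_node_not_vertex: "n' \<in> set (cable_node i n) \<Longrightarrow> \<not> is_vertex n'"
  by (cases n) (auto simp: cable_crossing_def split: if_splits)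

lemma cable_nodes_not_vertex: "n' \<in> set (cable_nodes i ns) \<Longrightarrow> \<not> is_vertex n'"
  by (induction ns arbitrary: i) (auto dest: cable_node_not_vertex)

lemma box_nodes_not_vertex: "n' \<in> set (box_nodes S hs) \<Longrightarrow> \<not> is_vertex n' \<and> \<not> is_crossing n'"
  by (auto simp: box_nodes_def cup_cap_box_def identity_box_def split: if_splits)

context skein begin

lemma bracket_eq_state_sum:
  assumes D: "is_diagram D" and m: "\<And>h. h \<in> half_edges D \<Longrightarrow> m h = mate D h"
  shows "d * bracket A (inverse A) d (cable_diagram S D) = state_sum (nodes D) (boxes S (half_edges D))"
proof -
  let ?C = "cable_nodes 0 (nodes D)" and ?B = "box_nodes S (concat (map node_half_edges (nodes D)))"
  let ?P = "boxes S (half_edges D)"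
  have H: "half_edges D = set (concat (map node_half_edges (nodes D)))"
    by (auto simp: half_edges_def)
  have B: "arcs ?B = ?P" unfolding H by (rule arcs_box_nodes)
  have closed: "mate D h = m h \<and> m h \<in> half_edges D" if "h \<in> half_edges D" for h
    using D m that by (auto simp: is_diagram_def)
  have "d * bracket A (inverse A) d (cable_diagram S D) =
      expand A (inverse A) (?C @ ?B) (\<lambda>r. d ^ card (strands (Diagram r (cable_mate (mate D)))))"
    unfolding bracket_eq_expand[OF d_nonzero] nodes_cable_diagram by (simp add: cable_diagram_def)
  also have "\<dots> = expand A (inverse A) (?C @ ?B) (\<lambda>r. d ^ curves (arcs r))"
  proof (rule expand_cong_strong)
    fix r assume r: "all_half_edges r = all_half_edges (?C @ ?B)" "\<forall>n\<in>set r. is_vertex n \<longrightarrow> n \<in> set (?C @ ?B)"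
    have "all_half_edges r = half_edges (cable_diagram S D)"
      unfolding r(1) by (simp add: half_edges_def nodes_cable_diagram)
    then have "card (strands (Diagram r (cable_mate (mate D)))) = curves (arcs r)"
      using r(2) cable_diagram_closed[of _ S D m] closed
      by (intro strands_eq_loops) (auto dest: cable_nodes_not_vertex box_nodes_not_vertex)
    then show "d ^ card (strands (Diagram r (cable_mate (mate D)))) = d ^ curves (arcs r)" by simp
  qed
  also have "\<dots> = expand A (inverse A) ?C (\<lambda>r. d ^ curves (?P \<union> arcs r))"
  proof -
    have "\<forall>n\<in>set ?B. \<not> is_crossing n" using box_nodes_not_vertex by blast
    then show ?thesis by (simp add: expand_append expand_no_crossing B Un_commute)
  qed
  also have "\<dots> = state_sum (nodes D) ?P"
  proof (rule expand_cable_nodes)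
    show "distinct (concat (map node_half_edges (nodes D)))" using D by (simp add: is_diagram_def)
    show "finite (\<Union>?P)" using finite_Union_arcs[of ?B] unfolding B .
    show "avoids ?P (all_half_edges (nodes D)) {Core}"
      by (auto simp: avoids_def boxes_def cut_def through_def cap_def)
    show "Iso j s \<notin> \<Union>?P" for j s
      by (auto simp: boxes_def cut_def through_def cap_def)
  qed
  finally show ?thesis .
qed

end

section \<open>Projectors and the crossing rule\<close>

lemma boxes_remove:
  "h \<in> H \<Longrightarrow> boxes S H = boxes S (H - {h}) \<union> (if h \<in> S then cut h else through h)"
  by (auto simp: boxes_def)

lemma boxes_cong: "S \<inter> H = S' \<inter> H \<Longrightarrow> boxes S H = boxes S' H"
  unfolding boxes_def by (rule SUP_cong) auto

lemma boxes_Un: "boxes S (H \<union> H') = boxes S H \<union> boxes S H'"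
  by (auto simp: boxes_def)

lemma finite_boxes: "finite H \<Longrightarrow> finite (\<Union>(boxes S H))"
  by (auto simp: boxes_def cut_def through_def cap_def)

lemma avoids_boxes: "H \<inter> H' = {} \<or> K \<subseteq> {Tip, Core} \<Longrightarrow> avoids (boxes S H) H' K"
  by (auto simp: avoids_def boxes_def cut_def through_def cap_def split: if_splits)

context skein begin

text \<open>
  The expansion of the projectors at the sites \<open>T\<close>: \<open>S\<close> is the set of sites with a cup-cap pair.
\<close>

definition project :: "'h set \<Rightarrow> ('h set \<Rightarrow> 'a) \<Rightarrow> 'a" where
  "project T f = (\<Sum>S\<in>Pow T. (- (1 / d)) ^ card S * f S)"

text \<open>
  The two terms of the projector at \<open>h\<close> cancel if the cup-cap term has one more curve.
\<close>

lemma project_eq_0: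
  assumes "finite T" "h \<in> T" and f: "\<And>S. S \<subseteq> T - {h} \<Longrightarrow> f (insert h S) = d * f S"
  shows "project T f = 0"
proof -
  have T: "T = insert h (T - {h})" using assms(2) by blast
  have "(- (1 / d)) ^ card (insert h S) * f (insert h S) = - ((- (1 / d)) ^ card S * f S)"
    if "S \<subseteq> T - {h}" for S
  proof -
    have "finite S" "h \<notin> S" using that assms(1) finite_subset by auto
    then show ?thesis using f[OF that] d_nonzero by simp
  qed
  then show ?thesis
    unfolding project_def
    by (subst T, subst sum_Pow_insert) (use assms(1) in \<open>simp_all add: sum_negf\<close>)
qed

lemma project_mult: "project T (\<lambda>S. c * f S) = c * project T f"
  by (simp add: project_def sum_distrib_left mult.left_commute)

lemma project_add: "project T (\<lambda>S. f S + g S) = project T f + project T g"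
  by (simp add: project_def sum.distrib algebra_simps)

lemma project_sum_list: "project T (\<lambda>S. \<Sum>x\<leftarrow>xs. f x S) = (\<Sum>x\<leftarrow>xs. project T (f x))"
  by (induction xs) (simp_all add: project_add, simp add: project_def)

text \<open>
  The relation \<open>P\<^sub>2 e\<^sub>1 = 0\<close>.
\<close>

lemma project_turnback:
  assumes "h \<in> T" "T \<subseteq> H" "finite H" "avoids P {h} {Near, Tip, Core}" "finite (\<Union>P)"
  shows "project T (\<lambda>S. d ^ curves (P \<union> boxes S H \<union>
     {{Strand h Ccw Tip, Strand h Ccw Core}, {Strand h Cw Tip, Strand h Cw Core}})) = 0"
proof (rule project_eq_0)
  show "finite T" using assms finite_subset by auto
  fix S assume S: "S \<subseteq> T - {h}"
  let ?X = "{{Strand h Ccw Tip, Strand h Ccw Core}, {Strand h Cw Tip, Strand h Cw Core}}"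
  let ?Q = "P \<union> boxes S (H - {h})"
  have h: "h \<in> H" "h \<notin> S" using assms S by auto
  have "boxes (insert h S) (H - {h}) = boxes S (H - {h})" by (rule boxes_cong) auto
  then have "P \<union> boxes (insert h S) H \<union> ?X = ?Q \<union> ?X \<union> cut h" "P \<union> boxes S H \<union> ?X = ?Q \<union> ?X \<union> through h"
    using boxes_remove[OF h(1), of S] boxes_remove[OF h(1), of "insert h S"] h(2) by auto
  moreover have "avoids ?Q {h} {Near, Tip, Core}" "finite (\<Union>?Q)"
    using assms avoids_boxes[of "H - {h}" "{h}"] finite_boxes[of "H - {h}" S] by auto
  ultimately show "d ^ curves (P \<union> boxes (insert h S) H \<union> ?X) = d * d ^ curves (P \<union> boxes S H \<union> ?X)"
    using turnback_cut[of ?Q h] turnback_through[of ?Q h] by simp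
qed (rule assms)

text \<open>
  The crossing rule, for a single crossing among arbitrary other arcs \<open>P\<close>.
\<close>

lemma project_crossing:
  assumes "distinct [a, b, c, e]" "{a, b, c, e} \<subseteq> T" "T \<subseteq> H" "finite H"
    and P: "avoids P {a, b, c, e} {Near, Tip, Core}" "finite (\<Union>P)"
  shows "project T (\<lambda>S. state_sum [Crossing a b c e] (P \<union> boxes S H)) =
      A ^ 4 * project T (\<lambda>S. state_sum [Point b c, Point e a] (P \<union> boxes S H))
    + inverse (A ^ 4) * project T (\<lambda>S. state_sum [Point a b, Point c e] (P \<union> boxes S H))
    - d * project T (\<lambda>S. state_sum [Vertex [a, b, c, e]] (P \<union> boxes S H))"
proof -
  define X where "X i j k l = corner i a b \<union> corner j b c \<union> corner k c e \<union> corner l e a" for i j k l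
  define G where "G i j k l = project T (\<lambda>S. d ^ curves (P \<union> boxes S H \<union> X i j k l))" for i j k l
  define V where "V = project T (\<lambda>S. d ^ curves (P \<union> boxes S H \<union> {disk_arc a b, disk_arc b c, disk_arc c e, disk_arc e a}))"
  define PA where "PA = project T (\<lambda>S. d ^ curves (P \<union> boxes S H \<union> parallel b c \<union> parallel e a))"
  define PB where "PB = project T (\<lambda>S. d ^ curves (P \<union> boxes S H \<union> parallel a b \<union> parallel c e))"
  have B: "avoids (P \<union> boxes S H) {a, b, c, e} {Core}" "finite (\<Union>(P \<union> boxes S H))" for S
    using P assms(4) avoids_boxes[of H _ "{Core}"] finite_boxes[of H S]
    by (auto elim: avoids_mono)
  have turn: "G i j k l = 0" if "\<not> i \<and> \<not> j \<or> \<not> j \<and> \<not> k \<or> \<not> k \<and> \<not> l \<or> \<not> l \<and> \<not> i" for i j k l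
  proof -
    have zero: "G i j k l = 0" if "h \<in> {a, b, c, e}"
      "X i j k l = Y \<union> {{Strand h Ccw Tip, Strand h Ccw Core}, {Strand h Cw Tip, Strand h Cw Core}}"
      "avoids Y {h} {Near, Tip, Core}" "finite (\<Union>Y)" for h Y
    proof -
      have "avoids P {h} {Near, Tip, Core}" using P(1) that(1) by (auto elim: avoids_mono)
      then have "project T (\<lambda>S. d ^ curves ((P \<union> Y) \<union> boxes S H \<union>
          {{Strand h Ccw Tip, Strand h Ccw Core}, {Strand h Cw Tip, Strand h Cw Core}})) = 0"
        by (intro project_turnback) (use that P assms in auto)
      then show ?thesis unfolding G_def that(2) by (simp add: Un_ac)
    qed
    from that consider "\<not> i" "\<not> j" | "\<not> j" "\<not> k" | "\<not> k" "\<not> l" | "\<not> l" "\<not> i" by blast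
    then show ?thesis
    proof cases
      case 1
      show ?thesis
        by (rule zero[of b "corner k c e \<union> corner l e a \<union>
              {{Strand a Ccw Tip, Strand a Ccw Core}, {Strand c Cw Tip, Strand c Cw Core}}"])
          (use 1 assms(1) in \<open>auto simp: X_def corner_def avoids_def\<close>)
    next
      case 2
      show ?thesis
        by (rule zero[of c "corner l e a \<union> corner i a b \<union>
              {{Strand b Ccw Tip, Strand b Ccw Core}, {Strand e Cw Tip, Strand e Cw Core}}"])
          (use 2 assms(1) in \<open>auto simp: X_def corner_def avoids_def\<close>)
    next
      case 3
      show ?thesis
        by (rule zero[of e "corner i a b \<union> corner j b c \<union>
              {{Strand c Ccw Tip, Strand c Ccw Core}, {Strand a Cw Tip, Strand a Cw Core}}"])
          (use 3 assms(1) in \<open>auto simp: X_def corner_def avoids_def\<close>)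
    next
      case 4
      show ?thesis
        by (rule zero[of a "corner j b c \<union> corner k c e \<union>
              {{Strand e Ccw Tip, Strand e Ccw Core}, {Strand b Cw Tip, Strand b Cw Core}}"])
          (use 4 assms(1) in \<open>auto simp: X_def corner_def avoids_def\<close>)
    qed
  qed
  have circ: "G True True True True = d * V"
    unfolding G_def V_def X_def project_mult[symmetric] Un_assoc[symmetric]
    using corners_vertex_circle[OF assms(1) B] by simp
  have rot: "avoids Q {b, c, e, a} K = avoids Q {a, b, c, e} K"
    "avoids Q {c, e, a, b} K = avoids Q {a, b, c, e} K"
    "avoids Q {e, a, b, c} K = avoids Q {a, b, c, e} K" for Q :: "'h cable set set" and K
    by (simp_all add: insert_commute)
  have dist: "distinct [b, c, e, a]" "distinct [c, e, a, b]" "distinct [e, a, b, c]"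
    using assms(1) by auto
  have vert: "G False True True True = V" "G True False True True = V"
    "G True True False True = V" "G True True True False = V"
    unfolding G_def V_def X_def Un_assoc[symmetric]
    using corners_vertex[OF assms(1) B(1)]
      corners_vertex[of b c e a "P \<union> boxes _ H", unfolded rot, OF dist(1) B(1)]
      corners_vertex[of c e a b "P \<union> boxes _ H", unfolded rot, OF dist(2) B(1)]
      corners_vertex[of e a b c "P \<union> boxes _ H", unfolded rot, OF dist(3) B(1)]
    by (simp_all add: Un_ac insert_commute)
  have par: "G False True False True = PA" "G True False True False = PB"
    unfolding G_def PA_def PB_def X_def Un_assoc[symmetric]
    using corners_parallel[OF assms(1) B(1)]
      corners_parallel[of b c e a "P \<union> boxes _ H", unfolded rot, OF dist(1) B(1)]
    by (simp_all add: Un_ac)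
  have V: "V = project T (\<lambda>S. state_sum [Vertex [a, b, c, e]] (P \<union> boxes S H))"
    by (simp add: V_def consecutive_def)
  have PA: "PA = project T (\<lambda>S. state_sum [Point b c, Point e a] (P \<union> boxes S H))"
    by (simp add: PA_def)
  have PB: "PB = project T (\<lambda>S. state_sum [Point a b, Point c e] (P \<union> boxes S H))"
    by (simp add: PB_def)
  have "project T (\<lambda>S. state_sum [Crossing a b c e] (P \<union> boxes S H)) =
      project T (\<lambda>S. \<Sum>(i, j, k, l)\<leftarrow>corner_choices. crossing_weight (i, j, k, l) *
        d ^ curves (P \<union> boxes S H \<union> X i j k l))"
    by (simp add: crossing_states_def comp_def split_def X_def)
  also have "\<dots> = (\<Sum>(i, j, k, l)\<leftarrow>corner_choices. crossing_weight (i, j, k, l) * G i j k l)"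
    unfolding project_sum_list split_def project_mult G_def ..
  \<comment> \<open>The vertex pattern with its circle has weight 1. A single unjoined corner changes one
    smoothing from B to A or from A to B, which gives \<open>A\<^sup>2\<close> twice and \<open>A\<^sup>-\<^sup>2\<close> twice.\<close>
  also have "\<dots> = A ^ 4 * PA + inverse A ^ 4 * PB + (d + 2 * A ^ 2 + 2 * inverse A ^ 2) * V"
    using A_nonzero
    by (simp add: corner_choices_def crossing_weight_def turn circ vert par field_simps
        power2_eq_square eval_nat_numeral)
  also have "d + 2 * A ^ 2 + 2 * inverse A ^ 2 = - d"
    using d_def by (simp add: power_int_minus power_inverse)
  finally show ?thesis
    unfolding V PA PB by (simp add: power_inverse)
qed

text \<open>
  The nodes contribute independently, so their order is immaterial. Hence all other nodes can be
  resolved first and the crossing rule is needed only for a single crossing.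
\<close>

lemma state_sum_swap: "state_sum (n # n' # ns) P = state_sum (n' # n # ns) P"
proof -
  have swap: "(\<Sum>x\<leftarrow>xs. \<Sum>y\<leftarrow>ys. f x y) = (\<Sum>y\<leftarrow>ys. \<Sum>x\<leftarrow>xs. f x y)"
    for xs ys :: "('a \<times> 'h cable set set) list" and f :: "_ \<Rightarrow> _ \<Rightarrow> 'a"
    by (induction xs) (simp_all add: sum_list_addf)
  show ?thesis
    unfolding state_sum.simps split_def sum_list_const_mult[symmetric]
    by (subst swap) (simp add: Un_ac mult.left_commute)
qed

lemma state_sum_move: "state_sum (ns @ n # ns') P = state_sum (n # ns @ ns') P"
proof (induction ns arbitrary: P)
  case (Cons k ns)
  have "state_sum ((k # ns) @ n # ns') P = state_sum (k # n # ns @ ns') P"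
    using Cons by simp
  then show ?case using state_sum_swap by simp
qed simp

lemma state_sum_commute: "state_sum (ns @ ns') P = state_sum (ns' @ ns) P"
proof (induction ns arbitrary: P)
  case (Cons n ns)
  then have "state_sum ((n # ns) @ ns') P = state_sum (n # ns' @ ns) P" by simp
  then show ?case using state_sum_move by simp
qed simp

lemma state_sum_to_end: "state_sum (ns1 @ xs @ ns2) P = state_sum ((ns2 @ ns1) @ xs) P"
proof -
  have "state_sum (ns1 @ (xs @ ns2)) P = state_sum (xs @ (ns2 @ ns1)) P"
    by (subst state_sum_commute) simp
  then show ?thesis using state_sum_commute by metis
qed

lemma project_crossing_context:
  assumes "distinct [a, b, c, e]" "{a, b, c, e} \<subseteq> T" "T \<subseteq> H" "finite H"
    and "avoids P {a, b, c, e} {Near, Tip, Core}" "finite (\<Union>P)"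
    and "all_half_edges ns \<inter> {a, b, c, e} = {}"
  shows "project T (\<lambda>S. state_sum (ns @ [Crossing a b c e]) (P \<union> boxes S H)) =
      A ^ 4 * project T (\<lambda>S. state_sum (ns @ [Point b c, Point e a]) (P \<union> boxes S H))
    + inverse (A ^ 4) * project T (\<lambda>S. state_sum (ns @ [Point a b, Point c e]) (P \<union> boxes S H))
    - d * project T (\<lambda>S. state_sum (ns @ [Vertex [a, b, c, e]]) (P \<union> boxes S H))"
  using assms(5-7)
proof (induction ns arbitrary: P)
  case Nil
  then show ?case using project_crossing[OF assms(1-4)] by simp
next
  case (Cons n ns)
  let ?p = "\<lambda>xs P. project T (\<lambda>S. state_sum (ns @ xs) (P \<union> boxes S H))"
  have head: "project T (\<lambda>S. state_sum ((n # ns) @ xs) (P \<union> boxes S H)) =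
      (\<Sum>(w, X)\<leftarrow>node_states n. w * ?p xs (P \<union> X))" for xs
    unfolding append_Cons state_sum.simps split_def project_sum_list project_mult
    by (simp add: Un_ac)
  have IH: "?p [Crossing a b c e] (P \<union> X) = A ^ 4 * ?p [Point b c, Point e a] (P \<union> X)
      + inverse (A ^ 4) * ?p [Point a b, Point c e] (P \<union> X) - d * ?p [Vertex [a, b, c, e]] (P \<union> X)"
    if "(w, X) \<in> set (node_states n)" for w X
    using Cons.prems node_states_avoids[OF that, of "{a, b, c, e}"] node_states_finite[OF that]
    by (intro Cons.IH) auto
  have "(\<Sum>(w, X)\<leftarrow>node_states n. w * ?p [Crossing a b c e] (P \<union> X)) =
     (\<Sum>(w, X)\<leftarrow>node_states n. A ^ 4 * (w * ?p [Point b c, Point e a] (P \<union> X))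
      + inverse (A ^ 4) * (w * ?p [Point a b, Point c e] (P \<union> X))
      - d * (w * ?p [Vertex [a, b, c, e]] (P \<union> X)))"
    by (intro arg_cong[of _ _ sum_list] map_cong refl, clarify, subst IH, assumption)
      (simp only: right_diff_distrib distrib_left mult.left_commute)
  then show ?case
    unfolding head by (simp add: split_def sum_list_addf sum_list_subtractf sum_list_const_mult)
qed

lemma project_crossing_diagram:
  assumes "distinct (concat (map node_half_edges (ns1 @ Crossing a b c e # ns2)))"
    and "{a, b, c, e} \<subseteq> T" "T \<subseteq> H" "finite H"
  shows "project T (\<lambda>S. state_sum (ns1 @ Crossing a b c e # ns2) (boxes S H)) =
      A ^ 4 * project T (\<lambda>S. state_sum (ns1 @ smoothA (Crossing a b c e) @ ns2) (boxes S H))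
    + inverse (A ^ 4) * project T (\<lambda>S. state_sum (ns1 @ smoothB (Crossing a b c e) @ ns2) (boxes S H))
    - d * project T (\<lambda>S. state_sum (ns1 @ Vertex [a, b, c, e] # ns2) (boxes S H))"
proof -
  have *: "state_sum (ns1 @ n # ns2) P = state_sum ((ns2 @ ns1) @ [n]) P" for n P
    using state_sum_to_end[of ns1 "[n]" ns2 P] by simp
  have dist: "distinct [a, b, c, e]" "all_half_edges (ns2 @ ns1) \<inter> {a, b, c, e} = {}"
    using assms(1) by auto
  show ?thesis
    using project_crossing_context[OF dist(1) assms(2-4) _ _ dist(2), of "{}"]
    unfolding * state_sum_to_end smoothA.simps smoothB.simps by (simp add: avoids_def)
qed

end

section \<open>Strands and their ends\<close>

lemma even_card_involution:
  assumes "finite E" "\<And>h. h \<in> E \<Longrightarrow> f h \<in> E \<and> f h \<noteq> h \<and> f (f h) = h"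
  shows "even (card E)"
  using assms
proof (induction "card E" arbitrary: E rule: less_induct)
  case less
  show ?case
  proof (cases "E = {}")
    case False
    then obtain h where h: "h \<in> E" by blast
    let ?E = "E - {h, f h}"
    have "card {h, f h} = 2" "{h, f h} \<subseteq> E" using less.prems(2)[OF h] h by auto
    then have c: "card E = card ?E + 2"
      using less.prems(1) by (metis add.commute card_Diff_subset card_mono finite.emptyI finite_insert le_add_diff_inverse2)
    have "even (card ?E)"
    proof (rule less.hyps)
      show "f k \<in> ?E \<and> f k \<noteq> k \<and> f (f k) = k" if "k \<in> ?E" for k
        using less.prems(2)[of k] less.prems(2)[OF h] that by auto
    qed (use c less.prems in auto)
    then show ?thesis using c by simp
  qed simp
qed

text \<open>
  The unique state of a node that is not a crossing.
\<close>

fun node_arcs :: "'h node \<Rightarrow> 'h cable set set" where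
  "node_arcs (Vertex hs) = (\<lambda>(h, h'). disk_arc h h') ` set (consecutive hs)"
| "node_arcs (Crossing a b c e) = {}"
| "node_arcs (Virtual a b c e) = parallel a c \<union> parallel b e"
| "node_arcs (Point p q) = parallel p q"

definition flat_arcs :: "'h node list \<Rightarrow> 'h cable set set" where
  "flat_arcs ns = (\<Union>n\<in>set ns. node_arcs n)"

lemma flat_arcs_simps [simp]:
  "flat_arcs [] = {}" "flat_arcs (n # ns) = node_arcs n \<union> flat_arcs ns"
  "flat_arcs (xs @ ys) = flat_arcs xs \<union> flat_arcs ys"
  by (auto simp: flat_arcs_def)

lemma Union_node_arcs: "x \<in> \<Union>(node_arcs n) \<Longrightarrow> \<exists>h\<in>set (node_half_edges n). \<exists>s. x = Strand h s Tip"
  by (cases n) (auto simp: parallel_def disk_arc_def, (blast dest: consecutive_mem)+)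

lemma avoids_node_arcs:
  assumes "H \<inter> set (node_half_edges n) = {} \<or> Tip \<notin> K"
  shows "avoids (node_arcs n) H K"
  unfolding avoids_def
proof (intro ballI allI notI)
  fix h s l assume "h \<in> H" "l \<in> K" "Strand h s l \<in> \<Union>(node_arcs n)"
  moreover from Union_node_arcs[OF this(3)] have "h \<in> set (node_half_edges n)" "l = Tip" by auto
  ultimately show False using assms by blast
qed

lemma avoids_flat_arcs:
  assumes "H \<inter> all_half_edges ns = {} \<or> Tip \<notin> K"
  shows "avoids (flat_arcs ns) H K"
proof -
  have "avoids (node_arcs n) H K" if "n \<in> set ns" for n
    by (rule avoids_node_arcs) (use assms that in auto)
  then show ?thesis by (simp add: avoids_def flat_arcs_def)
qed

lemma finite_node_arcs: "finite (\<Union>(node_arcs n))"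
  by (cases n) (auto simp: parallel_def disk_arc_def)

lemma finite_flat_arcs: "finite (\<Union>(flat_arcs ns))"
  by (induction ns) (simp_all add: finite_node_arcs)

lemma (in skein) state_sum_no_crossing:
  assumes "\<forall>n\<in>set ns. \<not> is_crossing n"
  shows "state_sum ns P = d ^ (curves (P \<union> flat_arcs ns) + count_list ns (Vertex []))"
  using assms
proof (induction ns arbitrary: P)
  case (Cons n ns)
  then show ?case
    by (cases n) (auto simp: Un_assoc consecutive_def)
qed simp

fun node_opposite :: "'h node \<Rightarrow> 'h \<Rightarrow> 'h" where
  "node_opposite (Vertex hs) h = h"
| "node_opposite (Crossing a b c e) h =
    (if h = a then c else if h = b then e else if h = c then a else if h = e then b else h)"
| "node_opposite (Virtual a b c e) h =
    (if h = a then c else if h = b then e else if h = c then a else if h = e then b else h)"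
| "node_opposite (Point p q) h = (if h = p then q else if h = q then p else h)"

text \<open>
  The half-edge opposite to a given one on its strand. At the end of an edge there is none, and
  \<open>partner\<close> returns the half-edge itself.
\<close>

fun partner :: "'h node list \<Rightarrow> 'h \<Rightarrow> 'h" where
  "partner [] h = h"
| "partner (n # ns) h =
    (if h \<in> set (node_half_edges n) then node_opposite n h else partner ns h)"

definition vertex_ends :: "'h node list \<Rightarrow> 'h set" where
  "vertex_ends ns = (\<Union>n\<in>{n \<in> set ns. is_vertex n}. set (node_half_edges n))"

lemma vertex_ends_simps [simp]:
  "vertex_ends [] = {}"
  "vertex_ends (n # ns) = (if is_vertex n then set (node_half_edges n) else {}) \<union> vertex_ends ns"
  "vertex_ends (xs @ ys) = vertex_ends xs \<union> vertex_ends ys"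
  by (auto simp: vertex_ends_def)

lemma vertex_ends_subset: "vertex_ends ns \<subseteq> all_half_edges ns"
  by (auto simp: vertex_ends_def)

lemma node_opposite:
  assumes "distinct (node_half_edges n)" "h \<in> set (node_half_edges n)"
  shows "node_opposite n h \<in> set (node_half_edges n)"
    and "node_opposite n (node_opposite n h) = h"
    and "node_opposite n h = h \<longleftrightarrow> is_vertex n"
    and "node_opposite n h \<noteq> h \<Longrightarrow>
      (h, node_opposite n h) \<in> opposite n \<or> (node_opposite n h, h) \<in> opposite n"
    and "(h, k) \<in> opposite n \<Longrightarrow> node_opposite n h = k"
  using assms by (cases n; auto)+

lemma opposite_mem:
  "(h, k) \<in> opposite n \<Longrightarrow> h \<in> set (node_half_edges n) \<and> k \<in> set (node_half_edges n)"
  by (cases n) auto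

lemma partner:
  assumes "distinct (concat (map node_half_edges ns))" "h \<in> all_half_edges ns"
  shows partner_mem: "partner ns h \<in> all_half_edges ns"
    and partner_partner: "partner ns (partner ns h) = h"
    and partner_fixed: "partner ns h = h \<longleftrightarrow> h \<in> vertex_ends ns"
    and partner_opposite: "partner ns h \<noteq> h \<Longrightarrow>
      \<exists>n\<in>set ns. (h, partner ns h) \<in> opposite n \<or> (partner ns h, h) \<in> opposite n"
  using assms
proof (atomize (full), induction ns)
  case (Cons n ns)
  show ?case
  proof (cases "h \<in> set (node_half_edges n)")
    case True
    then have "h \<notin> vertex_ends ns" "distinct (node_half_edges n)"
      using Cons.prems vertex_ends_subset[of ns] by auto
    then show ?thesis using True node_opposite[of n h] by auto
  next
    case False
    then have "h \<in> all_half_edges ns" using Cons.prems by simp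
    moreover from this Cons have "partner ns h \<in> all_half_edges ns" by simp
    then have "partner ns h \<notin> set (node_half_edges n)" using Cons.prems by auto
    ultimately show ?thesis using Cons False by auto
  qed
qed simp

lemma partner_eqI:
  assumes "distinct (concat (map node_half_edges ns))" "n \<in> set ns" "(h, k) \<in> opposite n"
  shows "partner ns h = k" "partner ns k = h"
proof -
  have "partner ns h = k"
    using assms
  proof (induction ns)
    case (Cons n' ns)
    have *: "h \<in> set (node_half_edges n)" using opposite_mem[OF Cons.prems(3)] by simp
    show ?case
    proof (cases "n = n'")
      case True
      then show ?thesis using * Cons.prems node_opposite(5)[of n h k] by simp
    next
      case False
      then have "n \<in> set ns" using Cons.prems by simp
      moreover from this have "h \<notin> set (node_half_edges n')" using * Cons.prems(1) by auto
      ultimately show ?thesis using Cons by simp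
    qed
  qed simp
  moreover have "h \<in> all_half_edges ns" using opposite_mem[OF assms(3)] assms(2) by auto
  ultimately show "partner ns h = k" "partner ns k = h"
    using partner_partner[OF assms(1)] by auto
qed

text \<open>
  The unions of strands, described by closure conditions. In this form they can be compared between
  diagrams with different nodes.
\<close>

definition strand_closed :: "'h diagram \<Rightarrow> 'h set \<Rightarrow> bool" where
  "strand_closed D C \<longleftrightarrow> C \<subseteq> half_edges D \<and>
     (\<forall>h\<in>C. mate D h \<in> C) \<and> (\<forall>n\<in>set (nodes D). \<forall>(a, b)\<in>opposite n. a \<in> C \<longleftrightarrow> b \<in> C)"

lemma strand_closed_iff_partner:
  assumes "is_diagram D"
  shows "strand_closed D C \<longleftrightarrow> C \<subseteq> half_edges D \<and>
     (\<forall>h\<in>C. mate D h \<in> C) \<and> (\<forall>h\<in>C. partner (nodes D) h \<in> C)"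
proof -
  have dist: "distinct (concat (map node_half_edges (nodes D)))"
    using assms by (simp add: is_diagram_def)
  have "(\<forall>n\<in>set (nodes D). \<forall>(a, b)\<in>opposite n. a \<in> C \<longleftrightarrow> b \<in> C) \<longleftrightarrow>
     (\<forall>h\<in>C. partner (nodes D) h \<in> C)" if C: "C \<subseteq> half_edges D"
  proof (intro iffI ballI)
    fix h assume *: "\<forall>n\<in>set (nodes D). \<forall>(a, b)\<in>opposite n. a \<in> C \<longleftrightarrow> b \<in> C" "h \<in> C"
    then have "h \<in> all_half_edges (nodes D)" using C by (auto simp: half_edges_def)
    from partner_opposite[OF dist this] show "partner (nodes D) h \<in> C" using * by fastforce
  next
    fix n p assume *: "\<forall>h\<in>C. partner (nodes D) h \<in> C" "n \<in> set (nodes D)" "p \<in> opposite n"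
    then show "case p of (a, b) \<Rightarrow> a \<in> C \<longleftrightarrow> b \<in> C"
    proof (cases p)
      case (Pair a b)
      then show ?thesis using * partner_eqI[OF dist *(2), of a b] by fastforce
    qed
  qed
  then show ?thesis unfolding strand_closed_def by blast
qed

lemma finite_half_edges [simp]: "finite (half_edges D)"
  by (simp add: half_edges_def)

text \<open>
  The single strands.
\<close>

definition minimal_closed :: "'h diagram \<Rightarrow> 'h set \<Rightarrow> bool" where
  "minimal_closed D e \<longleftrightarrow> strand_closed D e \<and> e \<noteq> {} \<and>
     (\<forall>C. strand_closed D C \<longrightarrow> C \<subseteq> e \<longrightarrow> C \<noteq> {} \<longrightarrow> C = e)"

text \<open>
  A union of strands has an even number of half-edges, as \<open>mate\<close> pairs them, and an even number of
  half-edges at nodes that are not vertices, as \<open>partner\<close> pairs those.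
\<close>

lemma even_ends:
  assumes D: "is_diagram D" and C: "strand_closed D C"
  shows "even (card (C \<inter> vertex_half_edges D))"
proof -
  note C' = C[unfolded strand_closed_iff_partner[OF D]]
  have dist: "distinct (concat (map node_half_edges (nodes D)))"
    using D by (simp add: is_diagram_def)
  have V: "vertex_half_edges D = vertex_ends (nodes D)"
    by (simp add: vertex_half_edges_def vertex_ends_def)
  have fin: "finite C" using C' finite_subset[OF _ finite_half_edges] by blast
  have CH: "h \<in> all_half_edges (nodes D)" "h \<in> half_edges D" if "h \<in> C" for h
    using that C' by (auto simp: half_edges_def)
  have "even (card C)"
    by (rule even_card_involution[of _ "mate D"]) (use fin C' D CH in \<open>auto simp: is_diagram_def\<close>)
  moreover have "even (card (C - vertex_half_edges D))"
  proof (rule even_card_involution[of _ "partner (nodes D)"])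
    fix h assume h: "h \<in> C - vertex_half_edges D"
    then have 1: "partner (nodes D) h \<in> C" "partner (nodes D) (partner (nodes D) h) = h"
      "partner (nodes D) h \<noteq> h"
      using C' partner[OF dist CH(1)[of h]] V by auto
    then have "partner (nodes D) h \<notin> vertex_half_edges D"
      using partner_fixed[OF dist CH(1)[OF 1(1)]] V by auto
    with 1 show "partner (nodes D) h \<in> C - vertex_half_edges D \<and> partner (nodes D) h \<noteq> h \<and>
       partner (nodes D) (partner (nodes D) h) = h" by blast
  qed (use fin in auto)
  moreover have "card C = card (C \<inter> vertex_half_edges D) + card (C - vertex_half_edges D)"
    using fin by (metis card_Int_Diff)
  ultimately show ?thesis by simp
qed

text \<open>
  Follow the edge from the end \<open>v\<close>. The initial pieces, which are closed under \<open>mate\<close>, have at most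
  two half-edges from which one cannot continue inside the piece, namely \<open>v\<close> and the current last one.
  A maximal piece with this property is the whole edge, so there are at most two ends.
\<close>

lemma edge_two_ends:
  assumes D: "is_diagram D" and e: "minimal_closed D e" and v: "v \<in> e \<inter> vertex_half_edges D"
  shows "card (e \<inter> vertex_half_edges D) = 2"
proof -
  let ?o = "partner (nodes D)" and ?m = "mate D"
  have dist: "distinct (concat (map node_half_edges (nodes D)))"
    using D by (simp add: is_diagram_def)
  have V: "vertex_half_edges D = vertex_ends (nodes D)"
    by (simp add: vertex_half_edges_def vertex_ends_def)
  have ec: "strand_closed D e" using e by (simp add: minimal_closed_def)
  note ec' = ec[unfolded strand_closed_iff_partner[OF D]]
  have fin: "finite e" using ec' finite_subset[OF _ finite_half_edges] by blast
  have eH: "h \<in> all_half_edges (nodes D)" "h \<in> half_edges D" if "h \<in> e" for h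
    using that ec' by (auto simp: half_edges_def)
  have mm: "?m (?m h) = h" "?m h \<in> e" if "h \<in> e" for h
    using eH[OF that] D ec' that by (auto simp: is_diagram_def)
  \<comment> \<open>The half-edges where a piece \<open>C\<close> stops: at a vertex, or because the strand leaves \<open>C\<close>.\<close>
  let ?open = "\<lambda>C. {u \<in> C. ?o u = u \<or> ?o u \<notin> C}"
  let ?G = "{C. C \<subseteq> e \<and> v \<in> C \<and> (\<forall>h\<in>C. ?m h \<in> C) \<and> card (?open C) \<le> 2}"
  have "finite ?G" by (rule finite_subset[of _ "Pow e"]) (use fin in auto)
  moreover have "{v, ?m v} \<in> ?G"
  proof -
    have "card (?open {v, ?m v}) \<le> card {v, ?m v}" by (rule card_mono) auto
    also have "\<dots> \<le> 2" by (simp add: card_insert_if)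
    finally show ?thesis using v mm by auto
  qed
  ultimately obtain C where C: "C \<in> ?G" and max: "\<forall>C'\<in>?G. C \<subseteq> C' \<longrightarrow> C = C'"
    by (meson finite_has_maximal2)
  have "?o u \<in> C" if u: "u \<in> C" for u
  proof (rule ccontr)
    assume w: "?o u \<notin> C"
    define w where "w = ?o u"
    have ue: "u \<in> e" using u C by auto
    have we: "w \<in> e" and ow: "?o w = u" and wu: "w \<noteq> u"
    proof -
      show "w \<in> e" using ec' ue unfolding w_def by blast
      show "?o w = u" unfolding w_def by (rule partner_partner[OF dist eH(1)[OF ue]])
      show "w \<noteq> u" using u w unfolding w_def by metis
    qed
    \<comment> \<open>Continue across the node at \<open>u\<close> and along the next segment: \<open>u\<close> no longer stops the piece,
      and only the far end of the segment can be a new stop.\<close>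
    let ?C = "C \<union> {w, ?m w}"
    have "?open ?C \<subseteq> (?open C - {u}) \<union> {?m w}"
    proof
      fix x assume x: "x \<in> ?open ?C"
      then have "x \<noteq> u" "x \<noteq> w" using ow wu u unfolding w_def by auto
      with x show "x \<in> (?open C - {u}) \<union> {?m w}" by auto
    qed
    then have "card (?open ?C) \<le> card ((?open C - {u}) \<union> {?m w})"
      by (rule card_mono[rotated]) (use C finite_subset[OF _ fin] in simp)
    also have "\<dots> \<le> card (?open C - {u}) + card {?m w}" by (rule card_Un_le)
    also have "card (?open C - {u}) = card (?open C) - 1"
      by (rule card_Diff_singleton) (use u w in simp)
    also have "card (?open C) - 1 + card {?m w} \<le> 2" using C by auto
    finally have "?C \<in> ?G" using C we mm by auto
    with max have "C \<subseteq> ?C \<longrightarrow> C = ?C" by (rule bspec)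
    then have "w \<in> C" by blast
    with w show False by (simp add: w_def)
  qed
  then have "strand_closed D C"
    using C ec' by (auto simp: strand_closed_iff_partner[OF D])
  with C e have "C = e" by (auto simp: minimal_closed_def)
  moreover have "?open e = e \<inter> vertex_half_edges D"
    using partner_fixed[OF dist eH(1)] ec' V by auto
  ultimately have "card (e \<inter> vertex_half_edges D) \<le> 2" using C by auto
  moreover have "card (e \<inter> vertex_half_edges D) > 0" using v fin by (auto simp: card_gt_0_iff)
  ultimately show ?thesis using even_ends[OF D ec] by presburger
qed

section \<open>Cutting a band\<close>

lemma boxes_pair:
  assumes "h \<in> H" "k \<in> H" "h \<noteq> k" "h \<in> S" "k \<notin> S"
  shows "boxes S H = boxes S (H - {h, k}) \<union> cut h \<union> through k"
    and "boxes (insert k S) H = boxes S (H - {h, k}) \<union> cut h \<union> cut k"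
proof -
  have 1: "boxes (insert k S) (H - {h, k}) = boxes S (H - {h, k})"
    by (rule boxes_cong) auto
  have "(H - {h, k}) \<union> {h, k} = H" using assms by auto
  then have 2: "boxes S' H = boxes S' (H - {h, k}) \<union> boxes S' {h, k}" for S'
    by (metis boxes_Un)
  have 3: "boxes S {h, k} = cut h \<union> through k" "boxes (insert k S) {h, k} = cut h \<union> cut k"
    using assms(3-5) by (simp_all add: boxes_def Un_commute)
  show "boxes S H = boxes S (H - {h, k}) \<union> cut h \<union> through k"
    unfolding 2[of S] 3 by (simp only: Un_assoc)
  show "boxes (insert k S) H = boxes S (H - {h, k}) \<union> cut h \<union> cut k"
    unfolding 2[of "insert k S"] 3 1 by (simp only: Un_assoc)
qed

lemma boxes_cut_all:
  assumes "e \<subseteq> H" "S \<inter> e = {}"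
  shows "boxes (S \<union> e) H = boxes S (H - e) \<union> cap Near ` e \<union> cap Far ` e"
proof -
  have "boxes (S \<union> e) H = boxes (S \<union> e) (H - e) \<union> boxes (S \<union> e) e"
    using assms(1) boxes_Un[of "S \<union> e" "H - e" e] by (simp add: Un_absorb2)
  moreover have "boxes (S \<union> e) (H - e) = boxes S (H - e)" by (rule boxes_cong) auto
  moreover have "boxes (S \<union> e) e = cap Near ` e \<union> cap Far ` e"
    by (auto simp: boxes_def cut_def)
  ultimately show ?thesis by (simp add: Un_assoc)
qed

context involution begin

lemma avoids_caps: "l \<notin> K \<or> E \<inter> H = {} \<Longrightarrow> avoids (cap l ` E) H K"
  by (auto simp: avoids_def cap_def)

lemma finite_caps: "finite E \<Longrightarrow> finite (\<Union>(cap l ` E))"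
  by (auto simp: cap_def)

lemma add_cut_mate:
  assumes "h \<in> H" "m h \<in> H" "m h \<noteq> h" "h \<in> S" "m h \<notin> S" "finite H"
    and "avoids F {h, m h} {Far}" "finite (\<Union>F)"
  shows "curves (F \<union> boxes (insert (m h) S) H) = Suc (curves (F \<union> boxes S H))"
proof -
  let ?k = "m h" and ?B = "F \<union> boxes S (H - {h, m h})"
  let ?P = "?B \<union> {cap Near h, cap Near ?k}"
  have B: "avoids ?B {h, ?k} {Far}" "finite (\<Union>?B)"
    using assms avoids_boxes[of "H - {h, m h}" "{h, m h}"] finite_boxes[of "H - {h, m h}" S] by auto
  have P: "avoids ?P {h, ?k} {Far}" "finite (\<Union>?P)"
    using B by (auto simp: avoids_def cap_def)
  note b = boxes_pair[OF assms(1,2) assms(3)[symmetric] assms(4,5)]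
  have "curves (F \<union> boxes (insert ?k S) H) = curves (?P \<union> {cap Far h, cap Far ?k})"
    unfolding b by (rule arg_cong[of _ _ curves]) (auto simp: cut_def)
  also have "\<dots> = Suc (curves ?P)" using mate_caps[OF P(1) assms(3) P(2)] .
  also have "curves ?P = curves (F \<union> boxes S H)"
    unfolding b using mate_cut_through[OF B(1) assms(3)] by (simp add: Un_assoc)
  finally show ?thesis .
qed

lemma add_cut_parallel:
  assumes "h \<in> H" "k \<in> H" "k \<noteq> h" "h \<in> S" "k \<notin> S" "finite H"
    and "avoids F {h, k} {Near, Tip}" "finite (\<Union>F)"
  shows "curves (F \<union> parallel h k \<union> boxes (insert k S) H) = Suc (curves (F \<union> parallel h k \<union> boxes S H))"
proof -
  let ?B = "F \<union> boxes S (H - {h, k})"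
  let ?P = "?B \<union> {cap Far h, cap Far k}"
  have B: "avoids ?B {h, k} {Near, Tip}" "finite (\<Union>?B)"
    using assms avoids_boxes[of "H - {h, k}" "{h, k}"] finite_boxes[of "H - {h, k}" S] by auto
  have P: "avoids ?P {h, k} {Near, Tip}" "finite (\<Union>?P)"
    using B by (auto simp: avoids_def cap_def)
  note b = boxes_pair[OF assms(1,2) assms(3)[symmetric] assms(4,5)]
  have "curves (F \<union> parallel h k \<union> boxes (insert k S) H) = curves (?P \<union> parallel h k \<union> {cap Near h, cap Near k})"
    unfolding b by (rule arg_cong[of _ _ curves]) (auto simp: cut_def)
  also have "\<dots> = Suc (curves ?P)" using parallel_caps[OF P(1) assms(3) P(2)] .
  also have "curves ?P = curves (F \<union> parallel h k \<union> boxes S H)"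
    unfolding b using parallel_cut_through[OF B(1) assms(3)] by (simp add: Un_ac)
  finally show ?thesis .
qed

text \<open>
  If all half-edges of some segments are cut, each segment contributes one circle.
\<close>

lemma far_caps:
  assumes "finite E" "\<And>h. h \<in> E \<Longrightarrow> m h \<in> E \<and> m h \<noteq> h" "avoids P E {Far}" "finite (\<Union>P)"
  shows "2 * curves (P \<union> cap Far ` E) = 2 * curves P + card E"
  using assms
proof (induction "card E" arbitrary: E rule: less_induct)
  case less
  show ?case
  proof (cases "E = {}")
    case False
    then obtain h where h: "h \<in> E" by blast
    let ?E = "E - {h, m h}"
    have "card {h, m h} = 2" "{h, m h} \<subseteq> E" using less.prems(2)[OF h] h by auto
    then have c: "card E = card ?E + 2"
      using less.prems(1) by (metis add.commute card_Diff_subset card_mono finite.emptyI finite_insert le_add_diff_inverse2)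
    have IH: "2 * curves (P \<union> cap Far ` ?E) = 2 * curves P + card ?E"
    proof (rule less.hyps)
      show "m k \<in> ?E \<and> m k \<noteq> k" if "k \<in> ?E" for k
        using less.prems(2)[of k] that m_m by (metis Diff_iff insert_iff empty_iff)
      show "avoids P ?E {Far}" using less.prems(3) by (rule avoids_mono) auto
    qed (use c less.prems in auto)
    have "curves ((P \<union> cap Far ` ?E) \<union> {cap Far h, cap Far (m h)}) = Suc (curves (P \<union> cap Far ` ?E))"
    proof (rule mate_caps)
      have "avoids P {h, m h} {Far}"
        using less.prems(3) \<open>{h, m h} \<subseteq> E\<close> by (rule avoids_mono) auto
      then show "avoids (P \<union> cap Far ` ?E) {h, m h} {Far}" using avoids_caps[of Far "{Far}" ?E "{h, m h}"] by auto
      show "finite (\<Union>(P \<union> cap Far ` ?E))" using less.prems(1,4) finite_caps[of ?E Far] by simp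
    qed (use less.prems(2)[OF h] in simp)
    also have "(P \<union> cap Far ` ?E) \<union> {cap Far h, cap Far (m h)} = P \<union> cap Far ` E"
      using \<open>{h, m h} \<subseteq> E\<close> by auto
    finally show ?thesis using IH c by simp
  qed simp
qed

end

lemma zip_rotate1:
  "length xs = length ys \<Longrightarrow> zip (rotate1 xs) (rotate1 ys) = rotate1 (zip xs ys)"
  by (cases xs; cases ys) auto

lemma set_consecutive_rotate: "set (consecutive (xs @ ys)) = set (consecutive (ys @ xs))"
proof -
  have "set (consecutive (rotate1 zs)) = set (consecutive zs)" for zs :: "'a list"
    by (simp add: consecutive_def zip_rotate1)
  then have "set (consecutive (rotate n zs)) = set (consecutive zs)" for n and zs :: "'a list"
    by (induction n) simp_all
  then show ?thesis by (metis rotate_append)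
qed

text \<open>
  Inserting \<open>h\<close> into a cyclic list replaces the pair formed by the last and the first element.
\<close>

lemma consecutive_Cons:
  assumes "zs \<noteq> []"
  obtains X where "set (consecutive (h # zs)) = {(h, hd zs), (last zs, h)} \<union> X"
    "set (consecutive zs) = insert (last zs, hd zs) X"
    "X \<subseteq> set zs \<times> set zs"
proof
  let ?X = "set (zip (butlast zs) (tl zs))"
  have "zs = butlast zs @ [last zs]" "zs = hd zs # tl zs" using assms by auto
  then have z: "zip zs (tl zs @ [k]) = zip (butlast zs) (tl zs) @ [(last zs, k)]" for k
    by (metis length_butlast length_tl zip_Cons_Cons zip_Nil zip_append)
  show "set (consecutive (h # zs)) = {(h, hd zs), (last zs, h)} \<union> ?X"
    using z[of h] \<open>zs = hd zs # tl zs\<close> unfolding consecutive_def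
    by (metis (no_types, lifting) append_Cons insert_is_Un list.simps(15) rotate1.simps(2) set_append
        sup_assoc sup_commute zip_Cons_Cons empty_set)
  show "set (consecutive zs) = insert (last zs, hd zs) ?X"
    using z[of "hd zs"] \<open>zs = hd zs # tl zs\<close> unfolding consecutive_def
    by (metis (no_types, lifting) insert_is_Un list.simps(15) rotate1.simps(2) set_append sup_commute empty_set)
  show "?X \<subseteq> set zs \<times> set zs"
    by (auto dest: set_zip_leftD set_zip_rightD in_set_butlastD list.set_sel(2)[OF assms])
qed

abbreviation disk_arcs :: "'h list \<Rightarrow> 'h cable set set" where
  "disk_arcs hs \<equiv> (\<lambda>(h, h'). disk_arc h h') ` set (consecutive hs)"

definition through_ends :: "'h node list \<Rightarrow> 'h set" where
  "through_ends ns = (\<Union>n\<in>{n \<in> set ns. \<not> is_vertex n}. set (node_half_edges n))"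

lemma through_ends_eq:
  assumes "distinct (concat (map node_half_edges ns))"
  shows "through_ends ns = all_half_edges ns - vertex_ends ns"
  using assms
proof (induction ns)
  case (Cons n ns)
  have "through_ends (n # ns) = (if is_vertex n then {} else set (node_half_edges n)) \<union> through_ends ns"
    by (auto simp: through_ends_def)
  then show ?case using Cons vertex_ends_subset[of ns] by auto
qed (simp add: through_ends_def)

lemma delete_node_half_edges: "all_half_edges (delete_node e n) \<subseteq> set (node_half_edges n)"
  by (cases n) auto

context involution begin

text \<open>
  Cutting all half-edges in \<open>e\<close> at a vertex deletes them. If none is left, one curve around the vertex
  remains, which is accounted for by the new isolated vertex.
\<close>

lemma vertex_delete:
  assumes "distinct hs" "avoids P (e \<inter> set hs) {Near, Tip}" "finite (\<Union>P)"
  shows "curves (P \<union> disk_arcs hs \<union> cap Near ` (e \<inter> set hs)) + (if hs = [] then 1 else 0) =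
    curves (P \<union> disk_arcs (filter (\<lambda>h. h \<notin> e) hs)) + (if filter (\<lambda>h. h \<notin> e) hs = [] then 1 else 0)"
  using assms(1,2)
proof (induction "length hs" arbitrary: hs rule: less_induct)
  case less
  show ?case
  proof (cases "e \<inter> set hs = {}")
    case True
    then have "filter (\<lambda>h. h \<notin> e) hs = hs" by (auto simp: filter_id_conv)
    then show ?thesis using True by simp
  next
    case False
    then obtain h xs ys where h: "h \<in> e" and hs: "hs = xs @ h # ys"
      by (metis Int_emptyI split_list)
    define zs where "zs = ys @ xs"
    have cons: "disk_arcs hs = disk_arcs (h # zs)"
      using set_consecutive_rotate[of xs "h # ys"] by (simp add: hs zs_def)
    have filt: "disk_arcs (filter (\<lambda>h. h \<notin> e) hs) = disk_arcs (filter (\<lambda>h. h \<notin> e) zs)"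
      "filter (\<lambda>h. h \<notin> e) hs = [] \<longleftrightarrow> filter (\<lambda>h. h \<notin> e) zs = []"
      using set_consecutive_rotate[of "filter (\<lambda>h. h \<notin> e) xs" "filter (\<lambda>h. h \<notin> e) ys"] h
      by (auto simp: hs zs_def)
    have z: "set hs = insert h (set zs)" "h \<notin> set zs" "distinct zs" "length zs < length hs"
      using less.prems(1) by (auto simp: hs zs_def)
    have caps: "cap Near ` (e \<inter> set hs) = insert (cap Near h) (cap Near ` (e \<inter> set zs))"
      using z h by auto
    have av: "avoids P {h} {Near, Tip}"
      using less.prems(2) by (rule avoids_mono) (use z h in auto)
    show ?thesis
    proof (cases "zs = []")
      case True
      have "curves (P \<union> {disk_arc h h, cap Near h}) = Suc (curves P)"
        using vertex_cap_single[OF av assms(3)] .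
      moreover have "hs = [h]" "e \<inter> {h} = {h}" using True h by (auto simp: hs zs_def)
      ultimately show ?thesis
        using h by (simp add: consecutive_def insert_commute)
    next
      case False
      obtain X where X: "set (consecutive (h # zs)) = {(h, hd zs), (last zs, h)} \<union> X"
        "set (consecutive zs) = insert (last zs, hd zs) X" "X \<subseteq> set zs \<times> set zs"
        by (rule consecutive_Cons[OF False])
      let ?Q = "P \<union> (\<lambda>(h, h'). disk_arc h h') ` X \<union> cap Near ` (e \<inter> set zs)"
      have "curves (?Q \<union> {disk_arc (last zs) h, disk_arc h (hd zs), cap Near h}) =
          curves (insert (disk_arc (last zs) (hd zs)) ?Q)"
      proof (rule vertex_cap)
        have "avoids ((\<lambda>(h, h'). disk_arc h h') ` X) {h} {Near, Tip}"
          using X(3) z(2) by (auto simp: avoids_def disk_arc_def)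
        then show "avoids ?Q {h} {Near, Tip}"
          using av avoids_caps[of Near _ "e \<inter> set zs" "{h}"] z(2) by auto
        show "h \<notin> {last zs, hd zs}" using False z(2) by auto
      qed
      also have "?Q \<union> {disk_arc (last zs) h, disk_arc h (hd zs), cap Near h} =
          P \<union> disk_arcs hs \<union> cap Near ` (e \<inter> set hs)"
        unfolding cons caps X(1) by auto
      also have "insert (disk_arc (last zs) (hd zs)) ?Q = P \<union> disk_arcs zs \<union> cap Near ` (e \<inter> set zs)"
        unfolding X(2) by auto
      finally have *: "curves (P \<union> disk_arcs hs \<union> cap Near ` (e \<inter> set hs)) =
          curves (P \<union> disk_arcs zs \<union> cap Near ` (e \<inter> set zs))" .
      have "avoids P (e \<inter> set zs) {Near, Tip}"
        using less.prems(2) by (rule avoids_mono) (use z in auto)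
      from less.hyps[OF z(4,3) this] show ?thesis
        using * False filt by (simp add: hs)
    qed
  qed
qed

text \<open>
  At a node that is not a vertex, each pair of opposite half-edges in \<open>e\<close> contributes a circle. The
  equation is doubled in order to count the half-edges instead of the pairs.
\<close>

lemma delete_node_flat:
  assumes "distinct (node_half_edges n)" "\<not> is_crossing n"
    and e: "\<forall>(a, b)\<in>opposite n. a \<in> e \<longleftrightarrow> b \<in> e"
    and "avoids P (e \<inter> set (node_half_edges n)) {Near, Tip}" "finite (\<Union>P)"
  shows "2 * (curves (P \<union> node_arcs n \<union> cap Near ` (e \<inter> set (node_half_edges n)))
        + count_list [n] (Vertex [])) =
      2 * (curves (P \<union> flat_arcs (delete_node e n)) + count_list (delete_node e n) (Vertex []))
        + (if is_vertex n then 0 else card (e \<inter> set (node_half_edges n)))"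
proof (cases n)
  case (Vertex hs)
  then show ?thesis using vertex_delete[of hs P e] assms by auto
next
  case (Virtual a b c k)
  have ac: "curves (Q \<union> parallel a c \<union> {cap Near a, cap Near c}) = Suc (curves Q)"
    if "a \<in> e" "avoids Q {a, c} {Near, Tip}" "finite (\<Union>Q)" for Q
    using that assms(1) Virtual by (intro parallel_caps) auto
  have bk: "curves (Q \<union> parallel b k \<union> {cap Near b, cap Near k}) = Suc (curves Q)"
    if "b \<in> e" "avoids Q {b, k} {Near, Tip}" "finite (\<Union>Q)" for Q
    using that assms(1) Virtual by (intro parallel_caps) auto
  have e': "c \<in> e \<longleftrightarrow> a \<in> e" "k \<in> e \<longleftrightarrow> b \<in> e" using e Virtual by auto
  have par: "avoids (parallel x y) H K" if "{x, y} \<inter> H = {}" for x y :: 'h and H K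
    using that by (auto simp: avoids_def parallel_def)
  have fin: "finite (\<Union>(parallel x y))" for x y :: 'h by (simp add: parallel_def)
  have dist: "a \<noteq> b" "a \<noteq> c" "a \<noteq> k" "b \<noteq> c" "b \<noteq> k" "c \<noteq> k" using assms(1) Virtual by auto
  show ?thesis
  proof (cases "a \<in> e")
    case a: True
    show ?thesis
    proof (cases "b \<in> e")
      case b: True
      have s: "e \<inter> {a, b, c, k} = {a, b, c, k}" using a b e' by auto
      have "avoids P {a, b, c, k} {Near, Tip}" using assms(4) Virtual s by simp
      then have P: "avoids P {a, c} {Near, Tip}" "avoids P {b, k} {Near, Tip}"
        by (auto elim: avoids_mono)
      let ?Q = "P \<union> parallel b k \<union> {cap Near b, cap Near k}"
      have "curves (?Q \<union> parallel a c \<union> {cap Near a, cap Near c}) = Suc (curves ?Q)"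
      proof (rule ac[OF a])
        have "avoids {cap Near b, cap Near k} {a, c} {Near, Tip}"
          using dist by (auto simp: avoids_def cap_def)
        then show "avoids ?Q {a, c} {Near, Tip}" using P(1) par[of b k "{a, c}"] dist unfolding avoids_Un by simp
        show "finite (\<Union>?Q)" using assms(5) fin by (simp add: cap_def)
      qed
      moreover have "curves ?Q = Suc (curves P)" using bk[OF b P(2) assms(5)] .
      moreover have "?Q \<union> parallel a c \<union> {cap Near a, cap Near c} =
          P \<union> (parallel a c \<union> parallel b k) \<union> cap Near ` {a, b, c, k}" by auto
      ultimately show ?thesis using a b e' s dist by (simp add: Virtual)
    next
      case b: False
      have s: "e \<inter> {a, b, c, k} = {a, c}" using a b e' by auto
      have P: "avoids P {a, c} {Near, Tip}" using assms(4) Virtual s by simp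
      let ?Q = "P \<union> parallel b k"
      have "curves (?Q \<union> parallel a c \<union> {cap Near a, cap Near c}) = Suc (curves ?Q)"
        by (rule ac[OF a]) (use P par[of b k "{a, c}"] dist assms(5) fin in auto)
      moreover have "?Q \<union> parallel a c \<union> {cap Near a, cap Near c} =
          P \<union> (parallel a c \<union> parallel b k) \<union> cap Near ` {a, c}" by auto
      ultimately show ?thesis using a b e' s dist by (simp add: Virtual)
    qed
  next
    case a: False
    show ?thesis
    proof (cases "b \<in> e")
      case b: True
      have s: "e \<inter> {a, b, c, k} = {b, k}" using a b e' by auto
      have P: "avoids P {b, k} {Near, Tip}" using assms(4) Virtual s by simp
      let ?Q = "P \<union> parallel a c"
      have "curves (?Q \<union> parallel b k \<union> {cap Near b, cap Near k}) = Suc (curves ?Q)"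
        by (rule bk[OF b]) (use P par[of a c "{b, k}"] dist assms(5) fin in auto)
      moreover have "?Q \<union> parallel b k \<union> {cap Near b, cap Near k} =
          P \<union> (parallel a c \<union> parallel b k) \<union> cap Near ` {b, k}" by auto
      ultimately show ?thesis using a b e' s dist by (simp add: Virtual)
    next
      case b: False
      have s: "e \<inter> {a, b, c, k} = {}" using a b e' by auto
      show ?thesis using a b s by (simp add: Virtual)
    qed
  qed
next
  case (Point p q)
  have e': "q \<in> e \<longleftrightarrow> p \<in> e" "p \<noteq> q" using e assms(1) Point by auto
  show ?thesis
  proof (cases "p \<in> e")
    case True
    have s: "e \<inter> {p, q} = {p, q}" using True e' by auto
    have "curves (P \<union> parallel p q \<union> {cap Near p, cap Near q}) = Suc (curves P)"
      using assms(4,5) e' s by (intro parallel_caps) (auto simp: Point)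
    then show ?thesis using True s e' by (simp add: Point)
  next
    case False
    then have s: "e \<inter> {p, q} = {}" using e' by auto
    then show ?thesis using False by (simp add: Point)
  qed
qed (use assms in auto)

lemma delete_nodes_flat:
  assumes "distinct (concat (map node_half_edges ns))" "\<forall>n\<in>set ns. \<not> is_crossing n"
    and "\<forall>n\<in>set ns. \<forall>(a, b)\<in>opposite n. a \<in> e \<longleftrightarrow> b \<in> e"
    and "avoids P (e \<inter> all_half_edges ns) {Near, Tip}" "finite (\<Union>P)"
  shows "2 * (curves (P \<union> flat_arcs ns \<union> cap Near ` (e \<inter> all_half_edges ns)) + count_list ns (Vertex [])) =
      2 * (curves (P \<union> flat_arcs (concat (map (delete_node e) ns)))
        + count_list (concat (map (delete_node e) ns)) (Vertex []))
      + card (e \<inter> through_ends ns)"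
  using assms
proof (induction ns arbitrary: P)
  case Nil
  then show ?case by (simp add: through_ends_def)
next
  case (Cons n ns)
  let ?H = "set (node_half_edges n)" and ?Hs = "all_half_edges ns"
  let ?del = "concat (map (delete_node e) ns)"
  have disj: "?H \<inter> ?Hs = {}" and dist: "distinct (node_half_edges n)"
    "distinct (concat (map node_half_edges ns))" using Cons.prems(1) by auto
  have P: "avoids P (e \<inter> ?H) {Near, Tip}" "avoids P (e \<inter> ?Hs) {Near, Tip}"
    using Cons.prems(4) by (auto elim: avoids_mono)
  let ?Q = "P \<union> flat_arcs ns \<union> cap Near ` (e \<inter> ?Hs)"
  have "2 * (curves (?Q \<union> node_arcs n \<union> cap Near ` (e \<inter> ?H)) + count_list [n] (Vertex [])) =
      2 * (curves (?Q \<union> flat_arcs (delete_node e n)) + count_list (delete_node e n) (Vertex []))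
        + (if is_vertex n then 0 else card (e \<inter> ?H))"
  proof (rule delete_node_flat)
    show "avoids ?Q (e \<inter> ?H) {Near, Tip}"
      using P(1) avoids_flat_arcs[of "e \<inter> ?H" ns] avoids_caps[of Near _ "e \<inter> ?Hs" "e \<inter> ?H"] disj
      by auto
    show "finite (\<Union>?Q)"
      using Cons.prems(5) finite_flat_arcs[of ns] finite_caps[of "e \<inter> ?Hs" Near] by simp
  qed (use Cons.prems dist in auto)
  also have "?Q \<union> node_arcs n \<union> cap Near ` (e \<inter> ?H) =
      P \<union> flat_arcs (n # ns) \<union> cap Near ` (e \<inter> all_half_edges (n # ns))" by auto
  also have "?Q \<union> flat_arcs (delete_node e n) =
      (P \<union> flat_arcs (delete_node e n)) \<union> flat_arcs ns \<union> cap Near ` (e \<inter> ?Hs)" by auto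
  finally have 1: "2 * (curves (P \<union> flat_arcs (n # ns) \<union> cap Near ` (e \<inter> all_half_edges (n # ns)))
        + count_list [n] (Vertex [])) =
      2 * (curves ((P \<union> flat_arcs (delete_node e n)) \<union> flat_arcs ns \<union> cap Near ` (e \<inter> ?Hs))
        + count_list (delete_node e n) (Vertex [])) + (if is_vertex n then 0 else card (e \<inter> ?H))" .
  have 2: "2 * (curves ((P \<union> flat_arcs (delete_node e n)) \<union> flat_arcs ns \<union> cap Near ` (e \<inter> ?Hs))
        + count_list ns (Vertex [])) =
      2 * (curves ((P \<union> flat_arcs (delete_node e n)) \<union> flat_arcs ?del) + count_list ?del (Vertex []))
      + card (e \<inter> through_ends ns)"
  proof (rule Cons.IH)
    show "avoids (P \<union> flat_arcs (delete_node e n)) (e \<inter> ?Hs) {Near, Tip}"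
    proof -
      have "e \<inter> ?Hs \<inter> all_half_edges (delete_node e n) = {}"
        using disj delete_node_half_edges[of e n] by blast
      then show ?thesis using P(2) avoids_flat_arcs[of "e \<inter> ?Hs" "delete_node e n"] by simp
    qed
  qed (use Cons.prems dist finite_flat_arcs in auto)
  have 3: "card (e \<inter> through_ends (n # ns)) =
      (if is_vertex n then 0 else card (e \<inter> ?H)) + card (e \<inter> through_ends ns)"
  proof (cases "is_vertex n")
    case nv: False
    have "e \<inter> through_ends (n # ns) = (e \<inter> ?H) \<union> (e \<inter> through_ends ns)"
      using nv unfolding through_ends_def by auto
    moreover have "finite (through_ends ns)" "(e \<inter> ?H) \<inter> (e \<inter> through_ends ns) = {}"
      using disj unfolding through_ends_def by auto
    ultimately show ?thesis using nv by (simp add: card_Un_disjoint)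
  next
    case True
    then have "{k \<in> set (n # ns). \<not> is_vertex k} = {k \<in> set ns. \<not> is_vertex k}" by auto
    with True show ?thesis unfolding through_ends_def by simp
  qed
  have 4: "count_list (n # ns) (Vertex []) = count_list [n] (Vertex []) + count_list ns (Vertex [])"
    "count_list (concat (map (delete_node e) (n # ns))) (Vertex []) =
      count_list (delete_node e n) (Vertex []) + count_list ?del (Vertex [])"
    "curves (P \<union> flat_arcs (concat (map (delete_node e) (n # ns)))) =
      curves ((P \<union> flat_arcs (delete_node e n)) \<union> flat_arcs ?del)"
    by (simp_all add: count_list_append Un_assoc)
  have "2 * (x + (i + k)) = 2 * (z + (j + l)) + (p + q)"
    if "2 * (x + i) = 2 * (y + j) + p" "2 * (y + k) = 2 * (z + l) + q" for x y z i j k l p q :: nat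
    using that by presburger
  from this[OF 1 2] show ?case unfolding 3 4 .
qed

end

section \<open>The edge rule\<close>

context skein begin

text \<open>
  The number of curves when there are no crossings and \<open>S\<close> is the set of half-edges with a cut.
\<close>

definition cut_loops :: "'h diagram \<Rightarrow> 'h set \<Rightarrow> nat" where
  "cut_loops D S = curves (flat_arcs (nodes D) \<union> boxes S (half_edges D)) + isolated_vertices D"

text \<open>
  The right-hand side of the theorem for an arbitrary set \<open>T\<close> of sites.
\<close>

definition cable_sum :: "'h diagram \<Rightarrow> 'h set \<Rightarrow> 'a" where
  "cable_sum D T = project T (\<lambda>S. state_sum (nodes D) (boxes S (half_edges D)))"

lemma cable_sum_no_crossing:
  assumes "\<forall>n\<in>set (nodes D). \<not> is_crossing n"
  shows "cable_sum D T = project T (\<lambda>S. d ^ cut_loops D S)"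
  by (simp add: cable_sum_def cut_loops_def state_sum_no_crossing[OF assms] isolated_vertices_def Un_commute)

text \<open>
  The arcs on a strand passing from \<open>h\<close> to \<open>k\<close>, isolated for the moves near these half-edges.
\<close>

lemma flat_arcs_split:
  fixes ns :: "'h node list"
  assumes "distinct (concat (map node_half_edges ns))" "n \<in> set ns" "\<not> is_crossing n"
    and "(h, k) \<in> opposite n"
  obtains F where "flat_arcs ns = F \<union> parallel h k" "avoids F {h, k} {Near, Tip}" "finite (\<Union>F)"
    "h \<noteq> k"
proof -
  obtain xs ys where ns: "ns = xs @ n # ys" using assms(2) by (meson split_list)
  have disj: "{h, k} \<inter> all_half_edges (xs @ ys) = {}"
    using opposite_mem[OF assms(4)] assms(1) by (auto simp: ns)
  have rest: "avoids (flat_arcs (xs @ ys)) {h, k} {Near, Tip}"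
    by (rule avoids_flat_arcs) (use disj in blast)
  have par: "avoids (parallel x y) {h, k} K" if "{x, y} \<inter> {h, k} = {}" for x y :: 'h and K
    using that by (auto simp: avoids_def parallel_def)
  have fin: "finite (\<Union>(parallel x y))" for x y :: 'h by (simp add: parallel_def)
  have "\<exists>X. node_arcs n = X \<union> parallel h k \<and> avoids X {h, k} {Near, Tip} \<and> finite (\<Union>X) \<and> h \<noteq> k"
  proof (cases n)
    case (Virtual a b c e)
    then have d: "distinct [a, b, c, e]" using assms(1) by (simp add: ns)
    from assms(4) Virtual consider "h = a" "k = c" | "h = b" "k = e" by auto
    then show ?thesis
    proof cases
      case 1
      then show ?thesis using d fin par[of b e] by (intro exI[of _ "parallel b e"]) (auto simp: Virtual)
    next
      case 2
      then show ?thesis using d fin par[of a c] by (intro exI[of _ "parallel a c"]) (auto simp: Virtual)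
    qed
  next
    case (Point p q)
    then show ?thesis using assms(1,4) by (intro exI[of _ "{}"]) (auto simp: ns avoids_def)
  qed (use assms(3,4) in auto)
  then obtain X where X: "node_arcs n = X \<union> parallel h k" "avoids X {h, k} {Near, Tip}"
    "finite (\<Union>X)" "h \<noteq> k" by blast
  show thesis
  proof (rule that[of "X \<union> flat_arcs (xs @ ys)"])
    show "flat_arcs ns = X \<union> flat_arcs (xs @ ys) \<union> parallel h k"
      by (simp add: ns X(1) Un_ac)
    show "finite (\<Union>(X \<union> flat_arcs (xs @ ys)))"
      using X(3) finite_flat_arcs[of "xs @ ys"] unfolding Union_Un_distrib by simp
  qed (use X rest in auto)
qed

lemma cut_loops_add:
  assumes D: "is_diagram D" "\<forall>n\<in>set (nodes D). \<not> is_crossing n"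
    and m: "\<And>h. h \<in> half_edges D \<Longrightarrow> mate D h = m h"
    and "h \<in> half_edges D" "h \<in> S" "k \<notin> S" "k = mate D h \<or> k = partner (nodes D) h"
  shows "cut_loops D (insert k S) = Suc (cut_loops D S)"
proof -
  let ?H = "half_edges D"
  have dist: "distinct (concat (map node_half_edges (nodes D)))"
    using D by (simp add: is_diagram_def)
  have hk: "h \<noteq> k" using assms by auto
  have "curves (flat_arcs (nodes D) \<union> boxes (insert k S) ?H) = Suc (curves (flat_arcs (nodes D) \<union> boxes S ?H))"
    using assms(7)
  proof
    assume "k = mate D h"
    then have k: "k = m h" "m h \<in> ?H" "m h \<noteq> h" using m D assms(4) by (auto simp: is_diagram_def)
    show ?thesis
      unfolding k(1) by (rule add_cut_mate)
        (use k assms finite_flat_arcs avoids_flat_arcs[of _ "nodes D" "{Far}"] in auto)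
  next
    assume k: "k = partner (nodes D) h"
    have hH: "h \<in> all_half_edges (nodes D)" using assms(4) by (simp add: half_edges_def)
    have kH: "k \<in> ?H" using partner_mem[OF dist hH] k by (simp add: half_edges_def)
    have "partner (nodes D) h \<noteq> h" using hk k by simp
    from partner_opposite[OF dist hH this]
    have "\<exists>n\<in>set (nodes D). (h, k) \<in> opposite n \<or> (k, h) \<in> opposite n"
      unfolding k .
    then obtain n where n: "n \<in> set (nodes D)" "(h, k) \<in> opposite n \<or> (k, h) \<in> opposite n" ..
    have nc: "\<not> is_crossing n" using D(2) n(1) by blast
    have "\<exists>F. flat_arcs (nodes D) = F \<union> parallel h k \<and> avoids F {h, k} {Near, Tip} \<and> finite (\<Union>F)"
      using n(2)
    proof
      assume "(h, k) \<in> opposite n"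
      from flat_arcs_split[OF dist n(1) nc this] show ?thesis by metis
    next
      assume "(k, h) \<in> opposite n"
      then obtain F where
        "flat_arcs (nodes D) = F \<union> parallel k h" "avoids F {k, h} {Near, Tip}" "finite (\<Union>F)"
        by (rule flat_arcs_split[OF dist n(1) nc])
      moreover have "parallel k h = parallel h k" "{k, h} = {h, k}"
        by (simp_all add: parallel_def insert_commute)
      ultimately show ?thesis by (intro exI[of _ F]) simp
    qed
    then obtain F where F: "flat_arcs (nodes D) = F \<union> parallel h k" "avoids F {h, k} {Near, Tip}"
      "finite (\<Union>F)" by metis
    show ?thesis unfolding F(1)
      by (rule add_cut_parallel) (use assms kH hk F in auto)
  qed
  then show ?thesis by (simp add: cut_loops_def)
qed

text \<open>
  Unless all half-edges of the edge are cut, some uncut one is next to a cut one, as the edge is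
  connected; cutting it adds a circle.
\<close>

lemma cut_loops_fill:
  assumes D: "is_diagram D" "\<forall>n\<in>set (nodes D). \<not> is_crossing n"
    and m: "\<And>h. h \<in> half_edges D \<Longrightarrow> mate D h = m h"
    and e: "minimal_closed D e" "S0 \<inter> e = {}" and "S1 \<subseteq> e" "S1 \<noteq> {}"
  shows "cut_loops D (S0 \<union> e) = cut_loops D (S0 \<union> S1) + card (e - S1)"
  using assms(6,7)
proof (induction "card (e - S1)" arbitrary: S1 rule: less_induct)
  case less
  have eH: "e \<subseteq> half_edges D" using e(1) by (simp add: minimal_closed_def strand_closed_def)
  have fin: "finite e" using eH finite_subset[OF _ finite_half_edges] by blast
  show ?case
  proof (cases "S1 = e")
    case False
    then have "\<not> strand_closed D S1" using e(1) less.prems by (auto simp: minimal_closed_def)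
    then obtain h k where hk: "h \<in> S1" "k \<notin> S1" "k = mate D h \<or> k = partner (nodes D) h"
      using less.prems eH by (auto simp: strand_closed_iff_partner[OF D(1)])
    have "strand_closed D e" using e(1) by (simp add: minimal_closed_def)
    then have "k \<in> e" using hk less.prems(1) unfolding strand_closed_iff_partner[OF D(1)] by blast
    have c: "card (e - S1) = Suc (card (e - insert k S1))"
      using \<open>k \<in> e\<close> hk(2) fin by (metis Diff_iff Diff_insert card_Suc_Diff1 finite_Diff)
    have "cut_loops D (S0 \<union> e) = cut_loops D (S0 \<union> insert k S1) + card (e - insert k S1)"
      by (rule less.hyps) (use c less.prems \<open>k \<in> e\<close> in auto)
    also have "S0 \<union> insert k S1 = insert k (S0 \<union> S1)" by auto
    also have "cut_loops D \<dots> = Suc (cut_loops D (S0 \<union> S1))"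
      by (rule cut_loops_add[OF D m]) (use hk less.prems eH e(2) \<open>k \<in> e\<close> in auto)
    finally show ?thesis using c by simp
  qed simp
qed

lemma half_edges_delete_edge:
  assumes "strand_closed D e" "\<forall>n\<in>set (nodes D). \<not> is_crossing n"
  shows "half_edges (delete_edge D e) = half_edges D - e"
proof -
  have "all_half_edges (delete_node e n) = set (node_half_edges n) - e"
    if "n \<in> set (nodes D)" for n
  proof -
    have "\<forall>(a, b)\<in>opposite n. a \<in> e \<longleftrightarrow> b \<in> e" using assms that by (auto simp: strand_closed_def)
    then show ?thesis using that assms(2) by (cases n) auto
  qed
  then have "(\<Union>n\<in>set (nodes D). all_half_edges (delete_node e n)) =
      (\<Union>n\<in>set (nodes D). set (node_half_edges n) - e)"
    by (rule SUP_cong[OF refl])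
  moreover have "half_edges (delete_edge D e) = (\<Union>n\<in>set (nodes D). all_half_edges (delete_node e n))"
    by (simp add: half_edges_def delete_edge_def)
  moreover have "(\<Union>n\<in>set (nodes D). set (node_half_edges n) - e) = half_edges D - e"
    by (auto simp: half_edges_def)
  ultimately show ?thesis by simp
qed

text \<open>
  When all half-edges of \<open>e\<close> are cut, everything becomes local: every segment and every opposite pair
  on \<open>e\<close> bounds a circle, and the end vertices lose their half-edges. As \<open>e\<close> has two ends, these are
  \<open>card e - 1\<close> circles. With fewer cuts there is one circle less for each of the cuts not
  made.
\<close>

lemma cut_loops_edge:
  assumes D: "is_diagram D" "\<forall>n\<in>set (nodes D). \<not> is_crossing n"
    and m: "\<And>h. h \<in> half_edges D \<Longrightarrow> mate D h = m h"
    and e: "minimal_closed D e" "e \<inter> vertex_half_edges D \<noteq> {}"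
    and S: "S0 \<inter> e = {}" "S1 \<subseteq> e" "S1 \<noteq> {}"
  shows "cut_loops D (S0 \<union> S1) + 1 = cut_loops (delete_edge D e) S0 + card S1"
proof -
  let ?H = "half_edges D" and ?F = "flat_arcs (nodes D)" and ?D = "delete_edge D e"
  have ec: "strand_closed D e" using e(1) by (simp add: minimal_closed_def)
  have eH: "e \<subseteq> ?H" using ec by (simp add: strand_closed_def)
  have fin: "finite e" using eH finite_subset[OF _ finite_half_edges] by blast
  have dist: "distinct (concat (map node_half_edges (nodes D)))"
    using D by (simp add: is_diagram_def)
  let ?B = "boxes S0 (?H - e)"
  let ?P = "?B \<union> ?F \<union> cap Near ` e"
  have "2 * curves (?P \<union> cap Far ` e) = 2 * curves ?P + card e"
  proof (rule far_caps)
    show "m h \<in> e \<and> m h \<noteq> h" if "h \<in> e" for h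
    proof -
      have "h \<in> ?H" using that eH by blast
      then show ?thesis using that ec m[of h] D(1) by (simp add: strand_closed_def is_diagram_def) metis
    qed
    show "avoids ?P e {Far}"
      using avoids_boxes[of "?H - e" e "{Far}" S0] avoids_flat_arcs[of e "nodes D" "{Far}"]
        avoids_caps[of Near "{Far}" e e] by auto
    show "finite (\<Union>?P)"
      using finite_boxes[of "?H - e" S0] finite_flat_arcs[of "nodes D"] finite_caps[OF fin, of Near]
      unfolding Union_Un_distrib by simp
  qed (rule fin)
  also have "?P \<union> cap Far ` e = ?F \<union> boxes (S0 \<union> e) ?H"
    unfolding boxes_cut_all[OF eH S(1)] by auto
  finally have 1: "2 * curves (?F \<union> boxes (S0 \<union> e) ?H) = 2 * curves ?P + card e" .
  have eall: "e \<inter> all_half_edges (nodes D) = e" using eH by (auto simp: half_edges_def)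
  have "2 * (curves (?B \<union> ?F \<union> cap Near ` (e \<inter> all_half_edges (nodes D))) + count_list (nodes D) (Vertex [])) =
      2 * (curves (?B \<union> flat_arcs (concat (map (delete_node e) (nodes D))))
        + count_list (concat (map (delete_node e) (nodes D))) (Vertex []))
      + card (e \<inter> through_ends (nodes D))"
  proof (rule delete_nodes_flat[OF dist D(2)])
    show "\<forall>n\<in>set (nodes D). \<forall>(a, b)\<in>opposite n. a \<in> e \<longleftrightarrow> b \<in> e"
      using ec by (simp add: strand_closed_def)
    show "avoids ?B (e \<inter> all_half_edges (nodes D)) {Near, Tip}"
      unfolding eall by (rule avoids_boxes) auto
    show "finite (\<Union>?B)" by (rule finite_boxes) simp
  qed
  then have 2: "2 * (curves ?P + isolated_vertices D) = 2 * cut_loops ?D S0 + card (e \<inter> through_ends (nodes D))"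
    unfolding eall cut_loops_def half_edges_delete_edge[OF ec D(2)]
    by (simp add: isolated_vertices_def delete_edge_def Un_commute)
  have V: "vertex_half_edges D = vertex_ends (nodes D)"
    by (simp add: vertex_half_edges_def vertex_ends_def)
  have "e \<inter> through_ends (nodes D) = e - vertex_half_edges D"
    using eH unfolding through_ends_eq[OF dist] V half_edges_def by auto
  moreover have "card (e \<inter> vertex_half_edges D) = 2"
    using edge_two_ends[OF D(1) e(1)] e(2) by blast
  moreover have "card e = card (e \<inter> vertex_half_edges D) + card (e - vertex_half_edges D)"
    using fin by (metis card_Int_Diff)
  ultimately have 3: "card e = card (e \<inter> through_ends (nodes D)) + 2" by simp
  have 4: "cut_loops D (S0 \<union> e) = cut_loops D (S0 \<union> S1) + card (e - S1)"
    by (rule cut_loops_fill[OF D m e(1) S])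
  have 5: "cut_loops D (S0 \<union> e) = curves (?F \<union> boxes (S0 \<union> e) ?H) + isolated_vertices D"
    by (simp add: cut_loops_def)
  have 6: "card e = card (e - S1) + card S1"
    using card_mono[OF fin S(2)] card_Diff_subset[OF finite_subset[OF S(2) fin] S(2)] by simp
  have "y + 1 = c' + s1"
    if "2 * a = 2 * p + c" "2 * (p + i) = 2 * c' + t" "c = t + 2" "x = y + r" "x = a + i" "c = r + s1"
    for a p c i c' t x y r s1 :: nat
    using that by simp
  from this[OF 1 2 3 4 5 6] show ?thesis .
qed

lemma sum_Pow_split:
  assumes "finite X" "Y \<subseteq> X"
  shows "(\<Sum>S\<in>Pow X. f S) = (\<Sum>S0\<in>Pow (X - Y). \<Sum>S1\<in>Pow Y. f (S0 \<union> S1))"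
proof -
  have "(\<Sum>S\<in>Pow X. f S) = (\<Sum>(S0, S1)\<in>Pow (X - Y) \<times> Pow Y. f (S0 \<union> S1))"
    by (rule sum.reindex_bij_witness[of _ "\<lambda>(S0, S1). S0 \<union> S1" "\<lambda>S. (S - Y, S \<inter> Y)"])
      (use assms(2) in \<open>auto simp: Un_absorb2 Int_Un_distrib2 Un_Diff intro!: arg_cong[of _ _ f]\<close>)
  also have "\<dots> = (\<Sum>S0\<in>Pow (X - Y). \<Sum>S1\<in>Pow Y. f (S0 \<union> S1))"
    by (rule sum.cartesian_product[symmetric])
  finally show ?thesis .
qed

lemma sum_Pow_minus_one:
  assumes "finite X" "X \<noteq> {}"
  shows "(\<Sum>S\<in>Pow X. (- 1) ^ card S) = (0::'a)"
proof -
  obtain x where x: "x \<in> X" using assms(2) by blast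
  then have X: "X = insert x (X - {x})" by blast
  have "(\<Sum>S\<in>Pow (X - {x}). (- 1) ^ card (insert x S)) = - (\<Sum>S\<in>Pow (X - {x}). (- 1) ^ card S :: 'a)"
    unfolding sum_negf[symmetric]
  proof (rule sum.cong[OF refl])
    fix S assume "S \<in> Pow (X - {x})"
    then have "finite S" "x \<notin> S" using assms(1) finite_subset[of S "X - {x}"] by auto
    then show "(- 1) ^ card (insert x S) = - ((- 1) ^ card S :: 'a)" by simp
  qed
  then show ?thesis
    by (subst X, subst sum_Pow_insert) (use assms(1) in simp_all)
qed

text \<open>
  The edge rule. The terms without a cut on \<open>e\<close> form the summand of the marked edge, the others that
  of the deleted edge.
\<close>

lemma cable_sum_edge:
  assumes D: "is_diagram D" "\<forall>n\<in>set (nodes D). \<not> is_crossing n"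
    and m: "\<And>h. h \<in> half_edges D \<Longrightarrow> mate D h = m h"
    and e: "minimal_closed D e" "e \<inter> vertex_half_edges D \<noteq> {}"
    and T: "finite T" "T \<inter> e \<noteq> {}"
  shows "cable_sum D T = - (1 / d) * cable_sum (delete_edge D e) (T - e) + cable_sum D (T - e)"
proof -
  let ?D = "delete_edge D e" and ?x = "- (1 / d)" and ?Y = "T \<inter> e"
  have nc: "\<forall>n\<in>set (nodes ?D). \<not> is_crossing n"
  proof -
    have "\<not> is_crossing k" if "k \<in> set (delete_node e n)" "\<not> is_crossing n" for k n
      using that by (cases n) (auto split: if_splits)
    then show ?thesis using D(2) by (auto simp: delete_edge_def)
  qed
  have inner: "(\<Sum>S1\<in>Pow ?Y. ?x ^ card (S0 \<union> S1) * d ^ cut_loops D (S0 \<union> S1)) =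
      ?x * (?x ^ card S0 * d ^ cut_loops ?D S0) + ?x ^ card S0 * d ^ cut_loops D S0"
    if S0: "S0 \<in> Pow (T - ?Y)" for S0
  proof -
    let ?c = "?x ^ card S0 * d ^ cut_loops ?D S0"
    have S0e: "S0 \<inter> e = {}" "finite S0" using S0 T(1) finite_subset[of S0 T] by auto
    have summand: "?x ^ card (S0 \<union> S1) * d ^ cut_loops D (S0 \<union> S1) = 1 / d * ?c * (- 1) ^ card S1"
      if S1: "S1 \<in> Pow ?Y - {{}}" for S1
    proof -
      have f: "finite S1" "S1 \<subseteq> e" "S1 \<noteq> {}" using S1 T(1) finite_subset[of S1 T] by auto
      have "card (S0 \<union> S1) = card S0 + card S1"
        by (rule card_Un_disjoint) (use S0e f in auto)
      moreover have "d * d ^ cut_loops D (S0 \<union> S1) = d ^ cut_loops ?D S0 * d ^ card S1"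
        using cut_loops_edge[OF D m e S0e(1) f(2,3)] by (simp flip: power_add power_Suc)
      then have "d ^ cut_loops D (S0 \<union> S1) = d ^ cut_loops ?D S0 * d ^ card S1 / d"
        using d_nonzero by (simp add: field_simps)
      moreover have "?x ^ k * d ^ k = (- 1) ^ k" for k
        using d_nonzero by (simp flip: power_mult_distrib)
      ultimately show ?thesis
        by (simp add: power_add field_simps)
    qed
    have "(\<Sum>S1\<in>Pow ?Y. (- 1) ^ card S1) = (1::'a) + (\<Sum>S1\<in>Pow ?Y - {{}}. (- 1) ^ card S1)"
      using T(1) by (subst sum.remove[of _ "{}"]) auto
    then have minus: "(\<Sum>S1\<in>Pow ?Y - {{}}. (- 1) ^ card S1) = (- 1::'a)"
      using sum_Pow_minus_one[of ?Y] T by (simp add: eq_neg_iff_add_eq_0 add.commute)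
    have "(\<Sum>S1\<in>Pow ?Y. ?x ^ card (S0 \<union> S1) * d ^ cut_loops D (S0 \<union> S1)) =
        ?x ^ card S0 * d ^ cut_loops D S0 +
        (\<Sum>S1\<in>Pow ?Y - {{}}. ?x ^ card (S0 \<union> S1) * d ^ cut_loops D (S0 \<union> S1))"
      using T(1) by (subst sum.remove[of _ "{}"]) auto
    also have "(\<Sum>S1\<in>Pow ?Y - {{}}. ?x ^ card (S0 \<union> S1) * d ^ cut_loops D (S0 \<union> S1)) =
        (\<Sum>S1\<in>Pow ?Y - {{}}. 1 / d * ?c * (- 1) ^ card S1)"
      by (rule sum.cong[OF refl summand])
    also have "\<dots> = 1 / d * ?c * (- 1)"
      unfolding sum_distrib_left[symmetric] minus ..
    finally show ?thesis by simp
  qed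
  have "cable_sum D T = (\<Sum>S0\<in>Pow (T - ?Y). \<Sum>S1\<in>Pow ?Y. ?x ^ card (S0 \<union> S1) * d ^ cut_loops D (S0 \<union> S1))"
    unfolding cable_sum_no_crossing[OF D(2)] project_def by (rule sum_Pow_split) (use T in auto)
  also have "\<dots> = (\<Sum>S0\<in>Pow (T - ?Y). ?x * (?x ^ card S0 * d ^ cut_loops ?D S0) + ?x ^ card S0 * d ^ cut_loops D S0)"
    by (rule sum.cong[OF refl inner])
  also have "T - ?Y = T - e" by auto
  finally show ?thesis
    unfolding cable_sum_no_crossing[OF D(2)] cable_sum_no_crossing[OF nc] project_def
    by (simp only: sum.distrib sum_distrib_left)
qed

end

section \<open>Diagrams, markings and closed sets of half-edges\<close>

text \<open>
  The conditions on a diagram that do not concern circle components. The classes of \<open>strand_rel\<close> can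
  be identified with the minimal closed sets on this basis, and this in turn is needed to
  reformulate the remaining condition.
\<close>

definition well_formed :: "'h diagram \<Rightarrow> bool" where
  "well_formed D \<longleftrightarrow> distinct (concat (map node_half_edges (nodes D))) \<and>
     (\<forall>h\<in>half_edges D. mate D h \<in> half_edges D \<and> mate D h \<noteq> h \<and> mate D (mate D h) = h)"

fun is_virtual :: "'h node \<Rightarrow> bool" where
  "is_virtual (Virtual a b c e) = True"
| "is_virtual _ = False"

text \<open>
  A strand without any of these half-edges would be a circle through virtual crossings only, on which
  there is no place to insert a vertex.
\<close>

definition anchors :: "'h diagram \<Rightarrow> 'h set" where
  "anchors D = (\<Union>n\<in>{n \<in> set (nodes D). \<not> is_virtual n}. set (node_half_edges n))"

definition strand :: "'h diagram \<Rightarrow> 'h \<Rightarrow> 'h set" where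
  "strand D h = conn (strand_rel D) `` {h}"

lemma strand_subset_closed:
  assumes "well_formed D" "strand_closed D C" "h \<in> C"
  shows "strand D h \<subseteq> C"
proof -
  have step: "v \<in> C" if "u \<in> C" "(u, v) \<in> strand_rel D \<or> (v, u) \<in> strand_rel D" for u v
    using that(2)
  proof
    assume "(u, v) \<in> strand_rel D"
    then show ?thesis using assms(2) that(1) unfolding strand_rel_def strand_closed_def by fastforce
  next
    assume "(v, u) \<in> strand_rel D"
    then consider "v \<in> half_edges D" "u = mate D v" | n where "n \<in> set (nodes D)" "(v, u) \<in> opposite n"
      by (auto simp: strand_rel_def)
    then show ?thesis
    proof cases
      case 1
      then have "v = mate D u" using assms(1) by (simp add: well_formed_def)
      then show ?thesis using assms(2) that(1) by (simp add: strand_closed_def)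
    next
      case 2
      then show ?thesis using assms(2) that(1) by (fastforce simp: strand_closed_def)
    qed
  qed
  have "v \<in> C" if "(h, v) \<in> conn (strand_rel D)" for v
    using that by (induction rule: rtrancl_induct) (use assms(3) step in auto)
  then show ?thesis by (auto simp: strand_def)
qed

lemma half_edges_closed:
  assumes "well_formed D"
  shows "strand_closed D (half_edges D)"
proof -
  have "a \<in> half_edges D \<and> b \<in> half_edges D" if "n \<in> set (nodes D)" "(a, b) \<in> opposite n" for n a b
    using that(1) opposite_mem[OF that(2)] by (auto simp: half_edges_def)
  then have "\<forall>n\<in>set (nodes D). \<forall>(a, b)\<in>opposite n. a \<in> half_edges D \<longleftrightarrow> b \<in> half_edges D"
    by blast
  then show ?thesis using assms by (simp add: strand_closed_def well_formed_def)
qed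

lemma strand_minimal_closed:
  assumes D: "well_formed D" and h: "h \<in> half_edges D"
  shows "minimal_closed D (strand D h)"
proof -
  have mem: "h \<in> strand D h" by (simp add: strand_def)
  have sub: "strand D h \<subseteq> half_edges D"
    by (rule strand_subset_closed[OF D half_edges_closed[OF D] h])
  have step: "v \<in> strand D h" if "u \<in> strand D h" "(u, v) \<in> conn (strand_rel D)" for u v
    using that by (auto simp: strand_def intro: conn_trans)
  have closed: "strand_closed D (strand D h)"
    unfolding strand_closed_def
  proof (intro conjI ballI)
    fix u assume u: "u \<in> strand D h"
    then have "(u, mate D u) \<in> strand_rel D" using sub by (auto simp: strand_rel_def)
    from conn_step[OF this] show "mate D u \<in> strand D h" by (rule step[OF u])
  next
    fix n p assume n: "n \<in> set (nodes D)" "p \<in> opposite n"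
    then have "(fst p, snd p) \<in> conn (strand_rel D)"
      by (intro conn_step) (auto simp: strand_rel_def)
    note pair = this
    have "fst p \<in> strand D h \<longleftrightarrow> snd p \<in> strand D h"
      using step[OF _ pair] step[OF _ conn_sym[OF pair]] by (rule iffI)
    then show "case p of (a, b) \<Rightarrow> (a \<in> strand D h) = (b \<in> strand D h)"
      by (simp add: split_def)
  qed (rule sub)
  have "C = strand D h" if C: "strand_closed D C" "C \<subseteq> strand D h" "C \<noteq> {}" for C
  proof -
    obtain x where x: "x \<in> C" using C(3) by blast
    then have "(h, x) \<in> conn (strand_rel D)" using C(2) by (auto simp: strand_def)
    then have "strand D x = strand D h" unfolding strand_def conn_class_eq_iff by (rule conn_sym)
    then show ?thesis using strand_subset_closed[OF D C(1) x] C(2) by blast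
  qed
  then show ?thesis using closed mem by (auto simp: minimal_closed_def)
qed

lemma strands_eq:
  assumes D: "well_formed D"
  shows "strands D = {e. minimal_closed D e}"
proof -
  have "strands D = strand D ` half_edges D"
    by (simp add: strands_def classes_eq_image strand_def)
  moreover have "e \<in> strand D ` half_edges D" if e: "minimal_closed D e" for e
  proof -
    obtain h where h: "h \<in> e" "h \<in> half_edges D" "strand_closed D e"
      using e by (auto simp: minimal_closed_def strand_closed_def)
    have "strand D h \<subseteq> e" by (rule strand_subset_closed[OF D h(3,1)])
    then have "strand D h = e"
      using e strand_minimal_closed[OF D h(2)] by (auto simp: minimal_closed_def)
    then show ?thesis using h by auto
  qed
  ultimately show ?thesis using strand_minimal_closed[OF D] by auto
qed

text \<open>
  The convention for circle components, for all closed sets. In this form it is inherited when nodes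
  are replaced, as closed sets that avoid the new nodes are closed in the old diagram.
\<close>

lemma is_diagram_iff:
  "is_diagram D \<longleftrightarrow> well_formed D \<and>
     (\<forall>C. strand_closed D C \<longrightarrow> C \<noteq> {} \<longrightarrow> C \<inter> anchors D \<noteq> {})"
proof (cases "well_formed D")
  case wf: True
  have "(\<forall>C\<in>free_circles D. \<exists>p q. Point p q \<in> set (nodes D) \<and> p \<in> C) \<longleftrightarrow>
     (\<forall>C. strand_closed D C \<longrightarrow> C \<noteq> {} \<longrightarrow> C \<inter> anchors D \<noteq> {})"
  proof (intro iffI ballI allI impI)
    fix C assume *: "\<forall>C\<in>free_circles D. \<exists>p q. Point p q \<in> set (nodes D) \<and> p \<in> C"
      "strand_closed D C" "C \<noteq> {}"
    then obtain h where h: "h \<in> C" "h \<in> half_edges D" by (auto simp: strand_closed_def)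
    have sC: "strand D h \<subseteq> C" by (rule strand_subset_closed[OF wf *(2) h(1)])
    have st: "strand D h \<in> strands D"
      using strand_minimal_closed[OF wf h(2)] by (simp add: strands_eq[OF wf])
    show "C \<inter> anchors D \<noteq> {}"
    proof (cases "strand D h \<inter> (vertex_half_edges D \<union> crossing_half_edges D) = {}")
      case True
      then have "strand D h \<in> free_circles D" using st by (simp add: free_circles_def)
      then obtain p q where "Point p q \<in> set (nodes D)" "p \<in> strand D h" using *(1) by blast
      then show ?thesis using sC by (force simp: anchors_def)
    next
      case False
      moreover have "is_vertex n \<or> is_crossing n \<Longrightarrow> \<not> is_virtual n" for n :: "'a node"
        by (cases n) auto
      ultimately show ?thesis
        using sC unfolding anchors_def vertex_half_edges_def crossing_half_edges_def by blast
    qed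
  next
    fix C assume *: "\<forall>C. strand_closed D C \<longrightarrow> C \<noteq> {} \<longrightarrow> C \<inter> anchors D \<noteq> {}" "C \<in> free_circles D"
    then have C: "minimal_closed D C" "C \<inter> (vertex_half_edges D \<union> crossing_half_edges D) = {}"
      by (auto simp: free_circles_def strands_eq[OF wf])
    then have closed: "strand_closed D C" "C \<noteq> {}" by (auto simp: minimal_closed_def)
    with *(1) obtain x n where x: "x \<in> C" "n \<in> set (nodes D)" "\<not> is_virtual n" "x \<in> set (node_half_edges n)"
      by (fastforce simp: anchors_def)
    then have "\<not> is_vertex n" "\<not> is_crossing n"
      using C(2) by (auto simp: vertex_half_edges_def crossing_half_edges_def)
    then obtain p q where n: "n = Point p q" using x(3) by (cases n) auto
    have "p \<in> C \<longleftrightarrow> q \<in> C" using closed x(2) by (fastforce simp: strand_closed_def n)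
    then show "\<exists>p q. Point p q \<in> set (nodes D) \<and> p \<in> C" using x n by auto
  qed
  then show ?thesis using wf by (auto simp: is_diagram_def well_formed_def)
qed (auto simp: is_diagram_def well_formed_def)

lemma is_diagram_well_formed: "is_diagram D \<Longrightarrow> well_formed D"
  by (simp add: is_diagram_iff)

lemma strand_closed_Int: "strand_closed D C \<Longrightarrow> strand_closed D C' \<Longrightarrow> strand_closed D (C \<inter> C')"
  unfolding strand_closed_def by fast

lemma strand_closed_Un: "strand_closed D C \<Longrightarrow> strand_closed D C' \<Longrightarrow> strand_closed D (C \<union> C')"
  unfolding strand_closed_def by fast

lemma is_marking_iff:
  assumes D: "well_formed D"
  shows "is_marking D M \<longleftrightarrow> strand_closed D M \<and> M \<inter> crossing_half_edges D = {}"
proof (intro iffI conjI)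
  assume M: "is_marking D M"
  then show "M \<inter> crossing_half_edges D = {}" by (simp add: is_marking_def)
  have sub: "strand D h \<subseteq> M" "h \<in> half_edges D" if "h \<in> M" for h
  proof -
    show h: "h \<in> half_edges D" using M that by (auto simp: is_marking_def)
    have "h \<in> strand D h" by (simp add: strand_def)
    moreover have "strand D h \<in> strands D"
      using strand_minimal_closed[OF D h] by (simp add: strands_eq[OF D])
    ultimately show "strand D h \<subseteq> M" using M that by (auto simp: is_marking_def)
  qed
  have M: "M = (\<Union>h\<in>M. strand D h)" using sub by (auto simp: strand_def)
  have "strand_closed D (\<Union>h\<in>M. strand D h)"
    using sub(2) strand_minimal_closed[OF D] unfolding minimal_closed_def strand_closed_def
    by (fastforce simp: split_def)
  then show "strand_closed D M" using M by simp
next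
  assume M: "strand_closed D M \<and> M \<inter> crossing_half_edges D = {}"
  have "e \<subseteq> M \<or> e \<inter> M = {}" if e: "minimal_closed D e" for e
  proof -
    have "strand_closed D (e \<inter> M)" using e M by (simp add: minimal_closed_def strand_closed_Int)
    then have "e \<inter> M = {} \<or> e \<inter> M = e" using e unfolding minimal_closed_def by blast
    then show ?thesis by blast
  qed
  then show "is_marking D M" using M by (simp add: is_marking_def strands_eq[OF D] strand_closed_def)
qed

lemma strand_closed_replace:
  assumes "strand_closed (Diagram (ns1 @ xs @ ns2) \<mu>) C" "all_half_edges xs = all_half_edges ys"
    and "C \<inter> all_half_edges ys = {}"
  shows "strand_closed (Diagram (ns1 @ ys @ ns2) \<mu>) C"
proof -
  have "a \<notin> C \<and> b \<notin> C" if "n \<in> set ys" "(a, b) \<in> opposite n" for n a b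
    using that opposite_mem[OF that(2)] assms(3) by auto
  then have "\<forall>n\<in>set ys. \<forall>(a, b)\<in>opposite n. a \<in> C \<longleftrightarrow> b \<in> C" by auto
  then show ?thesis
    using assms(1,2) by (simp add: strand_closed_def half_edges_def ball_Un UN_Un)
qed

lemma half_edges_replace:
  "all_half_edges xs = all_half_edges ys \<Longrightarrow>
    half_edges (Diagram (ns1 @ xs @ ns2) \<mu>) = half_edges (Diagram (ns1 @ ys @ ns2) \<mu>)"
  by (simp add: half_edges_def UN_Un)

lemma is_diagram_replace:
  assumes D: "is_diagram (Diagram (ns1 @ xs @ ns2) \<mu>)"
    and W: "all_half_edges xs = all_half_edges ys"
    and ys: "distinct (concat (map node_half_edges ys))" "\<forall>n\<in>set ys. \<not> is_virtual n"
  shows "is_diagram (Diagram (ns1 @ ys @ ns2) \<mu>)"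
  unfolding is_diagram_iff
proof (intro conjI allI impI)
  let ?D = "Diagram (ns1 @ xs @ ns2) \<mu>" and ?D' = "Diagram (ns1 @ ys @ ns2) \<mu>"
  note wf = is_diagram_well_formed[OF D]
  have "set (concat (map node_half_edges xs)) = set (concat (map node_half_edges ys))"
    using W by simp
  then show "well_formed ?D'"
    using wf ys(1) half_edges_replace[OF W, of ns1 ns2 \<mu>] unfolding well_formed_def by auto
  fix C assume C: "strand_closed ?D' C" "C \<noteq> {}"
  show "C \<inter> anchors ?D' \<noteq> {}"
  proof (cases "C \<inter> all_half_edges xs = {}")
    case True
    then have "strand_closed ?D C" using strand_closed_replace[OF C(1) W[symmetric]] by simp
    then have "C \<inter> anchors ?D \<noteq> {}" using D C(2) by (simp add: is_diagram_iff)
    then show ?thesis using True by (fastforce simp: anchors_def)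
  next
    case False
    then show ?thesis using ys(2) W by (fastforce simp: anchors_def)
  qed
qed

text \<open>
  Every unmarked strand carries a site. As for \<open>is_diagram_iff\<close>, closed sets are easier to transport
  than strands.
\<close>

definition hits :: "'h diagram \<Rightarrow> 'h set \<Rightarrow> 'h set \<Rightarrow> bool" where
  "hits D M T \<longleftrightarrow> (\<forall>C. strand_closed D C \<longrightarrow> C \<inter> M = {} \<longrightarrow> C \<noteq> {} \<longrightarrow> C \<inter> T \<noteq> {})"

lemma hits_replace:
  assumes "hits (Diagram (ns1 @ xs @ ns2) \<mu>) M T" "all_half_edges xs = all_half_edges ys"
    and "all_half_edges xs \<subseteq> T"
  shows "hits (Diagram (ns1 @ ys @ ns2) \<mu>) M T"
  unfolding hits_def
proof (intro allI impI)
  fix C assume C: "strand_closed (Diagram (ns1 @ ys @ ns2) \<mu>) C" "C \<inter> M = {}" "C \<noteq> {}"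
  show "C \<inter> T \<noteq> {}"
  proof (cases "C \<inter> all_half_edges xs = {}")
    case True
    then show ?thesis
      using strand_closed_replace[OF C(1) assms(2)[symmetric]] C assms(1) by (simp add: hits_def)
  qed (use assms(3) in blast)
qed

lemma set_delete_edge: "set (nodes (delete_edge D e)) = (\<Union>n\<in>set (nodes D). set (delete_node e n))"
  by (simp add: delete_edge_def)

lemma opposite_delete_node:
  assumes "\<forall>(a, b)\<in>opposite n. a \<in> e \<longleftrightarrow> b \<in> e" "\<not> is_crossing n"
  shows "(\<Union>k\<in>set (delete_node e n). opposite k) = {p \<in> opposite n. fst p \<notin> e}"
  using assms by (cases n) auto

text \<open>
  Deletion of \<open>e\<close> forgets exactly the opposite pairs on \<open>e\<close>.
\<close>

lemma strand_closed_delete_edge: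
  assumes e: "strand_closed D e" and nc: "\<forall>n\<in>set (nodes D). \<not> is_crossing n"
    and H: "half_edges (delete_edge D e) = half_edges D - e"
  shows "strand_closed (delete_edge D e) C \<longleftrightarrow> strand_closed D C \<and> C \<inter> e = {}"
proof -
  have compat: "\<forall>(a, b)\<in>opposite n. a \<in> e \<longleftrightarrow> b \<in> e" if "n \<in> set (nodes D)" for n
    using e that by (simp add: strand_closed_def)
  have "(\<forall>k\<in>set (nodes (delete_edge D e)). \<forall>(a, b)\<in>opposite k. a \<in> C \<longleftrightarrow> b \<in> C) \<longleftrightarrow>
     (\<forall>n\<in>set (nodes D). \<forall>p\<in>(\<Union>k\<in>set (delete_node e n). opposite k). fst p \<in> C \<longleftrightarrow> snd p \<in> C)"
    by (auto simp: set_delete_edge split_def)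
  also have "\<dots> \<longleftrightarrow> (\<forall>n\<in>set (nodes D). \<forall>p\<in>{p \<in> opposite n. fst p \<notin> e}. fst p \<in> C \<longleftrightarrow> snd p \<in> C)"
    using opposite_delete_node[OF compat] nc by simp
  finally have 1: "(\<forall>k\<in>set (nodes (delete_edge D e)). \<forall>(a, b)\<in>opposite k. a \<in> C \<longleftrightarrow> b \<in> C) \<longleftrightarrow>
     (\<forall>n\<in>set (nodes D). \<forall>p\<in>{p \<in> opposite n. fst p \<notin> e}. fst p \<in> C \<longleftrightarrow> snd p \<in> C)" .
  have 2: "(\<forall>n\<in>set (nodes D). \<forall>p\<in>{p \<in> opposite n. fst p \<notin> e}. fst p \<in> C \<longleftrightarrow> snd p \<in> C) \<longleftrightarrow>
     (\<forall>n\<in>set (nodes D). \<forall>(a, b)\<in>opposite n. a \<in> C \<longleftrightarrow> b \<in> C)" if "C \<inter> e = {}"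
    using compat that by (fastforce simp: split_def)
  have m: "mate (delete_edge D e) = mate D" by (simp add: delete_edge_def)
  show ?thesis
  proof (cases "C \<inter> e = {}")
    case True
    then have "C \<subseteq> half_edges D - e \<longleftrightarrow> C \<subseteq> half_edges D" by blast
    then show ?thesis unfolding strand_closed_def 1 2[OF True] H m using True by simp
  next
    case False
    then show ?thesis unfolding strand_closed_def H by blast
  qed
qed

lemma is_diagram_delete_edge:
  assumes D: "is_diagram D" and e: "strand_closed D e" and nc: "\<forall>n\<in>set (nodes D). \<not> is_crossing n"
    and H: "half_edges (delete_edge D e) = half_edges D - e"
  shows "is_diagram (delete_edge D e)"
  unfolding is_diagram_iff
proof (intro conjI allI impI)
  have wf: "well_formed D" by (rule is_diagram_well_formed[OF D])
  have "distinct (concat (map node_half_edges (concat (map (delete_node e) ns))))"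
    if "distinct (concat (map node_half_edges ns))" for ns
    using that
  proof (induction ns)
    case (Cons n ns)
    have "set (concat (map node_half_edges (concat (map (delete_node e) ns)))) =
        (\<Union>k\<in>set ns. all_half_edges (delete_node e k))" by auto
    also have "\<dots> \<subseteq> all_half_edges ns" by (rule UN_mono[OF order_refl delete_node_half_edges])
    finally have "set (concat (map node_half_edges (concat (map (delete_node e) ns)))) \<subseteq> all_half_edges ns" .
    moreover have "set (concat (map node_half_edges (delete_node e n))) \<subseteq> set (node_half_edges n)"
      by (cases n) auto
    moreover have "distinct (concat (map node_half_edges (delete_node e n)))"
      using Cons.prems by (cases n) auto
    ultimately show ?case using Cons by auto
  qed simp
  moreover have "mate D h \<notin> e" if "h \<in> half_edges D" "h \<notin> e" for h
    using that wf e by (metis strand_closed_def well_formed_def)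
  ultimately show "well_formed (delete_edge D e)"
    using wf unfolding well_formed_def H by (simp add: delete_edge_def)
  fix C assume C: "strand_closed (delete_edge D e) C" "C \<noteq> {}"
  then have C': "strand_closed D C" "C \<inter> e = {}"
    using strand_closed_delete_edge[OF e nc H] by auto
  then obtain x n where x: "x \<in> C" "n \<in> set (nodes D)" "\<not> is_virtual n" "x \<in> set (node_half_edges n)"
    using D C(2) by (fastforce simp: is_diagram_iff anchors_def)
  then have "x \<notin> e" using C' by auto
  moreover have "\<forall>(a, b)\<in>opposite n. a \<in> e \<longleftrightarrow> b \<in> e"
    using e x(2) by (simp add: strand_closed_def)
  ultimately have "\<exists>k\<in>set (delete_node e n). \<not> is_virtual k \<and> x \<in> set (node_half_edges k)"
    using x(3,4) nc x(2) by (cases n) auto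
  then show "C \<inter> anchors (delete_edge D e) \<noteq> {}"
    using x(1,2) by (fastforce simp: anchors_def set_delete_edge)
qed

section \<open>Marked cyclic graphs\<close>

lemma finite_sides: "finite (UNIV :: side set)"
  by (rule finite_subset[of _ "{Cw, Ccw}"]) (use side.exhaust in auto)

text \<open>
  Every boundary component lies in one connected component, and every component has a boundary.
\<close>

lemma num_components_le_num_boundaries: "num_components D \<le> num_boundaries D"
proof -
  let ?H = "half_edges D"
  let ?s = "strand_rel D \<union> (\<Union>n\<in>set (nodes D). vertex_rel n)" and ?r = "boundary_rel D"
  have "(fst u, fst v) \<in> conn ?s" if "(u, v) \<in> conn ?r" for u v
    using that by (rule conn_map) (auto simp: boundary_rel_def)
  then have finer: "conn ?s `` {fst u} = conn ?s `` {fst v}" if "conn ?r `` {u} = conn ?r `` {v}" for u v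
    using that unfolding conn_class_eq_iff .
  have "card ((\<lambda>x. conn ?s `` {fst x}) ` (?H \<times> (UNIV :: side set))) \<le>
      card ((\<lambda>x. conn ?r `` {x}) ` (?H \<times> UNIV))"
    by (rule card_image_le_if_finer[OF finite_cartesian_product[OF finite_half_edges finite_sides] finer])
  moreover have "(\<lambda>x. conn ?s `` {fst x}) ` (?H \<times> (UNIV :: side set)) = (\<lambda>h. conn ?s `` {h}) ` ?H"
    unfolding image_image[of "\<lambda>h. conn ?s `` {h}" fst, symmetric] by simp
  ultimately show ?thesis by (simp add: num_components_def num_boundaries_def classes_eq_image)
qed

lemma all_through: "boxes {} H = (\<Union>h\<in>H. through h)"
  by (simp add: boxes_def)

context skein begin

text \<open>
  Without cuts the two strands over a half-edge are the two sides of its band. Forgetting the levels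
  \<open>Tip\<close>, \<open>Near\<close> and \<open>Far\<close> contracts the graph of the curves to that of the boundary.
\<close>

lemma cut_loops_empty:
  assumes D: "is_diagram D" and nc: "\<forall>n\<in>set (nodes D). \<not> is_crossing n"
    and m: "\<And>h. h \<in> half_edges D \<Longrightarrow> mate D h = m h"
  shows "cut_loops D {} = num_boundaries D"
proof -
  let ?H = "half_edges D" and ?M = "cable_mate m"
  let ?P = "flat_arcs (nodes D) \<union> boxes {} ?H"
  let ?r = "link ?M ?P" and ?s = "boundary_rel D"
  define f :: "'h cable \<Rightarrow> 'h \<times> side" where
    "f x = (case x of Strand h s l \<Rightarrow> (h, s) | Iso i s \<Rightarrow> undefined)" for x
  define g :: "'h \<times> side \<Rightarrow> 'h cable" where "g = (\<lambda>(h, s). Strand h s Tip)"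
  have f [simp]: "f (Strand h s l) = (h, s)" for h s l by (simp add: f_def)
  have g [simp]: "g (h, s) = Strand h s Tip" for h s by (simp add: g_def)
  have mH: "m h \<in> ?H" "mate D h = m h" if "h \<in> ?H" for h
    using D m[OF that] that by (auto simp: is_diagram_def)
  have thr: "{Strand h s Near, Strand h s Far} \<in> ?P" if "h \<in> ?H" for h s
    using that by (cases s) (auto simp: all_through through_def)
  have tipX: "Strand h s Tip \<in> \<Union>?P" if h: "h \<in> ?H" for h s
  proof -
    from h obtain n where n: "n \<in> set (nodes D)" "h \<in> set (node_half_edges n)"
      by (auto simp: half_edges_def)
    have "Strand h s Tip \<in> \<Union>(node_arcs n)"
    proof (cases n)
      case (Vertex hs)
      then have "h \<in> set hs" using n by simp
      then obtain x y where "(h, x) \<in> set (consecutive hs)" "(y, h) \<in> set (consecutive hs)"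
        using set_consecutive[of hs] by (metis (no_types, lifting) imageE prod.collapse)
      then show ?thesis by (cases s) (force simp: Vertex disk_arc_def)+
    qed (use n nc in \<open>cases s; auto simp: parallel_def\<close>)+
    then show ?thesis using n(1) by (auto simp: flat_arcs_def)
  qed
  have X: "\<Union>?P = {Strand h s l |h s l. h \<in> ?H \<and> l \<in> {Near, Far, Tip}}"
  proof
    show "\<Union>?P \<subseteq> {Strand h s l |h s l. h \<in> ?H \<and> l \<in> {Near, Far, Tip}}"
    proof
      fix x assume "x \<in> \<Union>?P"
      then consider n where "n \<in> set (nodes D)" "x \<in> \<Union>(node_arcs n)" | "x \<in> \<Union>(boxes {} ?H)"
        by (auto simp: flat_arcs_def)
      then show "x \<in> {Strand h s l |h s l. h \<in> ?H \<and> l \<in> {Near, Far, Tip}}"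
      proof cases
        case 1
        from Union_node_arcs[OF this(2)] show ?thesis using 1(1) by (auto simp: half_edges_def)
      qed (auto simp: all_through through_def)
    qed
    show "{Strand h s l |h s l. h \<in> ?H \<and> l \<in> {Near, Far, Tip}} \<subseteq> \<Union>?P"
      using tipX thr by blast
  qed
  have tn: "(Strand h s Tip, Strand h s Near) \<in> ?r" and nf: "(Strand h s Near, Strand h s Far) \<in> ?r"
    and ff: "(Strand h s Far, Strand (m h) (flip s) Far) \<in> ?r" if "h \<in> ?H" for h s
    using that thr[OF that] mH unfolding link_def X by auto
  have tip: "(Strand h s Tip, Strand h s l) \<in> conn ?r" if "h \<in> ?H" "l \<in> {Near, Far, Tip}" for h s l
    using conn_step[OF tn[OF that(1)]] conn_step[OF nf[OF that(1)]] that(2)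
    by (auto intro: conn_trans)
  have "curves ?P = card (classes (?H \<times> UNIV) ?s)"
    unfolding loops_def
  proof (rule card_classes_contract[where f = f and g = g])
    show "f ` \<Union>?P = ?H \<times> UNIV"
      unfolding X by (auto simp: image_iff) (metis f insertI1)
    show "(x, g (f x)) \<in> conn ?r" if "x \<in> \<Union>?P" for x
      using that unfolding X by (auto intro!: conn_sym[OF tip])
    show "(f u, f v) \<in> conn ?s" if "(u, v) \<in> ?r" for u v
    proof -
      from that consider "{u, v} \<in> flat_arcs (nodes D)" | "{u, v} \<in> boxes {} ?H"
        | "v = ?M u" "u \<in> \<Union>?P" by (auto simp: link_def)
      then show ?thesis
      proof cases
        case 1
        then obtain n where n: "n \<in> set (nodes D)" "{u, v} \<in> node_arcs n" by (auto simp: flat_arcs_def)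
        have par: "(f u, f v) \<in> conn ?s" if "{u, v} \<in> parallel h k" "(h, k) \<in> opposite n" for h k
        proof -
          have hk: "(h, k) \<in> strand_rel D" using that(2) n(1) by (auto simp: strand_rel_def)
          have *: "((h, s), (k, flip s)) \<in> ?s" for s
            using hk by (auto simp: boundary_rel_def)
          from that(1) show ?thesis
            using conn_step[OF *[of Cw]] conn_step[OF *[of Ccw]]
              conn_sym[OF conn_step[OF *[of Cw]]] conn_sym[OF conn_step[OF *[of Ccw]]]
            by (auto simp: parallel_def doubleton_eq_iff)
        qed
        show ?thesis
        proof (cases n)
          case (Vertex hs)
          then obtain h k where hk: "(h, k) \<in> set (consecutive hs)" "{u, v} = disk_arc h k"
            using n(2) by auto
          then have "((h, Ccw), (k, Cw)) \<in> ?s"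
            using n(1) Vertex by (force simp: boundary_rel_def)
          from conn_step[OF this] conn_sym[OF conn_step[OF this]] show ?thesis
            using hk(2) by (auto simp: disk_arc_def doubleton_eq_iff)
        qed (use n(2) par nc in auto)
      next
        case 2
        then have "f u = f v" by (auto simp: all_through through_def doubleton_eq_iff)
        then show ?thesis by simp
      next
        case 3
        then obtain h s l where u: "u = Strand h s l" "h \<in> ?H" "l \<in> {Near, Far, Tip}"
          unfolding X by auto
        have "(h, mate D h) \<in> strand_rel D" using u(2) by (auto simp: strand_rel_def)
        then have "((h, s), (m h, flip s)) \<in> ?s" using mH[OF u(2)] by (auto simp: boundary_rel_def)
        then show ?thesis using u 3 conn_step by auto
      qed
    qed
    show "(g u, g v) \<in> conn ?r" if "(u, v) \<in> ?s" for u v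
    proof -
      from that consider h s where "h \<in> ?H" "u = (h, s)" "v = (m h, flip s)"
        | n h k s where "n \<in> set (nodes D)" "(h, k) \<in> opposite n" "u = (h, s)" "v = (k, flip s)"
        | n h k where "n \<in> set (nodes D)" "(h, k) \<in> vertex_rel n" "u = (h, Ccw)" "v = (k, Cw)"
        using mH unfolding boundary_rel_def strand_rel_def by auto
      then show ?thesis
      proof cases
        case 1
        have "(Strand h s Tip, Strand (m h) (flip s) Tip) \<in> conn ?r"
          using tip[OF 1(1), of Far s] conn_step[OF ff[OF 1(1), of s]]
            conn_sym[OF tip[OF mH(1)[OF 1(1)], of Far "flip s"]] by (meson conn_trans insertCI)
        then show ?thesis using 1 by simp
      next
        case (2 n h k s)
        have "parallel h k \<subseteq> node_arcs n"
          by (rule node.exhaust[of n]) (use 2 nc in auto)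
        then have "parallel h k \<subseteq> ?P" using 2(1) by (auto simp: flat_arcs_def)
        then have "{Strand h s Tip, Strand k (flip s) Tip} \<in> ?P" by (cases s) (auto simp: parallel_def)
        then show ?thesis using 2 by (intro conn_step) (auto simp: link_def)
      next
        case (3 n h k)
        have "disk_arc h k \<in> node_arcs n"
          by (rule node.exhaust[of n]) (use 3 in auto)
        then have "disk_arc h k \<in> ?P" using 3(1) by (auto simp: flat_arcs_def)
        then show ?thesis using 3 by (intro conn_step) (auto simp: link_def disk_arc_def)
      qed
    qed
  qed
  then show ?thesis by (simp add: cut_loops_def num_boundaries_def)
qed

abbreviation evaluate :: "laurent \<Rightarrow> 'a" where
  "evaluate \<equiv> laurent_eval (A ^ 4) (- inverse d)"

lemma evaluation_point: "A ^ 4 \<noteq> 0" "- inverse d \<noteq> 0"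
  using A_nonzero d_nonzero by simp_all

lemma evaluate_mult: "evaluate (p * q) = evaluate p * evaluate q"
  by (rule laurent_eval_mult[OF evaluation_point])

lemma evaluate_alpha: "evaluate (alpha_pow i) = (A ^ 4) powi i"
  by (simp add: alpha_pow_def laurent_eval_single)

lemma evaluate_x: "evaluate (x_pow i) = (- inverse d) powi i"
  by (simp add: x_pow_def laurent_eval_single)

lemma evaluate_minus_x: "evaluate (minus_x_pow i) = inverse d powi i"
  by (simp add: minus_x_pow_def laurent_eval_uminus evaluate_x)

lemma evaluate_ribbon_factor: "evaluate (alpha_pow 1 + alpha_pow (-1) + 2) = d ^ 2"
proof -
  have "evaluate 1 = 1"
    using laurent_eval_power[OF evaluation_point, of 0 0] by simp
  then have "evaluate (1 + 1) = 1 + 1" by (simp only: laurent_eval_add)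
  then have "evaluate 2 = 2" by simp
  then have "evaluate (alpha_pow 1 + alpha_pow (-1) + 2) = A ^ 4 + inverse (A ^ 4) + 2"
    by (simp add: laurent_eval_add evaluate_alpha power_int_minus)
  also have "\<dots> = (A ^ 2 + inverse (A ^ 2)) ^ 2"
    using A_nonzero by (simp add: power2_sum field_simps power_mult[symmetric])
  also have "\<dots> = d ^ 2"
    unfolding d_def by (simp add: power_int_minus power2_eq_square algebra_simps)
  finally show ?thesis .
qed

text \<open>
  The exponents add up: \<open>-(bc - 2k) + 2 (bc - k) = bc\<close>.
\<close>

lemma evaluate_cyclic_graph:
  assumes "k \<le> bc"
  shows "evaluate (minus_x_pow (int bc - 2 * int k) * (alpha_pow 1 + alpha_pow (-1) + 2) ^ (bc - k))
    = d ^ bc"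
proof -
  have p: "evaluate ((alpha_pow 1 + alpha_pow (-1) + 2) ^ (bc - k)) = d powi (2 * (int bc - int k))"
  proof -
    have "(d ^ 2) ^ (bc - k) = d powi int (2 * (bc - k))"
      by (simp only: power_mult[symmetric] power_int_of_nat)
    also have "int (2 * (bc - k)) = 2 * (int bc - int k)" using assms by simp
    finally show ?thesis unfolding laurent_eval_power[OF evaluation_point] evaluate_ribbon_factor .
  qed
  have "evaluate (minus_x_pow (int bc - 2 * int k) * (alpha_pow 1 + alpha_pow (-1) + 2) ^ (bc - k)) =
      d powi (- (int bc - 2 * int k)) * d powi (2 * (int bc - int k))"
    unfolding evaluate_mult evaluate_minus_x p by (simp only: power_int_inverse power_int_minus)
  also have "\<dots> = d powi (- (int bc - 2 * int k) + 2 * (int bc - int k))"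
    using d_nonzero by (simp only: power_int_add simp_thms)
  also have "- (int bc - 2 * int k) + 2 * (int bc - int k) = int bc" by simp
  finally show ?thesis by simp
qed

lemma project_empty: "project {} f = f {}"
  by (simp add: project_def)

text \<open>
  The three replacements of a crossing have its half-edges, so the sites remain meaningful.
\<close>

lemma half_edges_smoothed:
  "all_half_edges [Crossing a b c e] = all_half_edges (smoothA (Crossing a b c e))"
  "all_half_edges [Crossing a b c e] = all_half_edges (smoothB (Crossing a b c e))"
  "all_half_edges [Crossing a b c e] = all_half_edges [Vertex [a, b, c, e]]"
  by auto

section \<open>Comparison of the two sides\<close>

text \<open>
  Resolving a crossing lowers the first number. Marking or deleting an edge keeps the first and
  lowers the second. Inserting a vertex on a circle keeps both and lowers the third.
\<close>

definition reduction_order :: "(('h diagram \<times> 'h set) \<times> 'h diagram \<times> 'h set) set" where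
  "reduction_order = measures
     [\<lambda>(D, M). length (filter is_crossing (nodes D)), \<lambda>(D, M). card (half_edges D - M),
      \<lambda>(D, M). length (filter (\<lambda>n. \<not> is_vertex n) (nodes D))]"

lemma wf_reduction_order: "wf reduction_order"
  unfolding reduction_order_def by (rule wf_measures)

text \<open>
  The rules for \<open>R\<close> reduce every marked diagram to fully marked cyclic graphs, and \<open>cable_sum\<close> obeys the
  same rules. The conditions on \<open>T\<close> are those which make the crossing rule and the edge rule
  applicable and which persist under all reductions: a site at each half-edge of each crossing,
  at least one on each unmarked strand and none on marked ones.
\<close>

theorem evaluate_eq_cable_sum:
  assumes R: "generalized_yamada R"
    and "is_diagram D" "is_marking D M" "\<And>h. h \<in> half_edges D \<Longrightarrow> mate D h = m h"
    and "T \<subseteq> half_edges D" "T \<inter> M = {}" "crossing_half_edges D \<subseteq> T" "hits D M T"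
  shows "evaluate (R D M) = cable_sum D T"
  using assms(2-)
proof (induction "(D, M)" arbitrary: D M T rule: wf_induct_rule[OF wf_reduction_order])
  case (1 D M T)
  note D = 1(2) and M = 1(3) and m = 1(4) and T = 1(5-8)
  note IH = 1(1)
  have wf: "well_formed D" by (rule is_diagram_well_formed[OF D])
  have dist: "distinct (concat (map node_half_edges (nodes D)))"
    using wf by (simp add: well_formed_def)
  have Mc: "strand_closed D M" "M \<inter> crossing_half_edges D = {}"
    using M by (simp_all add: is_marking_iff[OF wf])
  consider n where "n \<in> set (nodes D)" "is_crossing n"
    | "\<forall>n\<in>set (nodes D). \<not> is_crossing n" "M = half_edges D"
    | "\<forall>n\<in>set (nodes D). \<not> is_crossing n" "M \<noteq> half_edges D" by blast
  then show ?case
  proof cases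
    case (1 n)
    from 1(2) obtain a b c e where n: "n = Crossing a b c e" by (cases n) auto
    obtain ns1 ns2 where ns: "nodes D = ns1 @ [n] @ ns2"
      using split_list[OF 1(1)] by auto
    obtain \<mu> where Dn: "D = Diagram (ns1 @ [Crossing a b c e] @ ns2) \<mu>"
      using ns n by (cases D) auto
    have W: "{a, b, c, e} \<subseteq> crossing_half_edges D"
      using 1 n by (force simp: crossing_half_edges_def)
    have WT: "all_half_edges [Crossing a b c e] \<subseteq> T" using W T(3) by auto
    have d4: "distinct [a, b, c, e]" "distinct [b, c, e, a]" using dist by (auto simp: Dn)
    have step: "evaluate (R (Diagram (ns1 @ ys @ ns2) \<mu>) M) = cable_sum (Diagram (ns1 @ ys @ ns2) \<mu>) T"
      "is_diagram (Diagram (ns1 @ ys @ ns2) \<mu>)"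
      if ys: "all_half_edges [Crossing a b c e] = all_half_edges ys" "distinct (concat (map node_half_edges ys))"
        "\<forall>n\<in>set ys. \<not> is_virtual n \<and> \<not> is_crossing n" for ys
    proof -
      let ?D = "Diagram (ns1 @ ys @ ns2) \<mu>"
      show D': "is_diagram ?D"
        by (rule is_diagram_replace[OF D[unfolded Dn] ys(1,2)]) (use ys(3) in blast)
      have H: "half_edges ?D = half_edges D"
        unfolding Dn by (rule half_edges_replace[OF ys(1), symmetric])
      have C: "crossing_half_edges ?D \<subseteq> crossing_half_edges D"
        using ys(3) by (auto simp: crossing_half_edges_def Dn)
      have "filter is_crossing ys = []" using ys(3) by (simp add: filter_empty_conv)
      then have less: "((?D, M), (D, M)) \<in> reduction_order"
        by (simp add: Dn reduction_order_def)
      have "strand_closed ?D M"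
        by (rule strand_closed_replace[OF Mc(1)[unfolded Dn] ys(1)]) (use Mc(2) W ys(1) in auto)
      then have "is_marking ?D M"
        using Mc(2) C by (auto simp: is_marking_iff[OF is_diagram_well_formed[OF D']])
      moreover have "hits ?D M T"
        by (rule hits_replace[OF T(4)[unfolded Dn] ys(1) WT])
      moreover have "mate ?D h = m h" if "h \<in> half_edges ?D" for h
        using m[of h] that H by (simp add: Dn)
      ultimately show "evaluate (R ?D M) = cable_sum ?D T"
        using IH[OF less D'] T(1-3) C H by simp
    qed
    note A' = step[OF half_edges_smoothed(1)] and B' = step[OF half_edges_smoothed(2)]
      and V' = step[OF half_edges_smoothed(3)]
    have "evaluate (R D M) = evaluate (alpha_pow 1 * R (Diagram (ns1 @ smoothA (Crossing a b c e) @ ns2) \<mu>) M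
       + alpha_pow (-1) * R (Diagram (ns1 @ smoothB (Crossing a b c e) @ ns2) \<mu>) M
       + x_pow (-1) * R (Diagram (ns1 @ Vertex [a, b, c, e] # ns2) \<mu>) M)"
      using generalized_yamada.classical_crossing[OF R, of ns1 a b c e ns2 \<mu> M] D M by (simp add: Dn)
    also have "\<dots> = A ^ 4 * evaluate (R (Diagram (ns1 @ smoothA (Crossing a b c e) @ ns2) \<mu>) M)
       + inverse (A ^ 4) * evaluate (R (Diagram (ns1 @ smoothB (Crossing a b c e) @ ns2) \<mu>) M)
       - d * evaluate (R (Diagram (ns1 @ [Vertex [a, b, c, e]] @ ns2) \<mu>) M)"
      by (simp add: laurent_eval_add evaluate_mult evaluate_alpha evaluate_x power_int_minus)
    also have "\<dots> = A ^ 4 * cable_sum (Diagram (ns1 @ smoothA (Crossing a b c e) @ ns2) \<mu>) T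
       + inverse (A ^ 4) * cable_sum (Diagram (ns1 @ smoothB (Crossing a b c e) @ ns2) \<mu>) T
       - d * cable_sum (Diagram (ns1 @ [Vertex [a, b, c, e]] @ ns2) \<mu>) T"
      using A'(1) B'(1) V'(1) d4 by simp
    also have "\<dots> = cable_sum D T"
    proof -
      have H: "half_edges (Diagram (ns1 @ ys @ ns2) \<mu>) = half_edges D"
        if "all_half_edges [Crossing a b c e] = all_half_edges ys" for ys
        unfolding Dn by (rule half_edges_replace[OF that, symmetric])
      have dist': "distinct (concat (map node_half_edges (ns1 @ Crossing a b c e # ns2)))"
        using dist by (simp add: Dn)
      have "{a, b, c, e} \<subseteq> T" using WT by simp
      from project_crossing_diagram[OF dist' this T(1) finite_half_edges] show ?thesis
        unfolding cable_sum_def H[OF half_edges_smoothed(1)] H[OF half_edges_smoothed(2)]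
          H[OF half_edges_smoothed(3)] by (simp add: Dn)
    qed
    finally show ?thesis .
  next
    case 2
    then have "T = {}" using T by auto
    have cl: "cut_loops D {} = num_boundaries D"
      by (rule cut_loops_empty[OF D 2(1)]) (rule m)
    have "evaluate (R D M) = d ^ num_boundaries D"
      unfolding 2(2) generalized_yamada.cyclic_graph[OF R D 2(1)]
      by (rule evaluate_cyclic_graph[OF num_components_le_num_boundaries])
    also have "\<dots> = cable_sum D T"
      unfolding cable_sum_no_crossing[OF 2(1)] \<open>T = {}\<close> project_empty cl ..
    finally show ?thesis .
  next
    case 3
    then obtain h where h: "h \<in> half_edges D" "h \<notin> M" using Mc(1) by (auto simp: strand_closed_def)
    define e where "e = strand D h"
    have he: "h \<in> e" by (simp add: e_def strand_def)
    have emin: "minimal_closed D e" unfolding e_def by (rule strand_minimal_closed[OF wf h(1)])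
    then have ec: "strand_closed D e" by (simp add: minimal_closed_def)
    have eH: "e \<subseteq> half_edges D" using ec by (simp add: strand_closed_def)
    have eM: "e \<inter> M = {}"
    proof -
      have "e \<inter> M = e \<or> e \<inter> M = {}"
        using emin strand_closed_Int[OF ec Mc(1)] unfolding minimal_closed_def by blast
      then show ?thesis using he h(2) by blast
    qed
    have noC: "crossing_half_edges D = {}" using 3(1) by (auto simp: crossing_half_edges_def)
    have eT: "T \<inter> e \<noteq> {}" using T(4) ec eM he by (fastforce simp: hits_def)
    have fT: "finite T" by (rule finite_subset[OF T(1) finite_half_edges])
    show ?thesis
    proof (cases "e \<inter> vertex_half_edges D = {}")
      case False
      have ed: "e \<in> edges D" using emin False by (simp add: edges_def strands_eq[OF wf])
      let ?D = "delete_edge D e"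
      have H: "half_edges ?D = half_edges D - e" by (rule half_edges_delete_edge[OF ec 3(1)])
      note closed' = strand_closed_delete_edge[OF ec 3(1) H]
      have D': "is_diagram ?D" by (rule is_diagram_delete_edge[OF D ec 3(1) H])
      have nc': "filter is_crossing (nodes ?D) = []" "filter is_crossing (nodes D) = []"
        "crossing_half_edges ?D = {}"
      proof -
        have "\<not> is_crossing k" if "k \<in> set (delete_node e n)" "\<not> is_crossing n" for k n
          using that by (cases n) (auto split: if_splits)
        then have "\<forall>n\<in>set (nodes ?D). \<not> is_crossing n" using 3(1) by (auto simp: set_delete_edge)
        then show "filter is_crossing (nodes ?D) = []" "crossing_half_edges ?D = {}"
          by (auto simp: filter_empty_conv crossing_half_edges_def)
        show "filter is_crossing (nodes D) = []" using 3(1) by (simp add: filter_empty_conv)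
      qed
      have fewer: "card (half_edges D - e - M) < card (half_edges D - M)"
        by (rule psubset_card_mono) (use h he in auto)
      have del: "evaluate (R ?D M) = cable_sum ?D (T - e)"
      proof (rule IH[OF _ D'])
        show "((?D, M), (D, M)) \<in> reduction_order"
          using fewer nc' H by (simp add: reduction_order_def)
        show "is_marking ?D M"
          unfolding is_marking_iff[OF is_diagram_well_formed[OF D']] using closed' Mc(1) eM nc' by auto
        show "mate ?D k = m k" if "k \<in> half_edges ?D" for k
          using m[of k] that H by (simp add: delete_edge_def)
        show "hits ?D M (T - e)" using T(4) closed' unfolding hits_def by blast
      qed (use T H nc' in auto)
      have mark: "evaluate (R D (M \<union> e)) = cable_sum D (T - e)"
      proof (rule IH[OF _ D])
        show "((D, M \<union> e), (D, M)) \<in> reduction_order"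
        proof -
          have "half_edges D - (M \<union> e) = half_edges D - e - M" by blast
          then show ?thesis using fewer by (simp add: reduction_order_def)
        qed
        show "is_marking D (M \<union> e)"
          unfolding is_marking_iff[OF wf] using strand_closed_Un[OF Mc(1) ec] noC by simp
        show "hits D (M \<union> e) (T - e)" using T(4) unfolding hits_def by blast
      qed (use T m noC in auto)
      have "evaluate (R D M) = evaluate (x_pow 1 * R ?D M + R D (M \<union> e))"
        using generalized_yamada.unmarked_edge[OF R D M ed eM] noC by simp
      also have "\<dots> = - (1 / d) * cable_sum ?D (T - e) + cable_sum D (T - e)"
        by (simp add: laurent_eval_add evaluate_mult evaluate_x del mark divide_inverse)
      also have "\<dots> = cable_sum D T"
        by (rule cable_sum_edge[OF D 3(1) _ emin False fT eT, symmetric]) (rule m)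
      finally show ?thesis .
    next
      case True
      then have "e \<in> free_circles D" using emin noC by (simp add: free_circles_def strands_eq[OF wf])
      then obtain p q where pq: "Point p q \<in> set (nodes D)" "p \<in> e"
        using D by (auto simp: is_diagram_def)
      have qe: "q \<in> e" using ec pq by (fastforce simp: strand_closed_def)
      obtain ns1 ns2 where ns: "nodes D = ns1 @ [Point p q] @ ns2"
        using split_list[OF pq(1)] by auto
      obtain \<mu> where Dn: "D = Diagram (ns1 @ [Point p q] @ ns2) \<mu>"
        using ns by (cases D) auto
      let ?D = "Diagram (ns1 @ [Vertex [p, q]] @ ns2) \<mu>"
      have W: "all_half_edges [Point p q] = all_half_edges [Vertex [p, q]]" by simp
      have D': "is_diagram ?D"
        by (rule is_diagram_replace[OF D[unfolded Dn] W]) (use dist in \<open>auto simp: Dn\<close>)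
      have H: "half_edges ?D = half_edges D"
        unfolding Dn by (rule half_edges_replace[OF W, symmetric])
      have pqM: "p \<notin> M" "q \<notin> M" using pq qe eM by auto
      have "strand_closed ?D M"
        by (rule strand_closed_replace[OF Mc(1)[unfolded Dn] W]) (use pqM in auto)
      moreover have noC': "crossing_half_edges ?D = {}" using noC by (auto simp: crossing_half_edges_def Dn)
      ultimately have M': "is_marking ?D M"
        unfolding is_marking_iff[OF is_diagram_well_formed[OF D']] by simp
      \<comment> \<open>The inserted vertex does not separate the circle: a closed set containing only one of \<open>p\<close>
        and \<open>q\<close> would meet the circle in a set with a single end.\<close>
      have reclosed: "strand_closed D C" if C: "strand_closed ?D C" for C
      proof -
        have e': "strand_closed ?D e"
          using ec by (auto simp: strand_closed_def Dn half_edges_def)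
        have V: "e \<inter> vertex_half_edges ?D = {p, q}"
          using True pq(2) qe by (auto simp: vertex_half_edges_def Dn)
        have "even (card (C \<inter> e \<inter> vertex_half_edges ?D))"
          by (rule even_ends[OF D' strand_closed_Int[OF C e']])
        then have ev: "even (card (C \<inter> {p, q}))" by (simp only: V Int_assoc)
        have "p \<noteq> q" using dist by (simp add: Dn)
        then have "p \<in> C \<longleftrightarrow> q \<in> C"
          using ev by (cases "p \<in> C"; cases "q \<in> C") auto
        then show ?thesis
          using C by (auto simp: strand_closed_def Dn half_edges_def)
      qed
      have less: "((?D, M), (D, M)) \<in> reduction_order"
        unfolding reduction_order_def measures_def using H by (simp add: Dn)
      have "evaluate (R D M) = evaluate (R ?D M)"
        using generalized_yamada.degree_2_vertex[OF R, of ns1 p q ns2 \<mu> M] D' M' pqM by (simp add: Dn)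
      also have "\<dots> = cable_sum ?D T"
      proof (rule IH[OF less D' M'])
        show "mate ?D k = m k" if "k \<in> half_edges ?D" for k
          using m[of k] that H by (simp add: Dn)
        show "hits ?D M T" using T(4) reclosed unfolding hits_def by blast
      qed (use T H noC' in auto)
      also have "\<dots> = cable_sum D T"
      proof -
        have "node_states (Vertex [p, q]) = node_states (Point p q)"
          by (auto simp: consecutive_def disk_arc_def parallel_def insert_commute)
        then have "state_sum (Vertex [p, q] # ns) P = state_sum (Point p q # ns) P" for ns P
          by simp
        then have "state_sum (nodes ?D) P = state_sum (nodes D) P" for P
          by (simp add: Dn state_sum_move del: state_sum.simps)
        then show ?thesis unfolding cable_sum_def H by (simp only:)
      qed
      finally show ?thesis .
    qed
  qed
qed

end

text \<open>
  A strand that meets neither vertices nor crossings is a free circle, for which a site was chosen.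
\<close>

lemma projector_sites_hit:
  assumes D: "is_diagram D"
  shows "projector_sites D \<subseteq> half_edges D" and "hits D {} (projector_sites D)"
proof -
  have wf: "well_formed D" by (rule is_diagram_well_formed[OF D])
  have some: "(SOME h. h \<in> C) \<in> C" if "minimal_closed D C" for C
    using that by (auto simp: minimal_closed_def some_in_eq)
  have circle: "minimal_closed D C" if "C \<in> free_circles D" for C
    using that by (simp add: free_circles_def strands_eq[OF wf])
  have "C \<subseteq> half_edges D" if "minimal_closed D C" for C
    using that by (simp add: minimal_closed_def strand_closed_def)
  then have "(SOME h. h \<in> C) \<in> half_edges D" if "C \<in> free_circles D" for C
    using some[OF circle[OF that]] circle[OF that] by blast
  then show "projector_sites D \<subseteq> half_edges D"
    by (auto simp: projector_sites_def vertex_half_edges_def crossing_half_edges_def half_edges_def)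
  show "hits D {} (projector_sites D)"
    unfolding hits_def
  proof (intro allI impI)
    fix C assume C: "strand_closed D C" "C \<noteq> {}"
    then obtain h where h: "h \<in> C" "h \<in> half_edges D" by (auto simp: strand_closed_def)
    have sC: "strand D h \<subseteq> C" by (rule strand_subset_closed[OF wf C(1) h(1)])
    have e: "minimal_closed D (strand D h)" by (rule strand_minimal_closed[OF wf h(2)])
    show "C \<inter> projector_sites D \<noteq> {}"
    proof (cases "strand D h \<inter> (vertex_half_edges D \<union> crossing_half_edges D) = {}")
      case True
      then have "strand D h \<in> free_circles D"
        using e by (simp add: free_circles_def strands_eq[OF wf])
      then have "(SOME k. k \<in> strand D h) \<in> projector_sites D"
        by (simp add: projector_sites_def)
      then show ?thesis using some[OF e] sC by blast
    next
      case False
      then show ?thesis using sC by (auto simp: projector_sites_def)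
    qed
  qed
qed

theorem theorem5p3:
  fixes R :: "'h diagram \<Rightarrow> 'h set \<Rightarrow> laurent"
    and D :: "'h diagram"
    and A d :: "'a::field"
  assumes "generalized_yamada R"
    and "is_diagram D"
    and "A \<noteq> 0"
    and "d = - (A ^ 2) - A powi (-2)"
    and "d \<noteq> 0"
  shows "laurent_eval (A ^ 4) (- inverse d) (R D {}) =
         d * linear_bracket A (inverse A) d (projected_diagram d D)"
proof -
  \<comment> \<open>The mate function is an involution only on the half-edges of \<open>D\<close>.\<close>
  define m where "m = (\<lambda>h. if h \<in> half_edges D then mate D h else h)"
  have wf: "well_formed D" by (rule is_diagram_well_formed[OF assms(2)])
  have "m (m h) = h" for h using wf by (simp add: m_def well_formed_def)
  then interpret skein m A d
    by unfold_locales (use assms in auto)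
  have m: "mate D h = m h" if "h \<in> half_edges D" for h using that by (simp add: m_def)
  let ?T = "projector_sites D"
  have "laurent_eval (A ^ 4) (- inverse d) (R D {}) = cable_sum D ?T"
  proof (rule evaluate_eq_cable_sum[OF assms(1,2)])
    show "is_marking D {}" by (simp add: is_marking_def)
    show "crossing_half_edges D \<subseteq> ?T" by (auto simp: projector_sites_def)
  qed (use m projector_sites_hit[OF assms(2)] in auto)
  also have "\<dots> = (\<Sum>S\<in>Pow ?T. (- (1 / d)) ^ card S * (d * bracket A (inverse A) d (cable_diagram S D)))"
    unfolding cable_sum_def project_def
    by (subst bracket_eq_state_sum[OF assms(2)]) (simp_all add: m)
  also have "\<dots> = d * linear_bracket A (inverse A) d (projected_diagram d D)"
    unfolding linear_bracket_projected sum_distrib_left by (simp only: mult.left_commute)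
  finally show ?thesis .
qed

end
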